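(* Let $\mathcal T$ be a triangulated category with coproducts, and let $(\mathcal T^{\le0},\mathcal T^{\ge0})$ be a $t$-structure on $\mathcal T$. If there exist an integer $A>0$ and a compact generator $G\in\mathcal T$ with $\mathrm{Hom}(\Sigma^{-A}G,\mathcal T^{\le0})=0$, then $\mathcal T^b_c\subset\mathcal T^-_c$ are triangulated subcategories of $\mathcal T$. If furthermore $G\in\mathcal T^-$, then $\mathcal T^b_c\subset\mathcal T^-_c$ are thick subcategories of $\mathcal T^-$.
   Context: $\Sigma$ is the suspension; $\mathcal T^c$ is the full subcategory of compact objects. For the given $t$-structure put $\mathcal T^{\le n}=\Sigma^{-n}\mathcal T^{\le0}$, $\mathcal T^{\ge n}=\Sigma^{-n}\mathcal T^{\ge0}$, $\mathcal T^-=\bigcup_{m>0}\mathcal T^{\le m}$, $\mathcal T^+=\bigcup_{m>0}\mathcal T^{\ge-m}$, $\mathcal T^b=\mathcal T^-\cap\mathcal T^+$. $\mathcal T^-_c\subset\mathcal T$ is the full subcategory of all objects $F$ such that, for every integer $m>0$, there exists a triangle $E\to F\to D\to\Sigma E$ with $E\in\mathcal T^c$ and $D\in\mathcal T^{\le-m}$. $\mathcal T^b_c=\mathcal T^-_c\cap\mathcal T^b$. A subcategory is thick if it is triangulated and closed under direct summands. *)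

theory Defs
  imports "HOL-Algebra.FiniteProduct" "HOL-Algebra.Product_Groups"
begin

section \<open>Categories and additive categories\<close>

record ('o, 'm) cat_data =
  Obj :: "'o set"
  Arr :: "'m set"
  Dom :: "'m \<Rightarrow> 'o"
  Cod :: "'m \<Rightarrow> 'o"
  Id :: "'o \<Rightarrow> 'm"
  Comp :: "'m \<Rightarrow> 'm \<Rightarrow> 'm" (infixl \<open>\<bullet>\<index>\<close> 70)

definition Hom :: "('o, 'm, 'e) cat_data_scheme \<Rightarrow> 'o \<Rightarrow> 'o \<Rightarrow> 'm set" where
  "Hom C X Y = {f \<in> Arr C. Dom C f = X \<and> Cod C f = Y}"

locale category =
  fixes C (structure)
  assumes dom_in_obj: "f \<in> Arr C \<Longrightarrow> Dom C f \<in> Obj C"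
    and cod_in_obj: "f \<in> Arr C \<Longrightarrow> Cod C f \<in> Obj C"
    and id_in_hom: "X \<in> Obj C \<Longrightarrow> Id C X \<in> Hom C X X"
    and comp_in_hom: "\<lbrakk>f \<in> Hom C X Y; g \<in> Hom C Y Z\<rbrakk> \<Longrightarrow> g \<bullet> f \<in> Hom C X Z"
    and comp_id: "f \<in> Hom C X Y \<Longrightarrow> f \<bullet> Id C X = f"
    and id_comp: "f \<in> Hom C X Y \<Longrightarrow> Id C Y \<bullet> f = f"
    and comp_assoc: "\<lbrakk>f \<in> Hom C W X; g \<in> Hom C X Y; h \<in> Hom C Y Z\<rbrakk>
      \<Longrightarrow> (h \<bullet> g) \<bullet> f = h \<bullet> (g \<bullet> f)"

definition is_iso :: "('o, 'm, 'e) cat_data_scheme \<Rightarrow> 'm \<Rightarrow> bool" where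
  "is_iso C f \<longleftrightarrow> f \<in> Arr C \<and>
    (\<exists>g \<in> Hom C (Cod C f) (Dom C f).
      g \<bullet>\<^bsub>C\<^esub> f = Id C (Dom C f) \<and> f \<bullet>\<^bsub>C\<^esub> g = Id C (Cod C f))"

definition isomorphic :: "('o, 'm, 'e) cat_data_scheme \<Rightarrow> 'o \<Rightarrow> 'o \<Rightarrow> bool" where
  "isomorphic C X Y \<longleftrightarrow> (\<exists>f \<in> Hom C X Y. is_iso C f)"

definition zero_object :: "('o, 'm, 'e) cat_data_scheme \<Rightarrow> 'o \<Rightarrow> bool" where
  "zero_object C Z \<longleftrightarrow> Z \<in> Obj C \<and>
    (\<forall>X \<in> Obj C. (\<exists>!f. f \<in> Hom C X Z) \<and> (\<exists>!f. f \<in> Hom C Z X))"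

text \<open>A full subcategory is represented by its set of objects; it is strictly full if this
  set is closed under isomorphism.\<close>

definition strictly_full :: "('o, 'm, 'e) cat_data_scheme \<Rightarrow> 'o set \<Rightarrow> bool" where
  "strictly_full C S \<longleftrightarrow> S \<subseteq> Obj C \<and>
    (\<forall>X \<in> S. \<forall>Y \<in> Obj C. isomorphic C X Y \<longrightarrow> Y \<in> S)"

record ('o, 'm) preadd_data = "('o, 'm) cat_data" +
  Add :: "'m \<Rightarrow> 'm \<Rightarrow> 'm" (infixl \<open>\<boxplus>\<index>\<close> 65)
  Zero :: "'o \<Rightarrow> 'o \<Rightarrow> 'm"

definition hom_group :: "('o, 'm, 'e) preadd_data_scheme \<Rightarrow> 'o \<Rightarrow> 'o \<Rightarrow> 'm monoid" where
  "hom_group C X Y = \<lparr>carrier = Hom C X Y, monoid.mult = Add C, one = Zero C X Y\<rparr>"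

definition neg :: "('o, 'm, 'e) preadd_data_scheme \<Rightarrow> 'm \<Rightarrow> 'm" where
  "neg C f = inv\<^bsub>hom_group C (Dom C f) (Cod C f)\<^esub> f"

definition biproduct ::
    "('o, 'm, 'e) preadd_data_scheme \<Rightarrow> 'o \<Rightarrow> 'o \<Rightarrow> 'o \<Rightarrow> 'm \<Rightarrow> 'm \<Rightarrow> 'm \<Rightarrow> 'm \<Rightarrow> bool" where
  "biproduct C X Y Z i j p q \<longleftrightarrow>
    i \<in> Hom C X Z \<and> j \<in> Hom C Y Z \<and> p \<in> Hom C Z X \<and> q \<in> Hom C Z Y \<and>
    p \<bullet>\<^bsub>C\<^esub> i = Id C X \<and> q \<bullet>\<^bsub>C\<^esub> j = Id C Y \<and>
    p \<bullet>\<^bsub>C\<^esub> j = Zero C Y X \<and> q \<bullet>\<^bsub>C\<^esub> i = Zero C X Y \<and>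
    (i \<bullet>\<^bsub>C\<^esub> p) \<boxplus>\<^bsub>C\<^esub> (j \<bullet>\<^bsub>C\<^esub> q) = Id C Z"

definition is_biproduct :: "('o, 'm, 'e) preadd_data_scheme \<Rightarrow> 'o \<Rightarrow> 'o \<Rightarrow> 'o \<Rightarrow> bool" where
  "is_biproduct C X Y Z \<longleftrightarrow> (\<exists>i j p q. biproduct C X Y Z i j p q)"

locale additive_category = category C for C (structure) +
  assumes hom_comm_group: "\<lbrakk>X \<in> Obj C; Y \<in> Obj C\<rbrakk> \<Longrightarrow> comm_group (hom_group C X Y)"
    and comp_add_left: "\<lbrakk>f \<in> Hom C X Y; g \<in> Hom C Y Z; g' \<in> Hom C Y Z\<rbrakk>
      \<Longrightarrow> (g \<boxplus> g') \<bullet> f = (g \<bullet> f) \<boxplus> (g' \<bullet> f)"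
    and comp_add_right: "\<lbrakk>f \<in> Hom C X Y; f' \<in> Hom C X Y; g \<in> Hom C Y Z\<rbrakk>
      \<Longrightarrow> g \<bullet> (f \<boxplus> f') = (g \<bullet> f) \<boxplus> (g \<bullet> f')"
    and ex_zero_object: "\<exists>Z. zero_object C Z"
    and ex_biproduct: "\<lbrakk>X \<in> Obj C; Y \<in> Obj C\<rbrakk> \<Longrightarrow> \<exists>Z \<in> Obj C. is_biproduct C X Y Z"

section \<open>Triangulated categories\<close>

text \<open>\<open>SuspO\<close> and \<open>SuspM\<close> are the action of the suspension on objects and on morphisms.
  A triple \<open>(f, g, h)\<close> in \<open>Tri\<close> is a distinguished triangle; its objects are recovered as the
  domains and codomains of the three morphisms.\<close>

record ('o, 'm) tri_data = "('o, 'm) preadd_data" +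
  SuspO :: "'o \<Rightarrow> 'o"
  SuspM :: "'m \<Rightarrow> 'm"
  Tri :: "('m \<times> 'm \<times> 'm) set"

text \<open>The suspension is an additive automorphism of the category, so that integer powers of it
  make sense on the nose. The axioms for triangles are Verdier's, \<open>octahedral\<close> being (TR4).\<close>

locale triangulated_category = additive_category T for T (structure) +
  assumes susp_obj_bij: "bij_betw (SuspO T) (Obj T) (Obj T)"
    and susp_arr_bij: "bij_betw (SuspM T) (Arr T) (Arr T)"
    and susp_hom: "f \<in> Hom T X Y \<Longrightarrow> SuspM T f \<in> Hom T (SuspO T X) (SuspO T Y)"
    and susp_id: "X \<in> Obj T \<Longrightarrow> SuspM T (Id T X) = Id T (SuspO T X)"
    and susp_comp: "\<lbrakk>f \<in> Hom T X Y; g \<in> Hom T Y Z\<rbrakk>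
      \<Longrightarrow> SuspM T (g \<bullet> f) = SuspM T g \<bullet> SuspM T f"
    and susp_add: "\<lbrakk>f \<in> Hom T X Y; f' \<in> Hom T X Y\<rbrakk>
      \<Longrightarrow> SuspM T (f \<boxplus> f') = SuspM T f \<boxplus> SuspM T f'"
    and tri_shape: "(f, g, h) \<in> Tri T \<Longrightarrow>
      \<exists>X Y Z. f \<in> Hom T X Y \<and> g \<in> Hom T Y Z \<and> h \<in> Hom T Z (SuspO T X)"
    and tri_iso: "\<lbrakk>(f, g, h) \<in> Tri T;
        f \<in> Hom T X Y; g \<in> Hom T Y Z; h \<in> Hom T Z (SuspO T X);
        f' \<in> Hom T X' Y'; g' \<in> Hom T Y' Z'; h' \<in> Hom T Z' (SuspO T X');
        a \<in> Hom T X X'; b \<in> Hom T Y Y'; c \<in> Hom T Z Z';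
        is_iso T a; is_iso T b; is_iso T c;
        b \<bullet> f = f' \<bullet> a; c \<bullet> g = g' \<bullet> b; SuspM T a \<bullet> h = h' \<bullet> c\<rbrakk>
      \<Longrightarrow> (f', g', h') \<in> Tri T"
    and tri_id: "\<lbrakk>X \<in> Obj T; zero_object T Z\<rbrakk>
      \<Longrightarrow> (Id T X, Zero T X Z, Zero T Z (SuspO T X)) \<in> Tri T"
    and tri_cone: "f \<in> Arr T \<Longrightarrow> \<exists>g h. (f, g, h) \<in> Tri T"
    and tri_rotate: "\<lbrakk>f \<in> Hom T X Y; g \<in> Hom T Y Z; h \<in> Hom T Z (SuspO T X)\<rbrakk>
      \<Longrightarrow> (f, g, h) \<in> Tri T \<longleftrightarrow> (g, h, neg T (SuspM T f)) \<in> Tri T"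
    and tri_morphism: "\<lbrakk>(f, g, h) \<in> Tri T; (f', g', h') \<in> Tri T;
        a \<in> Hom T (Dom T f) (Dom T f'); b \<in> Hom T (Cod T f) (Cod T f'); b \<bullet> f = f' \<bullet> a\<rbrakk>
      \<Longrightarrow> \<exists>c \<in> Hom T (Cod T g) (Cod T g'). c \<bullet> g = g' \<bullet> b \<and> SuspM T a \<bullet> h = h' \<bullet> c"
    and octahedral: "\<lbrakk>f \<in> Hom T X Y; g \<in> Hom T Y Z;
        (f, i, j) \<in> Tri T; (g \<bullet> f, k, l) \<in> Tri T; (g, m, n) \<in> Tri T\<rbrakk>
      \<Longrightarrow> \<exists>u v. u \<in> Hom T (Cod T i) (Cod T k) \<and> v \<in> Hom T (Cod T k) (Cod T m) \<and>
            (u, v, SuspM T i \<bullet> n) \<in> Tri T \<and>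
            u \<bullet> i = k \<bullet> g \<and> l \<bullet> u = j \<and> v \<bullet> k = m \<and> n \<bullet> v = SuspM T f \<bullet> l"

definition shift :: "('o, 'm, 'e) tri_data_scheme \<Rightarrow> int \<Rightarrow> 'o \<Rightarrow> 'o" where
  "shift T n X = (if n \<ge> 0 then (SuspO T ^^ nat n) X
                  else (inv_into (Obj T) (SuspO T) ^^ nat (- n)) X)"

definition triangulated_subcategory :: "('o, 'm, 'e) tri_data_scheme \<Rightarrow> 'o set \<Rightarrow> bool" where
  "triangulated_subcategory T S \<longleftrightarrow>
    strictly_full T S \<and>
    (\<exists>Z \<in> S. zero_object T Z) \<and>
    (\<forall>X \<in> S. \<forall>Y \<in> S. \<forall>Z \<in> Obj T. is_biproduct T X Y Z \<longrightarrow> Z \<in> S) \<and>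
    SuspO T ` S = S \<and>
    (\<forall>f g h. (f, g, h) \<in> Tri T \<and> Dom T f \<in> S \<and> Cod T f \<in> S \<longrightarrow> Cod T g \<in> S)"

text \<open>Thickness of \<open>S\<close> relative to an ambient triangulated subcategory \<open>D\<close>: the direct
  summands are those formed inside \<open>D\<close>.\<close>

definition thick_subcategory_of ::
    "('o, 'm, 'e) tri_data_scheme \<Rightarrow> 'o set \<Rightarrow> 'o set \<Rightarrow> bool" where
  "thick_subcategory_of T D S \<longleftrightarrow>
    triangulated_subcategory T D \<and> S \<subseteq> D \<and> triangulated_subcategory T S \<and>
    (\<forall>Z \<in> S. \<forall>X \<in> D. \<forall>Y \<in> D. is_biproduct T X Y Z \<longrightarrow> X \<in> S)"

section \<open>Smallness, coproducts and compact objects\<close>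

text \<open>``Small'' means of cardinality less than \<open>'u\<close>, where \<open>'u\<close> is a type parameter in the role
  of a Grothendieck universe. Strict inequality is essential: a category with at most
  \<open>\<lambda>\<close> morphisms between any two objects and with coproducts indexed by sets of cardinality
  \<open>\<lambda>\<close> is a preorder. Conversely, a locally small nonzero additive category with
  small coproducts forces the cardinality of \<open>'u\<close> to be regular and a strong limit, so
  these closure properties of the universe need not be assumed.\<close>

definition small :: "'u itself \<Rightarrow> 'a set \<Rightarrow> bool" where
  "small _ A \<longleftrightarrow> (card_of A, card_of (UNIV :: 'u set)) \<in> ordLess"

definition locally_small :: "'u itself \<Rightarrow> ('o, 'm, 'e) cat_data_scheme \<Rightarrow> bool" where
  "locally_small U C \<longleftrightarrow> (\<forall>X \<in> Obj C. \<forall>Y \<in> Obj C. small U (Hom C X Y))"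

definition is_coproduct ::
    "('o, 'm, 'e) cat_data_scheme \<Rightarrow> 'i set \<Rightarrow> ('i \<Rightarrow> 'o) \<Rightarrow> 'o \<Rightarrow> ('i \<Rightarrow> 'm) \<Rightarrow> bool" where
  "is_coproduct C I X S \<iota> \<longleftrightarrow>
    S \<in> Obj C \<and> (\<forall>i \<in> I. X i \<in> Obj C \<and> \<iota> i \<in> Hom C (X i) S) \<and>
    (\<forall>Y \<in> Obj C. \<forall>g. (\<forall>i \<in> I. g i \<in> Hom C (X i) Y) \<longrightarrow>
      (\<exists>!h. h \<in> Hom C S Y \<and> (\<forall>i \<in> I. h \<bullet>\<^bsub>C\<^esub> \<iota> i = g i)))"

text \<open>Every small set is in bijection with a small subset of \<open>'u\<close>, so index sets may be taken
  there.\<close>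

definition has_coproducts :: "'u itself \<Rightarrow> ('o, 'm, 'e) cat_data_scheme \<Rightarrow> bool" where
  "has_coproducts U C \<longleftrightarrow>
    (\<forall>(I :: 'u set) X. small U I \<and> (\<forall>i \<in> I. X i \<in> Obj C) \<longrightarrow> (\<exists>S \<iota>. is_coproduct C I X S \<iota>))"

text \<open>The canonical map from the direct sum of the groups \<open>Hom C G (X i)\<close> to
  \<open>Hom C G S\<close>. The product is HOL-Algebra's multiplicative name for the sum in
  \<open>hom_group\<close>, taken over the finite support.\<close>

definition coproduct_comparison ::
    "('o, 'm, 'e) preadd_data_scheme \<Rightarrow> 'o \<Rightarrow> 'i set \<Rightarrow> ('i \<Rightarrow> 'o) \<Rightarrow> 'o \<Rightarrow> ('i \<Rightarrow> 'm)
      \<Rightarrow> ('i \<Rightarrow> 'm) \<Rightarrow> 'm" where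
  "coproduct_comparison C G I X S \<iota> x =
    finprod (hom_group C G S) (\<lambda>i. \<iota> i \<bullet>\<^bsub>C\<^esub> x i) {i \<in> I. x i \<noteq> Zero C G (X i)}"

definition compact_object :: "'u itself \<Rightarrow> ('o, 'm, 'e) preadd_data_scheme \<Rightarrow> 'o \<Rightarrow> bool" where
  "compact_object U C G \<longleftrightarrow> G \<in> Obj C \<and>
    (\<forall>(I :: 'u set) X S \<iota>. small U I \<and> is_coproduct C I X S \<iota> \<longrightarrow>
      coproduct_comparison C G I X S \<iota>
        \<in> iso (sum_group I (\<lambda>i. hom_group C G (X i))) (hom_group C G S))"

definition compact_generator :: "'u itself \<Rightarrow> ('o, 'm, 'e) tri_data_scheme \<Rightarrow> 'o \<Rightarrow> bool" where
  "compact_generator U T G \<longleftrightarrow> compact_object U T G \<and>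
    (\<forall>X \<in> Obj T. (\<forall>n. Hom T (shift T n G) X = {Zero T (shift T n G) X}) \<longrightarrow> zero_object T X)"

section \<open>t-structures and the associated subcategories\<close>

text \<open>\<open>L\<close> and \<open>R\<close> stand for the aisle $T^{\le 0}$ and the coaisle $T^{\ge 0}$.\<close>

definition T_le :: "('o, 'm, 'e) tri_data_scheme \<Rightarrow> 'o set \<Rightarrow> int \<Rightarrow> 'o set" where
  "T_le T L n = shift T (- n) ` L"

definition T_ge :: "('o, 'm, 'e) tri_data_scheme \<Rightarrow> 'o set \<Rightarrow> int \<Rightarrow> 'o set" where
  "T_ge T R n = shift T (- n) ` R"

definition t_structure :: "('o, 'm, 'e) tri_data_scheme \<Rightarrow> 'o set \<Rightarrow> 'o set \<Rightarrow> bool" where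
  "t_structure T L R \<longleftrightarrow>
    strictly_full T L \<and> strictly_full T R \<and>
    T_le T L 0 \<subseteq> T_le T L 1 \<and> T_ge T R 1 \<subseteq> T_ge T R 0 \<and>
    (\<forall>X \<in> T_le T L 0. \<forall>Y \<in> T_ge T R 1. Hom T X Y = {Zero T X Y}) \<and>
    (\<forall>X \<in> Obj T. \<exists>A \<in> T_le T L 0. \<exists>B \<in> T_ge T R 1. \<exists>f g h.
      (f, g, h) \<in> Tri T \<and> f \<in> Hom T A X \<and> g \<in> Hom T X B)"

definition T_minus :: "('o, 'm, 'e) tri_data_scheme \<Rightarrow> 'o set \<Rightarrow> 'o set" where
  "T_minus T L = (\<Union>m \<in> {0<..}. T_le T L m)"

definition T_plus :: "('o, 'm, 'e) tri_data_scheme \<Rightarrow> 'o set \<Rightarrow> 'o set" where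
  "T_plus T R = (\<Union>m \<in> {0<..}. T_ge T R (- m))"

definition T_b :: "('o, 'm, 'e) tri_data_scheme \<Rightarrow> 'o set \<Rightarrow> 'o set \<Rightarrow> 'o set" where
  "T_b T L R = T_minus T L \<inter> T_plus T R"

definition T_minus_c :: "'u itself \<Rightarrow> ('o, 'm, 'e) tri_data_scheme \<Rightarrow> 'o set \<Rightarrow> 'o set" where
  "T_minus_c U T L = {F \<in> Obj T. \<forall>m > 0. \<exists>E D f g h.
    compact_object U T E \<and> D \<in> T_le T L (- m) \<and>
    (f, g, h) \<in> Tri T \<and> f \<in> Hom T E F \<and> g \<in> Hom T F D}"

definition T_b_c :: "'u itself \<Rightarrow> ('o, 'm, 'e) tri_data_scheme \<Rightarrow> 'o set \<Rightarrow> 'o set \<Rightarrow> 'o set" where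
  "T_b_c U T L R = T_minus_c U T L \<inter> T_b T L R"

end

theory Submission
  imports Defs
begin

text \<open>The key is a uniformity statement for a compact object \<open>E\<close>: if the objects \<open>D n\<close> are such
  that each shift of \<open>G\<close> has nonzero maps to only finitely many of them, then so does \<open>E\<close>. Indeed,
  the tower \<open>E = W 0, W 1, \<dots>\<close> that repeatedly kills all maps from shifts of \<open>G\<close> has zero
  homotopy colimit, so by compactness \<open>E\<close> maps by zero to some \<open>W n\<close> and is a direct summand of a
  finite extension of coproducts of shifts of \<open>G\<close>. For all such objects, as for \<open>G\<close> itself, the
  coproduct of the \<open>D n\<close> behaves like their product, whereas a map from \<open>E\<close> to it has only finitely
  many nonzero components. Applied to objects \<open>D n\<close> going to minus infinity in the aisle, this shows
  that \<open>E\<close> has no maps to $T^{\le -B}$ for large \<open>B\<close>; applied to \<open>D n\<close> going to plus infinity in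
  the coaisle, it shows that compact objects lie in $T^-$ as soon as \<open>G\<close> does.

  Given a triangle \<open>X, Y, Z\<close>, the vanishing allows maps \<open>X \<rightarrow> Y\<close> to be lifted to compact
  approximations, and three octahedra show that the cone of the lift approximates \<open>Z\<close>, one degree
  better than \<open>X\<close> is approximated. For a direct sum \<open>Z = X \<oplus> Y\<close> this gain is traded back and forth
  between \<open>X\<close> and \<open>Y\<close>, which gives thickness.\<close>

section \<open>Arithmetic of morphisms\<close>

text \<open>A compact object is not shown to lie in the thick closure of \<open>G\<close>; the tower
  only makes it a summand of a finite extension of infinite coproducts in which all shifts of
  \<open>G\<close> occur. The bound below which the aisle receives no maps from a shift of
  \<open>G\<close> depends on the shift, and having nonzero maps to only finitely many
  \<open>D n\<close> is lost in an infinite coproduct, so neither condition can be carried up the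
  tower. What survives is that Hom(-, S) is the product of the Hom(-, D n): both sides turn
  coproducts into products, and the five lemma handles extensions. Compactness of \<open>G\<close>
  makes the coproduct of the \<open>D n\<close> act as a product and makes the cone of the telescope
  vanish. Compactness of \<open>E\<close> finds the stage of the tower at which \<open>E\<close>
  dies, and bounds the number of nonzero components of the map assembled at the end.

  Compactness itself is handled as a finite support condition, equivalent to the comparison map
  being an isomorphism. Support can be followed along a triangle by composing with an endomorphism
  of the coproduct that kills finitely many summands.\<close>

context category
begin

text \<open>The object conditions are included so that unfolding a Hom membership supplies the side
  conditions of the simp rules below.\<close>

lemma in_hom: "f \<in> Hom C X Y \<longleftrightarrow> f \<in> Arr C \<and> Dom C f = X \<and> Cod C f = Y \<and> X \<in> Obj C \<and> Y \<in> Obj C"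
  unfolding Hom_def using dom_in_obj cod_in_obj by auto

lemma id_simps [simp]:
  assumes "X \<in> Obj C"
  shows "Id C X \<in> Arr C" "Dom C (Id C X) = X" "Cod C (Id C X) = X"
  using id_in_hom[OF assms] by (auto simp: in_hom)

lemma comp_simps [simp]:
  assumes "f \<in> Arr C" "g \<in> Arr C" "Cod C f = Dom C g"
  shows "g \<bullet> f \<in> Arr C" "Dom C (g \<bullet> f) = Dom C f" "Cod C (g \<bullet> f) = Cod C g"
proof -
  have "f \<in> Hom C (Dom C f) (Dom C g)" "g \<in> Hom C (Dom C g) (Cod C g)"
    using assms by (auto simp: Hom_def)
  from comp_in_hom[OF this]
  show "g \<bullet> f \<in> Arr C" "Dom C (g \<bullet> f) = Dom C f" "Cod C (g \<bullet> f) = Cod C g"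
    by (auto simp: Hom_def)
qed

lemma comp_id_simps [simp]:
  assumes "f \<in> Arr C"
  shows "Dom C f = X \<Longrightarrow> f \<bullet> Id C X = f" "Cod C f = X \<Longrightarrow> Id C X \<bullet> f = f"
  using comp_id id_comp assms by (auto simp: Hom_def)

lemma comp_assoc_simp [simp]:
  assumes "f \<in> Arr C" "g \<in> Arr C" "h \<in> Arr C" "Cod C f = Dom C g" "Cod C g = Dom C h"
  shows "(h \<bullet> g) \<bullet> f = h \<bullet> (g \<bullet> f)"
  by (rule comp_assoc) (use assms in \<open>auto simp: Hom_def\<close>)

text \<open>Composites are normalized to be nested to the right, which hides a known composite
  \<open>g \<bullet> f\<close> inside \<open>g \<bullet> (f \<bullet> x)\<close>; this rule rewrites
  it there.\<close>

lemma comp_reassoc: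
  assumes "g \<bullet> f = k" "f \<in> Arr C" "g \<in> Arr C" "x \<in> Arr C" "Cod C x = Dom C f" "Cod C f = Dom C g"
  shows "g \<bullet> (f \<bullet> x) = k \<bullet> x"
  using comp_assoc_simp[of x f g] assms by simp

lemma isoI:
  assumes "f \<in> Hom C X Y" "g \<in> Hom C Y X" "g \<bullet> f = Id C X" "f \<bullet> g = Id C Y"
  shows "is_iso C f"
  using assms by (auto simp: is_iso_def Hom_def)

lemma iso_id: "X \<in> Obj C \<Longrightarrow> is_iso C (Id C X)"
  by (rule isoI[of _ X X "Id C X"]) (auto simp: in_hom)

lemma isomorphicE:
  assumes "isomorphic C X Y"
  obtains f g where "f \<in> Hom C X Y" "g \<in> Hom C Y X" "g \<bullet> f = Id C X" "f \<bullet> g = Id C Y"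
    "is_iso C f"
proof -
  obtain f where f: "f \<in> Hom C X Y" "is_iso C f" using assms by (auto simp: isomorphic_def)
  then have "Dom C f = X" "Cod C f = Y" by (auto simp: Hom_def)
  with f(2) obtain g where "g \<in> Hom C Y X" "g \<bullet> f = Id C X" "f \<bullet> g = Id C Y"
    by (auto simp: is_iso_def)
  with f that show thesis by blast
qed

end

context additive_category
begin

lemma hom_group_simps [simp]:
  "carrier (hom_group C X Y) = Hom C X Y"
  "monoid.mult (hom_group C X Y) f g = f \<boxplus> g"
  "\<one>\<^bsub>hom_group C X Y\<^esub> = Zero C X Y"
  by (auto simp: hom_group_def)

lemma zero_simps [simp]:
  assumes "X \<in> Obj C" "Y \<in> Obj C"
  shows "Zero C X Y \<in> Arr C" "Dom C (Zero C X Y) = X" "Cod C (Zero C X Y) = Y"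
proof -
  interpret G: comm_group "hom_group C X Y" by (rule hom_comm_group[OF assms])
  show "Zero C X Y \<in> Arr C" "Dom C (Zero C X Y) = X" "Cod C (Zero C X Y) = Y"
    using G.one_closed by (auto simp: in_hom)
qed

lemma zero_in_hom: "X \<in> Obj C \<Longrightarrow> Y \<in> Obj C \<Longrightarrow> Zero C X Y \<in> Hom C X Y"
  by (simp add: in_hom)

lemma add_simps [simp]:
  assumes "f \<in> Arr C" "g \<in> Arr C" "Dom C f = Dom C g" "Cod C f = Cod C g"
  shows "f \<boxplus> g \<in> Arr C" "Dom C (f \<boxplus> g) = Dom C f" "Cod C (f \<boxplus> g) = Cod C f"
proof -
  interpret G: comm_group "hom_group C (Dom C f) (Cod C f)"
    by (rule hom_comm_group) (use assms dom_in_obj cod_in_obj in auto)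
  have "f \<boxplus> g \<in> Hom C (Dom C f) (Cod C f)"
    using G.m_closed[of f g] assms by (auto simp: Hom_def)
  then show "f \<boxplus> g \<in> Arr C" "Dom C (f \<boxplus> g) = Dom C f" "Cod C (f \<boxplus> g) = Cod C f"
    by (auto simp: Hom_def)
qed

lemma neg_simps [simp]:
  assumes "f \<in> Arr C"
  shows "neg C f \<in> Arr C" "Dom C (neg C f) = Dom C f" "Cod C (neg C f) = Cod C f"
    "neg C f \<boxplus> f = Zero C (Dom C f) (Cod C f)"
    "f \<boxplus> neg C f = Zero C (Dom C f) (Cod C f)"
    "neg C (neg C f) = f"
proof -
  interpret G: comm_group "hom_group C (Dom C f) (Cod C f)"
    by (rule hom_comm_group) (use assms dom_in_obj cod_in_obj in auto)
  have f: "f \<in> carrier (hom_group C (Dom C f) (Cod C f))" using assms by (auto simp: Hom_def)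
  have "neg C f \<in> Hom C (Dom C f) (Cod C f)"
    using G.inv_closed[OF f] by (simp add: neg_def)
  then show *: "neg C f \<in> Arr C" "Dom C (neg C f) = Dom C f" "Cod C (neg C f) = Cod C f"
    by (auto simp: Hom_def)
  show "neg C f \<boxplus> f = Zero C (Dom C f) (Cod C f)" using G.l_inv[OF f] by (simp add: neg_def)
  show "f \<boxplus> neg C f = Zero C (Dom C f) (Cod C f)" using G.r_inv[OF f] by (simp add: neg_def)
  show "neg C (neg C f) = f" using * G.inv_inv[OF f] by (simp add: neg_def)
qed

lemma add_zero [simp]:
  assumes "f \<in> Arr C" "Dom C f = X" "Cod C f = Y"
  shows "f \<boxplus> Zero C X Y = f" "Zero C X Y \<boxplus> f = f"
proof -
  have "X \<in> Obj C" "Y \<in> Obj C" using assms dom_in_obj cod_in_obj by auto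
  then interpret G: comm_group "hom_group C X Y" by (rule hom_comm_group)
  have f: "f \<in> carrier (hom_group C X Y)" using assms by (auto simp: Hom_def)
  show "f \<boxplus> Zero C X Y = f" "Zero C X Y \<boxplus> f = f" using G.r_one[OF f] G.l_one[OF f] by simp_all
qed

lemma add_assoc:
  assumes "f \<in> Hom C X Y" "g \<in> Hom C X Y" "h \<in> Hom C X Y"
  shows "f \<boxplus> g \<boxplus> h = f \<boxplus> (g \<boxplus> h)"
proof -
  interpret G: comm_group "hom_group C X Y" by (rule hom_comm_group) (use assms in \<open>auto simp: in_hom\<close>)
  show ?thesis using G.m_assoc[of f g h] assms by simp
qed

lemma add_comm:
  assumes "f \<in> Hom C X Y" "g \<in> Hom C X Y"
  shows "f \<boxplus> g = g \<boxplus> f"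
proof -
  interpret G: comm_group "hom_group C X Y" by (rule hom_comm_group) (use assms in \<open>auto simp: in_hom\<close>)
  show ?thesis using G.m_comm[of f g] assms by simp
qed

lemma diff_zero_imp_eq:
  assumes "f \<in> Hom C X Y" "g \<in> Hom C X Y" "f \<boxplus> neg C g = Zero C X Y"
  shows "f = g"
proof -
  interpret G: comm_group "hom_group C X Y" by (rule hom_comm_group) (use assms in \<open>auto simp: in_hom\<close>)
  have "neg C g = inv\<^bsub>hom_group C X Y\<^esub> g" using assms(2) by (simp add: neg_def in_hom)
  with assms(3) have "monoid.mult (hom_group C X Y) f (inv\<^bsub>hom_group C X Y\<^esub> g) = \<one>\<^bsub>hom_group C X Y\<^esub>"
    by simp
  then have "inv\<^bsub>hom_group C X Y\<^esub> (inv\<^bsub>hom_group C X Y\<^esub> g) = f"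
    by (rule G.inv_equality) (use assms G.inv_closed[of g] in auto)
  then show ?thesis using assms G.inv_inv[of g] by simp
qed

lemma add_eq_self_imp_zero:
  assumes "f \<in> Hom C X Y" "f \<boxplus> f = f"
  shows "f = Zero C X Y"
proof -
  interpret G: comm_group "hom_group C X Y" by (rule hom_comm_group) (use assms in \<open>auto simp: in_hom\<close>)
  show ?thesis using G.l_cancel_one[of f f] assms by simp
qed

text \<open>By bilinearity such a composite equals its own double, hence is zero.\<close>

lemma comp_zero_simps [simp]:
  assumes "f \<in> Arr C"
  shows "Cod C f = Y \<Longrightarrow> Z \<in> Obj C \<Longrightarrow> Zero C Y Z \<bullet> f = Zero C (Dom C f) Z"
    "Dom C f = Y \<Longrightarrow> X \<in> Obj C \<Longrightarrow> f \<bullet> Zero C X Y = Zero C X (Cod C f)"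
proof -
  show "Zero C Y Z \<bullet> f = Zero C (Dom C f) Z" if "Cod C f = Y" "Z \<in> Obj C"
  proof (rule add_eq_self_imp_zero)
    have Y: "Y \<in> Obj C" "Dom C f \<in> Obj C" using that assms cod_in_obj dom_in_obj by auto
    show "Zero C Y Z \<bullet> f \<in> Hom C (Dom C f) Z" using assms that Y by (simp add: in_hom)
    show "(Zero C Y Z \<bullet> f) \<boxplus> (Zero C Y Z \<bullet> f) = Zero C Y Z \<bullet> f"
      using comp_add_left[of f "Dom C f" Y "Zero C Y Z" Z "Zero C Y Z"] assms that Y by (simp add: in_hom)
  qed
  show "f \<bullet> Zero C X Y = Zero C X (Cod C f)" if "Dom C f = Y" "X \<in> Obj C"
  proof (rule add_eq_self_imp_zero)
    have Y: "Y \<in> Obj C" "Cod C f \<in> Obj C" using that assms cod_in_obj dom_in_obj by auto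
    show "f \<bullet> Zero C X Y \<in> Hom C X (Cod C f)" using assms that Y by (simp add: in_hom)
    show "(f \<bullet> Zero C X Y) \<boxplus> (f \<bullet> Zero C X Y) = f \<bullet> Zero C X Y"
      using comp_add_right[of "Zero C X Y" X Y "Zero C X Y" f "Cod C f"] assms that Y by (simp add: in_hom)
  qed
qed

lemma comp_add_left_simp [simp]:
  assumes "f \<in> Arr C" "g \<in> Arr C" "g' \<in> Arr C"
    and "Dom C g = Cod C f" "Dom C g' = Cod C f" "Cod C g = Cod C g'"
  shows "(g \<boxplus> g') \<bullet> f = (g \<bullet> f) \<boxplus> (g' \<bullet> f)"
  by (rule comp_add_left) (use assms in \<open>auto simp: Hom_def\<close>)

lemma comp_add_right_simp [simp]:
  assumes "f \<in> Arr C" "f' \<in> Arr C" "g \<in> Arr C"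
    and "Cod C f = Dom C g" "Cod C f' = Dom C g" "Dom C f = Dom C f'"
  shows "g \<bullet> (f \<boxplus> f') = (g \<bullet> f) \<boxplus> (g \<bullet> f')"
  by (rule comp_add_right) (use assms in \<open>auto simp: Hom_def\<close>)

lemma neg_unique:
  assumes "f \<in> Hom C X Y" "g \<in> Hom C X Y" "f \<boxplus> g = Zero C X Y"
  shows "f = neg C g"
  by (rule diff_zero_imp_eq) (use assms in \<open>auto simp: in_hom\<close>)

lemma comp_neg_simps [simp]:
  assumes "f \<in> Arr C" "g \<in> Arr C" "Cod C f = Dom C g"
  shows "neg C g \<bullet> f = neg C (g \<bullet> f)" "g \<bullet> neg C f = neg C (g \<bullet> f)"
proof -
  have ob: "Dom C f \<in> Obj C" "Dom C g \<in> Obj C" "Cod C g \<in> Obj C"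
    using assms dom_in_obj cod_in_obj by auto
  have "(neg C g \<bullet> f) \<boxplus> (g \<bullet> f) = (neg C g \<boxplus> g) \<bullet> f"
    using assms by (simp del: neg_simps(4))
  then show "neg C g \<bullet> f = neg C (g \<bullet> f)"
    using assms ob by (intro neg_unique[of _ "Dom C f" "Cod C g"]) (auto simp: in_hom)
  have "(g \<bullet> neg C f) \<boxplus> (g \<bullet> f) = g \<bullet> (neg C f \<boxplus> f)"
    using assms by (simp del: neg_simps(4))
  then show "g \<bullet> neg C f = neg C (g \<bullet> f)"
    using assms ob by (intro neg_unique[of _ "Dom C f" "Cod C g"]) (auto simp: in_hom)
qed

lemma neg_zero [simp]: "X \<in> Obj C \<Longrightarrow> Y \<in> Obj C \<Longrightarrow> neg C (Zero C X Y) = Zero C X Y"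
  by (rule sym, rule neg_unique) (auto simp: in_hom)

lemma neg_eq_zero:
  assumes "f \<in> Hom C X Y" "neg C f = Zero C X Y"
  shows "f = Zero C X Y"
  using assms neg_simps(6)[of f] by (simp add: in_hom)

lemma diff_in_hom: "f \<in> Hom C X Y \<Longrightarrow> g \<in> Hom C X Y \<Longrightarrow> f \<boxplus> neg C g \<in> Hom C X Y"
  by (simp add: in_hom)

text \<open>Every map into or out of \<open>Z\<close> factors through the identity of
  \<open>Z\<close>, so it vanishes as soon as that identity does.\<close>

lemma zero_object_iff: "zero_object C Z \<longleftrightarrow> Z \<in> Obj C \<and> Id C Z = Zero C Z Z"
proof
  assume z: "zero_object C Z"
  then have "Z \<in> Obj C" "\<exists>!f. f \<in> Hom C Z Z" by (auto simp: zero_object_def)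
  then show "Z \<in> Obj C \<and> Id C Z = Zero C Z Z" by (auto simp: in_hom dest: id_in_hom zero_in_hom)
next
  assume z: "Z \<in> Obj C \<and> Id C Z = Zero C Z Z"
  show "zero_object C Z"
    unfolding zero_object_def
  proof (intro conjI ballI)
    fix X assume X: "X \<in> Obj C"
    show "\<exists>!f. f \<in> Hom C X Z"
    proof (rule ex1I[of _ "Zero C X Z"])
      fix f assume "f \<in> Hom C X Z"
      then have "f = Zero C Z Z \<bullet> f" using z comp_id_simps(2)[of f Z] by (simp add: in_hom)
      also have "\<dots> = Zero C X Z" using \<open>f \<in> Hom C X Z\<close> by (simp add: in_hom)
      finally show "f = Zero C X Z" .
    qed (use X z in \<open>simp add: in_hom\<close>)
    show "\<exists>!f. f \<in> Hom C Z X"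
    proof (rule ex1I[of _ "Zero C Z X"])
      fix f assume "f \<in> Hom C Z X"
      then have "f = f \<bullet> Zero C Z Z" using z comp_id_simps(1)[of f Z] by (simp add: in_hom)
      also have "\<dots> = Zero C Z X" using \<open>f \<in> Hom C Z X\<close> by (simp add: in_hom)
      finally show "f = Zero C Z X" .
    qed (use X z in \<open>simp add: in_hom\<close>)
  qed (use z in simp)
qed

lemma zero_object_hom:
  assumes "zero_object C Z"
  shows "f \<in> Hom C X Z \<Longrightarrow> f = Zero C X Z" "f \<in> Hom C Z X \<Longrightarrow> f = Zero C Z X"
  using assms zero_in_hom by (auto simp: zero_object_def in_hom) 

lemma zero_object_obj: "zero_object C Z \<Longrightarrow> Z \<in> Obj C"
  by (simp add: zero_object_def)

lemma comp_finprod: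
  assumes "finite F" "\<And>i. i \<in> F \<Longrightarrow> u i \<in> Hom C X Y" "r \<in> Hom C Y Z" "X \<in> Obj C"
  shows "r \<bullet> finprod (hom_group C X Y) u F = finprod (hom_group C X Z) (\<lambda>i. r \<bullet> u i) F"
  using assms(1,2)
proof (induction F rule: finite_induct)
  case empty
  have "comm_monoid (hom_group C X Y)" "comm_monoid (hom_group C X Z)"
    using assms(3,4) hom_comm_group comm_group.axioms(1) by (auto simp: in_hom)
  then show ?case using assms(3,4) by (simp add: in_hom comm_monoid.finprod_empty)
next
  case (insert i F)
  have ob: "X \<in> Obj C" "Y \<in> Obj C" "Z \<in> Obj C" using assms(3,4) by (auto simp: in_hom)
  interpret G: comm_group "hom_group C X Y" by (rule hom_comm_group) (use ob in auto)
  interpret H: comm_group "hom_group C X Z" by (rule hom_comm_group) (use ob in auto)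
  have u: "u \<in> F \<rightarrow> carrier (hom_group C X Y)" "u i \<in> Hom C X Y" using insert by auto
  have ru: "(\<lambda>i. r \<bullet> u i) \<in> F \<rightarrow> carrier (hom_group C X Z)" "r \<bullet> u i \<in> carrier (hom_group C X Z)"
    using insert.prems comp_in_hom[OF _ assms(3)] by auto
  have "finprod (hom_group C X Y) u F \<in> Hom C X Y" using G.finprod_closed[OF u(1)] by simp
  then show ?case
    using insert.hyps insert.IH insert.prems u ru assms(3)
      comp_add_right[of "u i" X Y "finprod (hom_group C X Y) u F" r Z]
    by (simp add: G.finprod_insert[simplified] H.finprod_insert[simplified] del: comp_add_left_simp comp_add_right_simp)
qed

lemma finprod_comp:
  assumes "finite F" "\<And>i. i \<in> F \<Longrightarrow> u i \<in> Hom C Y Z" "r \<in> Hom C X Y" "Z \<in> Obj C"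
  shows "finprod (hom_group C Y Z) u F \<bullet> r = finprod (hom_group C X Z) (\<lambda>i. u i \<bullet> r) F"
  using assms(1,2)
proof (induction F rule: finite_induct)
  case empty
  have "comm_monoid (hom_group C Y Z)" "comm_monoid (hom_group C X Z)"
    using assms(3,4) hom_comm_group comm_group.axioms(1) by (auto simp: in_hom)
  then show ?case using assms(3,4) by (simp add: in_hom comm_monoid.finprod_empty)
next
  case (insert i F)
  have ob: "X \<in> Obj C" "Y \<in> Obj C" "Z \<in> Obj C" using assms(3,4) by (auto simp: in_hom)
  interpret G: comm_group "hom_group C Y Z" by (rule hom_comm_group) (use ob in auto)
  interpret H: comm_group "hom_group C X Z" by (rule hom_comm_group) (use ob in auto)
  have u: "u \<in> F \<rightarrow> carrier (hom_group C Y Z)" "u i \<in> Hom C Y Z" using insert by auto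
  have ru: "(\<lambda>i. u i \<bullet> r) \<in> F \<rightarrow> carrier (hom_group C X Z)" "u i \<bullet> r \<in> carrier (hom_group C X Z)"
    using insert.prems comp_in_hom[OF assms(3)] by auto
  have "finprod (hom_group C Y Z) u F \<in> Hom C Y Z" using G.finprod_closed[OF u(1)] by simp
  then show ?case
    using insert.hyps insert.IH insert.prems u ru assms(3)
      comp_add_left[of r X Y "u i" Z "finprod (hom_group C Y Z) u F"]
    by (simp add: G.finprod_insert[simplified] H.finprod_insert[simplified] del: comp_add_left_simp comp_add_right_simp)
qed

end

section \<open>Triangles and exact sequences\<close>

context triangulated_category
begin

lemma susp_obj [simp]: "X \<in> Obj T \<Longrightarrow> SuspO T X \<in> Obj T"
  using susp_obj_bij by (auto simp: bij_betw_def)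

lemma susp_obj_eq [simp]: "X \<in> Obj T \<Longrightarrow> Y \<in> Obj T \<Longrightarrow> SuspO T X = SuspO T Y \<longleftrightarrow> X = Y"
  using susp_obj_bij by (auto simp: bij_betw_def inj_on_def)

lemma susp_simps [simp]:
  assumes "f \<in> Arr T"
  shows "SuspM T f \<in> Arr T" "Dom T (SuspM T f) = SuspO T (Dom T f)"
    "Cod T (SuspM T f) = SuspO T (Cod T f)"
  using susp_hom[of f "Dom T f" "Cod T f"] assms by (auto simp: Hom_def)

lemma susp_eq: "f \<in> Arr T \<Longrightarrow> g \<in> Arr T \<Longrightarrow> SuspM T f = SuspM T g \<Longrightarrow> f = g"
  using susp_arr_bij by (auto simp: bij_betw_def inj_on_def)

lemma susp_comp_simp:
  "f \<in> Arr T \<Longrightarrow> g \<in> Arr T \<Longrightarrow> Cod T f = Dom T g \<Longrightarrow> SuspM T (g \<bullet> f) = SuspM T g \<bullet> SuspM T f"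
  by (rule susp_comp) (auto simp: Hom_def)

lemma susp_zero [simp]:
  assumes "X \<in> Obj T" "Y \<in> Obj T"
  shows "SuspM T (Zero T X Y) = Zero T (SuspO T X) (SuspO T Y)"
proof (rule add_eq_self_imp_zero)
  show "SuspM T (Zero T X Y) \<in> Hom T (SuspO T X) (SuspO T Y)" using assms by (simp add: in_hom)
  show "SuspM T (Zero T X Y) \<boxplus> SuspM T (Zero T X Y) = SuspM T (Zero T X Y)"
    using susp_add[of "Zero T X Y" X Y "Zero T X Y"] assms by (simp add: in_hom)
qed

lemma desusp_obj: "X \<in> Obj T \<Longrightarrow> \<exists>X0\<in>Obj T. X = SuspO T X0"
  using susp_obj_bij by (auto simp: bij_betw_def)

lemma desusp_hom:
  assumes "f \<in> Hom T (SuspO T X) (SuspO T Y)" "X \<in> Obj T" "Y \<in> Obj T"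
  shows "\<exists>f0\<in>Hom T X Y. f = SuspM T f0"
proof -
  obtain f0 where f0: "f0 \<in> Arr T" "f = SuspM T f0"
    using susp_arr_bij assms(1) by (auto simp: bij_betw_def in_hom)
  have "SuspO T (Dom T f0) = SuspO T X" "SuspO T (Cod T f0) = SuspO T Y"
    using f0 assms(1) by (auto simp: in_hom)
  then have "Dom T f0 = X" "Cod T f0 = Y" using f0 assms dom_in_obj cod_in_obj by auto
  with f0 show ?thesis by (auto simp: Hom_def)
qed

lemma zero_object_susp: "zero_object T Z \<Longrightarrow> zero_object T (SuspO T Z)"
  by (metis susp_id susp_obj susp_zero zero_object_iff)

text \<open>\<open>Tri\<close> records morphisms only; carrying the three objects along spares the
  rules below any computation of domains and codomains.\<close>

definition triangle :: "'b \<Rightarrow> 'b \<Rightarrow> 'b \<Rightarrow> 'a \<Rightarrow> 'a \<Rightarrow> 'a \<Rightarrow> bool" where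
  "triangle f g h X Y Z \<longleftrightarrow>
    (f, g, h) \<in> Tri T \<and> f \<in> Hom T X Y \<and> g \<in> Hom T Y Z \<and> h \<in> Hom T Z (SuspO T X)"

lemma triangleD:
  assumes "triangle f g h X Y Z"
  shows "(f, g, h) \<in> Tri T" "f \<in> Hom T X Y" "g \<in> Hom T Y Z" "h \<in> Hom T Z (SuspO T X)"
    "X \<in> Obj T" "Y \<in> Obj T" "Z \<in> Obj T"
  using assms by (auto simp: triangle_def in_hom)

lemma triangle_of_Tri:
  assumes "(f, g, h) \<in> Tri T"
  shows "triangle f g h (Dom T f) (Cod T f) (Cod T g)"
proof -
  obtain X Y Z where "f \<in> Hom T X Y" "g \<in> Hom T Y Z" "h \<in> Hom T Z (SuspO T X)"
    using tri_shape[OF assms] by blast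
  then show ?thesis using assms by (auto simp: triangle_def Hom_def)
qed

lemma triangle_cone:
  assumes "f \<in> Hom T X Y"
  shows "\<exists>Z g h. triangle f g h X Y Z"
  using tri_cone[of f] triangle_of_Tri assms by (metis in_hom)

lemma triangle_rotate: "triangle f g h X Y Z \<Longrightarrow> triangle g h (neg T (SuspM T f)) Y Z (SuspO T X)"
  using tri_rotate[of f X Y g Z h] unfolding triangle_def by (auto simp: in_hom)

text \<open>The first map is the desuspension of \<open>neg T h\<close>; its sign cancels the one
  that rotation introduces.\<close>

lemma triangle_unrotate:
  assumes "triangle f g h X Y (SuspO T Z)" "Z \<in> Obj T"
  shows "\<exists>k. triangle k f g Z X Y"
proof -
  have h: "h \<in> Hom T (SuspO T Z) (SuspO T X)" "X \<in> Obj T" using triangleD[OF assms(1)] by auto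
  then have "neg T h \<in> Hom T (SuspO T Z) (SuspO T X)" by (simp add: in_hom)
  then obtain k where k: "k \<in> Hom T Z X" "neg T h = SuspM T k"
    using desusp_hom assms(2) h(2) by blast
  have "h = neg T (SuspM T k)" using k(2) h(1) neg_simps(6)[of h] by (simp add: in_hom)
  then have "(k, f, g) \<in> Tri T"
    using tri_rotate[of k Z X f Y g] k triangleD[OF assms(1)] by simp
  then show ?thesis using k triangleD[OF assms(1)] by (auto simp: triangle_def)
qed

lemma triangle_id:
  assumes "X \<in> Obj T" "zero_object T Z"
  shows "triangle (Id T X) (Zero T X Z) (Zero T Z (SuspO T X)) X X Z"
  using tri_id[OF assms] assms zero_object_obj by (simp add: triangle_def in_hom)

text \<open>One rotation turns this into the identity triangle of \<open>X\<close> whose zero vertex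
  is the suspension of \<open>U\<close>.\<close>

lemma triangle_zero_id:
  assumes "X \<in> Obj T" "zero_object T U"
  shows "triangle (Zero T U X) (Id T X) (Zero T X (SuspO T U)) U X X"
proof -
  have U: "U \<in> Obj T" "SuspO T U \<in> Obj T" using assms zero_object_obj by auto
  have "Zero T (SuspO T U) (SuspO T X) = neg T (SuspM T (Zero T U X))" using assms U by simp
  then show ?thesis
    using tri_rotate[of "Zero T U X" U X "Id T X" X "Zero T X (SuspO T U)"] assms U
      tri_id[OF assms(1) zero_object_susp[OF assms(2)]]
    by (simp add: triangle_def in_hom)
qed

text \<open>The identity of \<open>X\<close> and \<open>f\<close> extend to a morphism from the
  identity triangle of \<open>X\<close>, so the composite factors through its zero vertex.\<close>

lemma triangle_comp_first:
  assumes "triangle f g h X Y Z"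
  shows "g \<bullet> f = Zero T X Z"
proof -
  obtain U where U: "zero_object T U" using ex_zero_object by blast
  note d = triangleD[OF assms] and Uo = zero_object_obj[OF U]
  have "\<exists>c\<in>Hom T (Cod T (Zero T X U)) (Cod T g).
      c \<bullet> Zero T X U = g \<bullet> f \<and> SuspM T (Id T X) \<bullet> Zero T U (SuspO T X) = h \<bullet> c"
    by (rule tri_morphism[OF tri_id[OF d(5) U] d(1)]) (use d Uo in \<open>auto simp: in_hom\<close>)
  then show ?thesis using d Uo by (auto simp: in_hom)
qed

lemma triangle_comp_second: "triangle f g h X Y Z \<Longrightarrow> h \<bullet> g = Zero T Y (SuspO T X)"
  using triangle_comp_first[OF triangle_rotate] .

lemma triangle_comp_third:
  assumes "triangle f g h X Y Z"
  shows "SuspM T f \<bullet> h = Zero T Z (SuspO T Y)"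
proof (rule neg_eq_zero)
  note d = triangleD[OF assms]
  show "SuspM T f \<bullet> h \<in> Hom T Z (SuspO T Y)" using d by (simp add: in_hom)
  show "neg T (SuspM T f \<bullet> h) = Zero T Z (SuspO T Y)"
    using triangle_comp_second[OF triangle_rotate[OF assms]] d by (simp add: in_hom)
qed

text \<open>Because \<open>g \<bullet> a\<close> is zero, \<open>a\<close> and a zero map start a
  morphism from the triangle W, 0, \<open>SuspO T W\<close> to the rotated triangle. Its third
  component is the suspension of the desired lift, as both last maps carry the same minus
  sign.\<close>

lemma lift_first:
  assumes "triangle f g h X Y Z" "a \<in> Hom T W Y" "g \<bullet> a = Zero T W Z"
  shows "\<exists>b\<in>Hom T W X. f \<bullet> b = a"
proof -
  obtain U where U: "zero_object T U" using ex_zero_object by blast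
  note d = triangleD[OF assms(1)] and Uo = zero_object_obj[OF U]
  have W: "W \<in> Obj T" using assms(2) by (simp add: in_hom)
  let ?n = "neg T (SuspM T (Id T W))"
  have t1: "triangle (Zero T W U) (Zero T U (SuspO T W)) ?n W U (SuspO T W)"
    using triangle_rotate[OF triangle_id[OF W U]] by simp
  have "\<exists>c\<in>Hom T (Cod T (Zero T U (SuspO T W))) (Cod T h).
      c \<bullet> Zero T U (SuspO T W) = h \<bullet> Zero T U Z \<and> SuspM T a \<bullet> ?n = neg T (SuspM T f) \<bullet> c"
    by (rule tri_morphism[OF triangleD(1)[OF t1] triangleD(1)[OF triangle_rotate[OF assms(1)]]])
      (use d Uo W assms in \<open>auto simp: in_hom\<close>)
  then obtain c where c: "c \<in> Hom T (SuspO T W) (SuspO T X)"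
    "SuspM T a \<bullet> ?n = neg T (SuspM T f) \<bullet> c"
    using d Uo W by (auto simp: in_hom)
  obtain b where b: "b \<in> Hom T W X" "c = SuspM T b" using desusp_hom[OF c(1) W d(5)] by blast
  have "neg T (SuspM T a) = neg T (SuspM T (f \<bullet> b))"
    using c(2) b W d assms(2) by (simp add: in_hom susp_id susp_comp_simp)
  then have "SuspM T a = SuspM T (f \<bullet> b)"
    using neg_simps(6)[of "SuspM T a"] neg_simps(6)[of "SuspM T (f \<bullet> b)"] b d assms(2)
    by (simp add: in_hom)
  then have "a = f \<bullet> b" using susp_eq b d assms(2) by (simp add: in_hom)
  then show ?thesis using b by auto
qed

lemma lift_second:
  assumes "triangle f g h X Y Z" "a \<in> Hom T W Z" "h \<bullet> a = Zero T W (SuspO T X)"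
  shows "\<exists>b\<in>Hom T W Y. g \<bullet> b = a"
  using lift_first[OF triangle_rotate[OF assms(1)]] assms by blast

lemma lift_third:
  assumes "triangle f g h X Y Z" "a \<in> Hom T W (SuspO T X)" "SuspM T f \<bullet> a = Zero T W (SuspO T Y)"
  shows "\<exists>b\<in>Hom T W Z. h \<bullet> b = a"
proof (rule lift_second[OF triangle_rotate[OF assms(1)] assms(2)])
  show "neg T (SuspM T f) \<bullet> a = Zero T W (SuspO T Y)"
    using triangleD[OF assms(1)] assms by (simp add: in_hom)
qed

text \<open>Dually, \<open>a\<close> and a zero map start a morphism to the triangle 0, W, W, whose
  third component is the extension.\<close>

lemma extend_second:
  assumes "triangle f g h X Y Z" "a \<in> Hom T Y W" "a \<bullet> f = Zero T X W"
  shows "\<exists>b\<in>Hom T Z W. b \<bullet> g = a"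
proof -
  obtain U where U: "zero_object T U" using ex_zero_object by blast
  note d = triangleD[OF assms(1)] and Uo = zero_object_obj[OF U]
  have W: "W \<in> Obj T" using assms(2) by (simp add: in_hom)
  have "\<exists>c\<in>Hom T (Cod T g) (Cod T (Id T W)).
      c \<bullet> g = Id T W \<bullet> a \<and> SuspM T (Zero T X U) \<bullet> h = Zero T W (SuspO T U) \<bullet> c"
    by (rule tri_morphism[OF d(1) triangleD(1)[OF triangle_zero_id[OF W U]]])
      (use d Uo W assms in \<open>auto simp: in_hom\<close>)
  then show ?thesis using d W assms(2) by (auto simp: in_hom)
qed

lemma extend_third:
  assumes "triangle f g h X Y Z" "a \<in> Hom T Z W" "a \<bullet> g = Zero T Y W"
  shows "\<exists>b\<in>Hom T (SuspO T X) W. b \<bullet> h = a"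
  using extend_second[OF triangle_rotate[OF assms(1)]] assms by blast

definition is_tri :: "'a \<Rightarrow> 'a \<Rightarrow> 'a \<Rightarrow> bool" where
  "is_tri X Y Z \<longleftrightarrow> (\<exists>f g h. triangle f g h X Y Z)"

lemma is_tri_obj: "is_tri X Y Z \<Longrightarrow> X \<in> Obj T \<and> Y \<in> Obj T \<and> Z \<in> Obj T"
  using triangleD by (auto simp: is_tri_def)

lemma is_tri_rotate: "is_tri X Y Z \<Longrightarrow> is_tri Y Z (SuspO T X)"
  using triangle_rotate unfolding is_tri_def by blast

lemma is_tri_unrotate: "is_tri X Y (SuspO T Z) \<Longrightarrow> Z \<in> Obj T \<Longrightarrow> is_tri Z X Y"
  using triangle_unrotate unfolding is_tri_def by blast

lemma is_tri_rotate_iff: "X \<in> Obj T \<Longrightarrow> is_tri X Y Z \<longleftrightarrow> is_tri Y Z (SuspO T X)"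
  using is_tri_rotate is_tri_unrotate by blast

text \<open>Three rotations; the signs they produce are absorbed by the existential quantifiers in
  \<open>is_tri\<close>.\<close>

lemma is_tri_susp_iff:
  assumes "X \<in> Obj T" "Y \<in> Obj T" "Z \<in> Obj T"
  shows "is_tri (SuspO T X) (SuspO T Y) (SuspO T Z) \<longleftrightarrow> is_tri X Y Z"
  using is_tri_rotate_iff assms by simp

lemma is_tri_iso:
  assumes "is_tri X Y Z" "isomorphic T Y Y'"
  shows "is_tri X Y' Z"
proof -
  obtain f g h where t: "triangle f g h X Y Z" using assms(1) by (auto simp: is_tri_def)
  note d = triangleD[OF t]
  obtain b c where b: "b \<in> Hom T Y Y'" "c \<in> Hom T Y' Y" "c \<bullet> b = Id T Y" "is_iso T b"
    using assms(2) by (elim isomorphicE)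
  have cbf: "g \<bullet> (c \<bullet> b) = g" using b d by (simp add: in_hom)
  have "(b \<bullet> f, g \<bullet> c, h) \<in> Tri T"
    by (rule tri_iso[OF d(1,2,3,4), where a = "Id T X" and b = b and c = "Id T Z"])
      (use b d cbf in \<open>auto simp: in_hom iso_id susp_id\<close>)
  then have "triangle (b \<bullet> f) (g \<bullet> c) h X Y' Z" using b d by (auto simp: triangle_def in_hom)
  then show ?thesis by (auto simp: is_tri_def)
qed

lemma octahedron:
  assumes "triangle f i j X Y A" "triangle g m n Y Z B" "triangle (g \<bullet> f) k l X Z C"
  shows "\<exists>u v w. triangle u v w A C B \<and> u \<bullet> i = k \<bullet> g \<and> v \<bullet> k = m"
proof -
  note d1 = triangleD[OF assms(1)] and d2 = triangleD[OF assms(2)] and d3 = triangleD[OF assms(3)]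
  have "\<exists>u v. u \<in> Hom T (Cod T i) (Cod T k) \<and> v \<in> Hom T (Cod T k) (Cod T m) \<and>
            (u, v, SuspM T i \<bullet> n) \<in> Tri T \<and>
            u \<bullet> i = k \<bullet> g \<and> l \<bullet> u = j \<and> v \<bullet> k = m \<and> n \<bullet> v = SuspM T f \<bullet> l"
    by (rule octahedral[OF d1(2) d2(2) d1(1) d3(1) d2(1)])
  then obtain u v where "u \<in> Hom T A C" "v \<in> Hom T C B" "(u, v, SuspM T i \<bullet> n) \<in> Tri T"
    "u \<bullet> i = k \<bullet> g" "v \<bullet> k = m" using d1 d2 d3 by (auto simp: in_hom)
  then have "triangle u v (SuspM T i \<bullet> n) A C B \<and> u \<bullet> i = k \<bullet> g \<and> v \<bullet> k = m"
    using d1 d2 d3 by (auto simp: triangle_def in_hom)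
  then show ?thesis by blast
qed

text \<open>The cone \<open>C\<close> of the split inclusion \<open>j\<close> is compared with
  \<open>X\<close>: \<open>p\<close> kills \<open>j\<close>, so it induces a map \<open>c\<close>
  from \<open>C\<close> to \<open>X\<close>, and \<open>g \<bullet> i\<close> is its inverse. Thus
  the cone triangle is isomorphic to one with \<open>p\<close> as second map.\<close>

lemma is_tri_biproduct:
  assumes "biproduct T X Y Z i j p q" "X \<in> Obj T" "Y \<in> Obj T"
  shows "is_tri Y Z X"
proof -
  have b: "i \<in> Hom T X Z" "j \<in> Hom T Y Z" "p \<in> Hom T Z X" "q \<in> Hom T Z Y"
    "p \<bullet> i = Id T X" "q \<bullet> j = Id T Y" "p \<bullet> j = Zero T Y X" "(i \<bullet> p) \<boxplus> (j \<bullet> q) = Id T Z"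
    using assms(1) by (auto simp: biproduct_def)
  obtain C g h where t: "triangle j g h Y Z C" using triangle_cone[OF b(2)] by blast
  note d = triangleD[OF t]
  \<comment> \<open>The retraction \<open>q\<close> of \<open>j\<close> forces the connecting map
    \<open>h\<close> to vanish, which is what makes \<open>g\<close> split.\<close>
  have "h = SuspM T (q \<bullet> j) \<bullet> h" using d assms by (simp add: b(6) in_hom susp_id)
  also have "\<dots> = SuspM T q \<bullet> (SuspM T j \<bullet> h)"
    using b(1-4) d by (simp add: in_hom susp_comp_simp)
  also have "\<dots> = Zero T C (SuspO T Y)" using triangle_comp_third[OF t] b d by (simp add: in_hom)
  finally have h: "h \<bullet> Id T C = Zero T C (SuspO T Y)" using d by (simp add: in_hom)
  have "\<exists>s\<in>Hom T C Z. g \<bullet> s = Id T C"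
    by (rule lift_second[OF t _ h]) (use d in \<open>simp add: in_hom\<close>)
  then obtain s where s: "s \<in> Hom T C Z" "g \<bullet> s = Id T C" by blast
  obtain c where c: "c \<in> Hom T C X" "c \<bullet> g = p" using extend_second[OF t b(3,7)] by blast
  have gj: "g \<bullet> j = Zero T Y C" by (rule triangle_comp_first[OF t])
  \<comment> \<open>Insert the biproduct decomposition of the identity between \<open>g\<close> and
    its section \<open>s\<close>; the part through \<open>Y\<close> dies because
    \<open>g \<bullet> j\<close> is zero.\<close>
  have "g \<bullet> s = (g \<bullet> Id T Z) \<bullet> s" using d by (simp add: in_hom)
  also have "\<dots> = (g \<bullet> ((i \<bullet> p) \<boxplus> (j \<bullet> q))) \<bullet> s" by (simp only: b(8))
  also have "\<dots> = (g \<bullet> (i \<bullet> (c \<bullet> (g \<bullet> s)))) \<boxplus> (g \<bullet> (j \<bullet> (q \<bullet> s)))"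
    using b(1-4) d s(1) c(1) by (simp add: in_hom flip: c(2))
  also have "\<dots> = g \<bullet> (i \<bullet> c)"
    using comp_reassoc[OF gj, of "q \<bullet> s"] b(1-4) d s c(1) by (simp add: in_hom)
  finally have gic: "(g \<bullet> i) \<bullet> c = Id T C" using s(2) c(1) b(1-4) d by (simp add: in_hom)
  have cgi: "c \<bullet> (g \<bullet> i) = Id T X" using c b(1-5) d comp_assoc_simp[of i g c] by (simp add: in_hom)
  have "is_iso T c"
    by (rule isoI[of _ C X "g \<bullet> i"]) (use c b d gic cgi in \<open>auto simp: in_hom\<close>)
  moreover have gic': "g \<bullet> (i \<bullet> c) = Id T C" using gic c(1) b(1-4) d by (simp add: in_hom)
  ultimately have "(j, p, h \<bullet> (g \<bullet> i)) \<in> Tri T"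
    by (intro tri_iso[OF d(1,2,3,4), where a = "Id T Y" and b = "Id T Z" and c = c and X' = Y and Y' = Z and Z' = X])
      (use c b(1-4) d gic' in \<open>auto simp: in_hom iso_id susp_id\<close>)
  then have "triangle j p (h \<bullet> (g \<bullet> i)) Y Z X" using b d by (auto simp: triangle_def in_hom)
  then show ?thesis by (auto simp: is_tri_def)
qed

lemma biproduct_sym:
  assumes "is_biproduct T X Y Z"
  shows "is_biproduct T Y X Z"
proof -
  obtain i j p q where b: "biproduct T X Y Z i j p q" using assms by (auto simp: is_biproduct_def)
  then have "biproduct T Y X Z j i q p"
    using add_comm[of "i \<bullet> p" Z Z "j \<bullet> q"] by (auto simp: biproduct_def in_hom)
  then show ?thesis by (auto simp: is_biproduct_def)
qed

end

section \<open>Coproducts and compact objects\<close>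

lemma small_ordLeq:
  assumes "small U A" "inj_on f B" "f ` B \<subseteq> A"
  shows "small U B"
  using assms card_of_ordLeq[of B A] ordLeq_ordLess_trans by (auto simp: small_def)

lemma small_image: "small U A \<Longrightarrow> small U (f ` A)"
  using card_of_image[of f A] ordLeq_ordLess_trans by (auto simp: small_def)

lemma small_embedding:
  fixes A :: "'a set"
  assumes "small TYPE('u) A"
  shows "\<exists>\<phi> :: 'a \<Rightarrow> 'u. inj_on \<phi> A"
  using assms card_of_ordLeq[of A "UNIV :: 'u set"] ordLess_imp_ordLeq by (auto simp: small_def)

context category
begin

lemma coproductD:
  assumes "is_coproduct C I X S \<iota>"
  shows "S \<in> Obj C" "i \<in> I \<Longrightarrow> X i \<in> Obj C" "i \<in> I \<Longrightarrow> \<iota> i \<in> Hom C (X i) S"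
  using assms by (auto simp: is_coproduct_def)

lemma coproduct_ex1:
  assumes "is_coproduct C I X S \<iota>" "Y \<in> Obj C" "\<And>i. i \<in> I \<Longrightarrow> g i \<in> Hom C (X i) Y"
  shows "\<exists>!h. h \<in> Hom C S Y \<and> (\<forall>i\<in>I. h \<bullet> \<iota> i = g i)"
  using assms(1)[unfolded is_coproduct_def, THEN conjunct2, THEN conjunct2, rule_format, of Y g]
    assms(2,3) by simp

lemma coproduct_ex:
  assumes "is_coproduct C I X S \<iota>" "Y \<in> Obj C" "\<And>i. i \<in> I \<Longrightarrow> g i \<in> Hom C (X i) Y"
  shows "\<exists>h\<in>Hom C S Y. \<forall>i\<in>I. h \<bullet> \<iota> i = g i"
  using ex1_implies_ex[OF coproduct_ex1[OF assms]] by blast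

lemma coproduct_eqI:
  assumes "is_coproduct C I X S \<iota>" "h \<in> Hom C S Y" "h' \<in> Hom C S Y"
    "\<And>i. i \<in> I \<Longrightarrow> h \<bullet> \<iota> i = h' \<bullet> \<iota> i"
  shows "h = h'"
proof -
  have Y: "Y \<in> Obj C" using assms(2) by (simp add: in_hom)
  have "\<exists>!k. k \<in> Hom C S Y \<and> (\<forall>i\<in>I. k \<bullet> \<iota> i = h' \<bullet> \<iota> i)"
    by (rule coproduct_ex1[OF assms(1) Y comp_in_hom[OF coproductD(3)[OF assms(1)] assms(3)]])
  then show ?thesis by (rule ex1E) (use assms(2-4) in metis)
qed

lemma is_coproductI:
  assumes "S \<in> Obj C" "\<And>i. i \<in> I \<Longrightarrow> X i \<in> Obj C" "\<And>i. i \<in> I \<Longrightarrow> \<iota> i \<in> Hom C (X i) S"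
    and "\<And>Y g. Y \<in> Obj C \<Longrightarrow> (\<And>i. i \<in> I \<Longrightarrow> g i \<in> Hom C (X i) Y)
      \<Longrightarrow> \<exists>h\<in>Hom C S Y. \<forall>i\<in>I. h \<bullet> \<iota> i = g i"
    and "\<And>Y h h'. Y \<in> Obj C \<Longrightarrow> h \<in> Hom C S Y \<Longrightarrow> h' \<in> Hom C S Y
      \<Longrightarrow> (\<And>i. i \<in> I \<Longrightarrow> h \<bullet> \<iota> i = h' \<bullet> \<iota> i) \<Longrightarrow> h = h'"
  shows "is_coproduct C I X S \<iota>"
  unfolding is_coproduct_def
proof (intro conjI ballI allI impI)
  fix Y g assume Y: "Y \<in> Obj C" and g: "\<forall>i\<in>I. g i \<in> Hom C (X i) Y"
  have g': "\<And>i. i \<in> I \<Longrightarrow> g i \<in> Hom C (X i) Y" using g by blast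
  obtain h where h: "h \<in> Hom C S Y" "\<forall>i\<in>I. h \<bullet> \<iota> i = g i" using assms(4)[OF Y g'] by blast
  show "\<exists>!h. h \<in> Hom C S Y \<and> (\<forall>i\<in>I. h \<bullet> \<iota> i = g i)"
  proof (rule ex1I[of _ h])
    fix h' assume h': "h' \<in> Hom C S Y \<and> (\<forall>i\<in>I. h' \<bullet> \<iota> i = g i)"
    then show "h' = h" using assms(5)[OF Y, of h' h] h by simp
  qed (use h in auto)
qed (use assms(1-3) in auto)

lemma coproduct_reindex:
  assumes "is_coproduct C J X S \<iota>" "bij_betw \<phi> I J"
  shows "is_coproduct C I (\<lambda>i. X (\<phi> i)) S (\<lambda>i. \<iota> (\<phi> i))"
proof (rule is_coproductI)
  note c = coproductD[OF assms(1)]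
  have \<phi>: "\<phi> i \<in> J" if "i \<in> I" for i using assms(2) that by (auto simp: bij_betw_def)
  show "S \<in> Obj C" "\<And>i. i \<in> I \<Longrightarrow> X (\<phi> i) \<in> Obj C" "\<And>i. i \<in> I \<Longrightarrow> \<iota> (\<phi> i) \<in> Hom C (X (\<phi> i)) S"
    using c \<phi> by auto
  fix Y assume Y: "Y \<in> Obj C"
  show "\<exists>h\<in>Hom C S Y. \<forall>i\<in>I. h \<bullet> \<iota> (\<phi> i) = g i" if g: "\<And>i. i \<in> I \<Longrightarrow> g i \<in> Hom C (X (\<phi> i)) Y" for g
  proof -
    let ?\<psi> = "inv_into I \<phi>"
    have "?\<psi> j \<in> I \<and> \<phi> (?\<psi> j) = j" if "j \<in> J" for j
      using assms(2) that by (auto simp: bij_betw_def inv_into_into f_inv_into_f)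
    then have "\<And>j. j \<in> J \<Longrightarrow> g (?\<psi> j) \<in> Hom C (X j) Y" using g by metis
    from coproduct_ex[OF assms(1) Y this] obtain h
      where h: "h \<in> Hom C S Y" "\<forall>j\<in>J. h \<bullet> \<iota> j = g (?\<psi> j)" by blast
    have "\<forall>i\<in>I. h \<bullet> \<iota> (\<phi> i) = g i"
      using h(2) \<phi> assms(2) by (auto simp: bij_betw_def inv_into_f_f)
    with h show ?thesis by blast
  qed
  show "h = h'" if h: "h \<in> Hom C S Y" "h' \<in> Hom C S Y" "\<And>i. i \<in> I \<Longrightarrow> h \<bullet> \<iota> (\<phi> i) = h' \<bullet> \<iota> (\<phi> i)" for h h'
  proof (rule coproduct_eqI[OF assms(1) h(1,2)])
    fix j assume "j \<in> J"
    then obtain i where "i \<in> I" "j = \<phi> i" using assms(2) by (auto simp: bij_betw_def)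
    then show "h \<bullet> \<iota> j = h' \<bullet> \<iota> j" using h(3) by simp
  qed
qed

text \<open>\<open>has_coproducts\<close> speaks of index sets in \<open>'u\<close> only. An
  injection into \<open>'u\<close> extends it to any small index set, such as a hom set or the
  integers.\<close>

lemma coproduct_exists:
  fixes I :: "'i set"
  assumes "has_coproducts TYPE('u) C" "small TYPE('u) I" "\<And>i. i \<in> I \<Longrightarrow> X i \<in> Obj C"
  shows "\<exists>S \<iota>. is_coproduct C I X S \<iota>"
proof -
  obtain \<phi> :: "'i \<Rightarrow> 'u" where \<phi>: "inj_on \<phi> I" using small_embedding[OF assms(2)] by blast
  have "\<forall>j\<in>\<phi> ` I. X (inv_into I \<phi> j) \<in> Obj C" using assms(3) by (auto simp: inv_into_into)
  then obtain S \<iota> where "is_coproduct C (\<phi> ` I) (\<lambda>j. X (inv_into I \<phi> j)) S \<iota>"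
    using assms(1)[unfolded has_coproducts_def, rule_format, of "\<phi> ` I" "\<lambda>j. X (inv_into I \<phi> j)"]
      small_image[OF assms(2), of \<phi>] by blast
  then have "is_coproduct C I (\<lambda>i. X (inv_into I \<phi> (\<phi> i))) S (\<lambda>i. \<iota> (\<phi> i))"
    by (rule coproduct_reindex) (use \<phi> in \<open>simp add: bij_betw_def\<close>)
  then have "is_coproduct C I X S (\<lambda>i. \<iota> (\<phi> i))"
    using \<phi> by (simp add: is_coproduct_def inv_into_f_f)
  then show ?thesis by blast
qed

end

section \<open>Projections, finite support and the comparison map\<close>

context additive_category
begin

definition coproduct_projection where
  "coproduct_projection I X S \<iota> p \<longleftrightarrow> (\<forall>j\<in>I. p j \<in> Hom C S (X j) \<and>
    (\<forall>i\<in>I. p j \<bullet> \<iota> i = (if i = j then Id C (X j) else Zero C (X i) (X j))))"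

lemma coproduct_projection_exists:
  assumes "is_coproduct C I X S \<iota>"
  shows "\<exists>p. coproduct_projection I X S \<iota> p"
proof -
  note c = coproductD[OF assms]
  have "\<exists>h\<in>Hom C S (X j). \<forall>i\<in>I. h \<bullet> \<iota> i = (if i = j then Id C (X j) else Zero C (X i) (X j))"
    if "j \<in> I" for j
    by (rule coproduct_ex[OF assms]) (use c that in \<open>auto simp: in_hom\<close>)
  then show ?thesis unfolding coproduct_projection_def by metis
qed

lemma coproduct_projectionD:
  assumes "coproduct_projection I X S \<iota> p" "j \<in> I"
  shows "p j \<in> Hom C S (X j)" "p j \<bullet> \<iota> j = Id C (X j)"
    "i \<in> I \<Longrightarrow> i \<noteq> j \<Longrightarrow> p j \<bullet> \<iota> i = Zero C (X i) (X j)"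
  using assms by (auto simp: coproduct_projection_def)

lemma projection_finprod:
  assumes "is_coproduct C I X S \<iota>" "coproduct_projection I X S \<iota> p" "finite F" "F \<subseteq> I"
    and "\<And>i. i \<in> F \<Longrightarrow> x i \<in> Hom C E (X i)" "j \<in> I" "E \<in> Obj C"
  shows "p j \<bullet> finprod (hom_group C E S) (\<lambda>i. \<iota> i \<bullet> x i) F = (if j \<in> F then x j else Zero C E (X j))"
proof -
  note c = coproductD[OF assms(1)] and p = coproduct_projectionD[OF assms(2,6)]
  interpret H: comm_group "hom_group C E (X j)" by (rule hom_comm_group) (use assms c in auto)
  have ix: "\<iota> i \<bullet> x i \<in> Hom C E S" if "i \<in> F" for i
    using assms(4,5) c(3) that comp_in_hom by blast
  have e: "p j \<bullet> (\<iota> i \<bullet> x i) = (if j = i then x i else Zero C E (X j))" if "i \<in> F" for i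
  proof -
    have i: "i \<in> I" "x i \<in> Hom C E (X i)" "\<iota> i \<in> Hom C (X i) S" using that assms c by auto
    then have "p j \<bullet> (\<iota> i \<bullet> x i) = (p j \<bullet> \<iota> i) \<bullet> x i" using p(1) by (simp add: in_hom)
    also have "\<dots> = (if j = i then x i else Zero C E (X j))"
      using i p(2) p(3)[OF i(1)] c(2)[OF assms(6)] by (auto simp: in_hom)
    finally show ?thesis .
  qed
  have "p j \<bullet> finprod (hom_group C E S) (\<lambda>i. \<iota> i \<bullet> x i) F
      = finprod (hom_group C E (X j)) (\<lambda>i. p j \<bullet> (\<iota> i \<bullet> x i)) F"
    by (rule comp_finprod[OF assms(3) ix p(1) assms(7)])
  also have "\<dots> = finprod (hom_group C E (X j))
      (\<lambda>i. if j = i then x i else \<one>\<^bsub>hom_group C E (X j)\<^esub>) F"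
    by (rule H.finprod_cong')
      (use assms(5,7) c(2)[OF assms(6)] e in \<open>auto split: if_splits simp: zero_in_hom\<close>)
  also have "\<dots> = (if j \<in> F then x j else Zero C E (X j))"
  proof (cases "j \<in> F")
    case True
    \<comment> \<open>\<open>finprod_singleton\<close> wants a summand lying in the group for every
      index, and \<open>x i\<close> has the wrong codomain for other indices; the doubled
      conditional replaces it by zero there.\<close>
    have "finprod (hom_group C E (X j)) (\<lambda>i. if j = i then x i else \<one>\<^bsub>hom_group C E (X j)\<^esub>) F
      = finprod (hom_group C E (X j))
        (\<lambda>i. if j = i then (if j = i then x i else Zero C E (X j)) else \<one>\<^bsub>hom_group C E (X j)\<^esub>) F"
      by (rule arg_cong[of _ _ "\<lambda>f. finprod _ f F"]) auto
    also have "\<dots> = (if j = j then x j else Zero C E (X j))"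
      by (rule H.finprod_singleton[OF True assms(3)])
        (use assms(5,7) c(2)[OF assms(6)] in \<open>auto split: if_splits simp: zero_in_hom\<close>)
    finally show ?thesis using True by simp
  next
    case False
    then show ?thesis by (subst H.finprod_one_eqI) auto
  qed
  finally show ?thesis .
qed

text \<open>A morphism \<open>y\<close> into a coproduct is supported on \<open>F\<close> if it factors through the summands
  indexed by \<open>F\<close>; testing against maps out of the coproduct avoids choosing the factorization.\<close>

definition supported where
  "supported X S \<iota> E F y \<longleftrightarrow>
    (\<forall>Y. \<forall>r\<in>Hom C S Y. (\<forall>i\<in>F. r \<bullet> \<iota> i = Zero C (X i) Y) \<longrightarrow> r \<bullet> y = Zero C E Y)"

text \<open>The sum \<open>?e\<close> of the idempotents belonging to \<open>F\<close> fixes the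
  injections of \<open>F\<close>. Hence \<open>Id C S\<close> minus \<open>?e\<close> vanishes on
  those summands, and support then says that it kills \<open>y\<close>.\<close>

lemma supported_expansion:
  assumes "is_coproduct C I X S \<iota>" "coproduct_projection I X S \<iota> p" "finite F" "F \<subseteq> I"
    and "y \<in> Hom C E S" "supported X S \<iota> E F y"
  shows "y = finprod (hom_group C E S) (\<lambda>i. \<iota> i \<bullet> (p i \<bullet> y)) F"
proof -
  note c = coproductD[OF assms(1)]
  have p: "p i \<in> Hom C S (X i)" if "i \<in> F" for i
    using assms(2,4) that by (auto simp: coproduct_projection_def)
  have i: "\<iota> i \<in> Hom C (X i) S" if "i \<in> F" for i
    using c(3) assms(4) that by blast
  have ip: "\<iota> i \<bullet> p i \<in> Hom C S S" if "i \<in> F" for i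
    using i p comp_in_hom that by blast
  interpret H: comm_group "hom_group C S S" by (rule hom_comm_group) (use c in auto)
  let ?e = "finprod (hom_group C S S) (\<lambda>i. \<iota> i \<bullet> p i) F"
  have e: "?e \<in> Hom C S S" by (rule H.finprod_closed[simplified]) (use ip in auto)
  have ei: "?e \<bullet> \<iota> j = \<iota> j" if j: "j \<in> F" for j
  proof -
    have jI: "j \<in> I" using j assms(4) by auto
    interpret G: comm_group "hom_group C (X j) S" by (rule hom_comm_group) (use c jI in auto)
    have "?e \<bullet> \<iota> j = finprod (hom_group C (X j) S) (\<lambda>i. (\<iota> i \<bullet> p i) \<bullet> \<iota> j) F"
      by (rule finprod_comp[OF assms(3) ip i[OF j] c(1)])
    also have "\<dots> = finprod (hom_group C (X j) S) (\<lambda>i. if j = i then \<iota> i else \<one>\<^bsub>hom_group C (X j) S\<^esub>) F"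
    proof (rule G.finprod_cong')
      fix k assume k: "k \<in> F"
      then have kI: "k \<in> I" using assms(4) by auto
      have "(\<iota> k \<bullet> p k) \<bullet> \<iota> j = \<iota> k \<bullet> (p k \<bullet> \<iota> j)"
        using i[OF k] p[OF k] i[OF j] by (simp add: in_hom)
      then show "(\<iota> k \<bullet> p k) \<bullet> \<iota> j = (if j = k then \<iota> k else \<one>\<^bsub>hom_group C (X j) S\<^esub>)"
        using coproduct_projectionD(2)[OF assms(2) kI] coproduct_projectionD(3)[OF assms(2) kI, of j] jI i[OF k] i[OF j] by (auto simp: in_hom)
    qed (use i j c zero_in_hom[of "X j" S] jI in auto)
    also have "\<dots> = finprod (hom_group C (X j) S)
        (\<lambda>i. if j = i then (if j = i then \<iota> i else Zero C (X j) S) else \<one>\<^bsub>hom_group C (X j) S\<^esub>) F"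
      by (rule arg_cong[of _ _ "\<lambda>f. finprod _ f F"]) auto
    also have "\<dots> = (if j = j then \<iota> j else Zero C (X j) S)"
      by (rule G.finprod_singleton[OF j assms(3)]) (use i c jI zero_in_hom[of "X j" S] in auto)
    finally show ?thesis by simp
  qed
  have "(Id C S \<boxplus> neg C ?e) \<bullet> y = Zero C E S"
  proof -
    have "Id C S \<boxplus> neg C ?e \<in> Hom C S S" using e c(1) by (simp add: in_hom)
    moreover have "(Id C S \<boxplus> neg C ?e) \<bullet> \<iota> i = Zero C (X i) S" if "i \<in> F" for i
      using ei[OF that] e c(1) i[OF that] by (simp add: in_hom)
    ultimately show ?thesis using assms(6) by (auto simp: supported_def)
  qed
  then have "y \<boxplus> neg C (?e \<bullet> y) = Zero C E S" using e c(1) assms(5) by (simp add: in_hom)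
  then have "y = ?e \<bullet> y"
    by (rule diff_zero_imp_eq[rotated 2]) (use e assms(5) comp_in_hom in auto)
  also have "\<dots> = finprod (hom_group C E S) (\<lambda>i. (\<iota> i \<bullet> p i) \<bullet> y) F"
    by (rule finprod_comp[OF assms(3) ip assms(5) c(1)])
  also have "\<dots> = finprod (hom_group C E S) (\<lambda>i. \<iota> i \<bullet> (p i \<bullet> y)) F"
  proof -
    interpret K: comm_group "hom_group C E S" by (rule hom_comm_group) (use c assms(5) in \<open>auto simp: in_hom\<close>)
    show ?thesis
      by (rule K.finprod_cong') (use i p assms(5) in \<open>auto simp: in_hom\<close>)
  qed
  finally show ?thesis .
qed

end

context additive_category
begin

text \<open>Families with different supports can be added only over a common finite index set, so
  summation over any finite set containing the support is allowed.\<close>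

lemma coproduct_comparison_eq:
  assumes "is_coproduct C I X S \<iota>" "E \<in> Obj C" "finite F" "F \<subseteq> I"
    and "\<And>i. i \<in> I \<Longrightarrow> x i \<in> Hom C E (X i)" "{i \<in> I. x i \<noteq> Zero C E (X i)} \<subseteq> F"
  shows "coproduct_comparison C E I X S \<iota> x = finprod (hom_group C E S) (\<lambda>i. \<iota> i \<bullet> x i) F"
proof -
  note c = coproductD[OF assms(1)]
  interpret K: comm_group "hom_group C E S" by (rule hom_comm_group) (use c assms(2) in auto)
  show ?thesis
    unfolding coproduct_comparison_def
  proof (rule K.finprod_mono_neutral_cong_left[OF assms(3,6)])
    fix i assume i: "i \<in> F - {i \<in> I. x i \<noteq> Zero C E (X i)}"
    then have "i \<in> I" "x i = Zero C E (X i)" using assms(4) by auto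
    then show "\<iota> i \<bullet> x i = \<one>\<^bsub>hom_group C E S\<^esub>"
      using c(2,3)[of i] assms(2) by (simp add: in_hom)
  next
    show "(\<lambda>i. \<iota> i \<bullet> x i) \<in> F \<rightarrow> carrier (hom_group C E S)"
      using comp_in_hom[OF assms(5) c(3)] assms(4) by auto
  qed auto
qed

lemma carrier_sum_hom_group:
  assumes "E \<in> Obj C" "\<And>i. i \<in> I \<Longrightarrow> X i \<in> Obj C"
  shows "carrier (sum_group I (\<lambda>i. hom_group C E (X i)))
    = {x \<in> \<Pi>\<^sub>E i\<in>I. Hom C E (X i). finite {i \<in> I. x i \<noteq> Zero C E (X i)}}"
proof -
  have "group (hom_group C E (X i))" if "i \<in> I" for i
    using hom_comm_group[OF assms(1) assms(2)[OF that]] by (rule comm_group.axioms(2))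
  then show ?thesis by (simp add: carrier_sum_group)
qed

text \<open>A preimage of \<open>y\<close> in the direct sum has finite support, and
  \<open>y\<close> is the finite sum of its components.\<close>

lemma compact_imp_supported_univ:
  fixes I :: "'u set"
  assumes "compact_object TYPE('u) C E" "small TYPE('u) I" "is_coproduct C I X S \<iota>" "y \<in> Hom C E S"
  shows "\<exists>F. finite F \<and> F \<subseteq> I \<and> supported X S \<iota> E F y"
proof -
  note c = coproductD[OF assms(3)]
  have E: "E \<in> Obj C" using assms(1) by (simp add: compact_object_def)
  have "coproduct_comparison C E I X S \<iota>
        \<in> iso (sum_group I (\<lambda>i. hom_group C E (X i))) (hom_group C E S)"
    using assms(1-3) unfolding compact_object_def by blast
  then obtain x where x: "x \<in> carrier (sum_group I (\<lambda>i. hom_group C E (X i)))"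
    and y: "y = coproduct_comparison C E I X S \<iota> x"
    using assms(4) by (auto simp: iso_def bij_betw_def)
  then have x': "\<And>i. i \<in> I \<Longrightarrow> x i \<in> Hom C E (X i)" "finite {i \<in> I. x i \<noteq> Zero C E (X i)}"
    by (auto simp: carrier_sum_hom_group[OF E c(2)])
  let ?F = "{i \<in> I. x i \<noteq> Zero C E (X i)}"
  have "supported X S \<iota> E ?F y"
    unfolding supported_def
  proof (intro allI ballI impI)
    fix Y r assume r: "r \<in> Hom C S Y" and z: "\<forall>i\<in>?F. r \<bullet> \<iota> i = Zero C (X i) Y"
    have Y: "Y \<in> Obj C" using r by (simp add: in_hom)
    have ix: "\<iota> i \<bullet> x i \<in> Hom C E S" if "i \<in> ?F" for i using that c(3) x'(1) comp_in_hom by blast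
    interpret H: comm_group "hom_group C E Y" by (rule hom_comm_group[OF E Y])
    have "r \<bullet> y = finprod (hom_group C E Y) (\<lambda>i. r \<bullet> (\<iota> i \<bullet> x i)) ?F"
      unfolding y coproduct_comparison_def by (rule comp_finprod[OF x'(2) ix r E])
    also have "\<dots> = \<one>\<^bsub>hom_group C E Y\<^esub>"
    proof (rule H.finprod_one_eqI)
      fix i assume i: "i \<in> ?F"
      then have "r \<bullet> (\<iota> i \<bullet> x i) = (r \<bullet> \<iota> i) \<bullet> x i"
        using r c(3)[of i] x'(1)[of i] by (simp add: in_hom)
      also have "\<dots> = Zero C E Y" using z i x'(1)[of i] Y by (simp add: in_hom)
      finally show "r \<bullet> (\<iota> i \<bullet> x i) = \<one>\<^bsub>hom_group C E Y\<^esub>" by simp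
    qed
    finally show "r \<bullet> y = Zero C E Y" by simp
  qed
  with x'(2) show ?thesis by blast
qed

text \<open>Only surjectivity of the comparison map depends on \<open>E\<close>: it is additive for
  every object, and injective since the projections recover the components. Support supplies
  surjectivity through \<open>supported_expansion\<close>.\<close>

lemma compact_if_supported:
  assumes E: "E \<in> Obj C"
    and supp: "\<And>(I :: 'u set) X S \<iota> y. small TYPE('u) I \<Longrightarrow> is_coproduct C I X S \<iota> \<Longrightarrow> y \<in> Hom C E S
      \<Longrightarrow> \<exists>F. finite F \<and> F \<subseteq> I \<and> supported X S \<iota> E F y"
  shows "compact_object TYPE('u) C E"
  unfolding compact_object_def
proof (intro conjI allI impI E)
  fix I :: "'u set" and X S \<iota>
  assume "small TYPE('u) I \<and> is_coproduct C I X S \<iota>"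
  then have sm: "small TYPE('u) I" and cop: "is_coproduct C I X S \<iota>" by auto
  note c = coproductD[OF cop]
  obtain p where p: "coproduct_projection I X S \<iota> p" using coproduct_projection_exists[OF cop] by blast
  interpret K: comm_group "hom_group C E S" by (rule hom_comm_group[OF E c(1)])
  let ?G = "sum_group I (\<lambda>i. hom_group C E (X i))"
  let ?k = "coproduct_comparison C E I X S \<iota>"
  let ?s = "\<lambda>x. {i \<in> I. x i \<noteq> Zero C E (X i)}"
  have carr: "x \<in> carrier ?G \<longleftrightarrow> x \<in> (\<Pi>\<^sub>E i\<in>I. Hom C E (X i)) \<and> finite (?s x)" for x
    by (auto simp: carrier_sum_hom_group[OF E c(2)])
  have mem: "\<iota> i \<bullet> x i \<in> Hom C E S" if "x \<in> carrier ?G" "i \<in> I" for x i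
    using that c(3) comp_in_hom unfolding carr by blast
  have pk: "p j \<bullet> ?k x = x j" if x: "x \<in> carrier ?G" and j: "j \<in> I" for x j
  proof -
    have xI: "\<And>i. i \<in> I \<Longrightarrow> x i \<in> Hom C E (X i)" "finite (?s x)" using x unfolding carr by auto
    have "p j \<bullet> finprod (hom_group C E S) (\<lambda>i. \<iota> i \<bullet> x i) (?s x)
        = (if j \<in> ?s x then x j else Zero C E (X j))"
      by (rule projection_finprod[OF cop p xI(2)]) (use xI j E in auto)
    then show ?thesis using j by (auto simp: coproduct_comparison_def)
  qed
  have closed: "?k x \<in> Hom C E S" if "x \<in> carrier ?G" for x
    unfolding coproduct_comparison_def
    by (rule K.finprod_closed[simplified]) (use mem[OF that] in auto)
  have hom: "?k (x \<otimes>\<^bsub>?G\<^esub> x') = ?k x \<otimes>\<^bsub>hom_group C E S\<^esub> ?k x'"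
    if x: "x \<in> carrier ?G" and x': "x' \<in> carrier ?G" for x x'
  proof -
    let ?F = "?s x \<union> ?s x'" and ?y = "\<lambda>i\<in>I. x i \<boxplus> x' i"
    have F: "finite ?F" "?F \<subseteq> I" using x x' unfolding carr by auto
    have xI: "\<And>i. i \<in> I \<Longrightarrow> x i \<in> Hom C E (X i)" "\<And>i. i \<in> I \<Longrightarrow> x' i \<in> Hom C E (X i)"
      using x x' unfolding carr by auto
    have yI: "\<And>i. i \<in> I \<Longrightarrow> ?y i \<in> Hom C E (X i)" using xI by (simp add: in_hom)
    have yF: "?s ?y \<subseteq> ?F" using c(2) E by (auto simp: in_hom)
    have "?k ?y = finprod (hom_group C E S) (\<lambda>i. \<iota> i \<bullet> ?y i) ?F"
      by (rule coproduct_comparison_eq[OF cop E F yI yF])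
    also have "\<dots> = finprod (hom_group C E S) (\<lambda>i. (\<iota> i \<bullet> x i) \<otimes>\<^bsub>hom_group C E S\<^esub> (\<iota> i \<bullet> x' i)) ?F"
    proof (rule K.finprod_cong')
      show "(\<lambda>i. (\<iota> i \<bullet> x i) \<otimes>\<^bsub>hom_group C E S\<^esub> (\<iota> i \<bullet> x' i)) \<in> ?F \<rightarrow> carrier (hom_group C E S)"
        using mem[OF x] mem[OF x'] K.m_closed by simp
      fix i assume "i \<in> ?F"
      then have i: "i \<in> I" using F by blast
      show "\<iota> i \<bullet> ?y i = (\<iota> i \<bullet> x i) \<otimes>\<^bsub>hom_group C E S\<^esub> (\<iota> i \<bullet> x' i)"
        using i xI[OF i] c(3)[OF i] by (simp add: in_hom)
    qed simp
    also have "\<dots> = finprod (hom_group C E S) (\<lambda>i. \<iota> i \<bullet> x i) ?F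
        \<otimes>\<^bsub>hom_group C E S\<^esub> finprod (hom_group C E S) (\<lambda>i. \<iota> i \<bullet> x' i) ?F"
      by (rule K.finprod_multf) (use mem[OF x] mem[OF x'] in auto)
    also have "\<dots> = ?k x \<otimes>\<^bsub>hom_group C E S\<^esub> ?k x'"
      using coproduct_comparison_eq[OF cop E F xI(1)] coproduct_comparison_eq[OF cop E F xI(2)] by simp
    finally show ?thesis by simp
  qed
  have inj: "inj_on ?k (carrier ?G)"
  proof (rule inj_onI)
    fix x x' assume x: "x \<in> carrier ?G" "x' \<in> carrier ?G" "?k x = ?k x'"
    show "x = x'"
    proof (rule PiE_ext)
      show "x \<in> (\<Pi>\<^sub>E i\<in>I. Hom C E (X i))" "x' \<in> (\<Pi>\<^sub>E i\<in>I. Hom C E (X i))" using x unfolding carr by auto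
      show "x i = x' i" if "i \<in> I" for i using pk[OF x(1) that] pk[OF x(2) that] x(3) by simp
    qed
  qed
  have surj: "y \<in> ?k ` carrier ?G" if y: "y \<in> Hom C E S" for y
  proof -
    obtain F where F: "finite F" "F \<subseteq> I" "supported X S \<iota> E F y" using supp[OF sm cop y] by blast
    let ?x = "\<lambda>i\<in>I. if i \<in> F then p i \<bullet> y else Zero C E (X i)"
    have xI: "?x i \<in> Hom C E (X i)" if "i \<in> I" for i
      using coproduct_projectionD(1)[OF p that] y that E c(2) comp_in_hom zero_in_hom by auto
    have xF: "?s ?x \<subseteq> F" by auto
    then have mx: "?x \<in> carrier ?G" using xI F(1) finite_subset unfolding carr by auto
    have kx: "?k ?x = y"
    proof -
      have "?k ?x = finprod (hom_group C E S) (\<lambda>i. \<iota> i \<bullet> ?x i) F"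
        by (rule coproduct_comparison_eq[OF cop E F(1,2) xI xF])
      also have "\<dots> = finprod (hom_group C E S) (\<lambda>i. \<iota> i \<bullet> (p i \<bullet> y)) F"
      proof (rule K.finprod_cong')
        show "(\<lambda>i. \<iota> i \<bullet> (p i \<bullet> y)) \<in> F \<rightarrow> carrier (hom_group C E S)"
          using comp_in_hom[OF comp_in_hom[OF y coproduct_projectionD(1)[OF p]] c(3)] F(2) by auto
      qed (use F(2) in auto)
      also have "\<dots> = y" by (rule supported_expansion[OF cop p F(1,2) y F(3), symmetric])
      finally show ?thesis .
    qed
    show ?thesis using imageI[OF mx, of ?k] unfolding kx .
  qed
  have "?k \<in> hom ?G (hom_group C E S)"
    by (rule homI) (use closed hom in auto)
  moreover have "bij_betw ?k (carrier ?G) (carrier (hom_group C E S))"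
    using inj surj closed by (auto simp: bij_betw_def)
  ultimately show "?k \<in> iso ?G (hom_group C E S)" by (simp add: iso_def)
qed

lemma compact_obj: "compact_object U C E \<Longrightarrow> E \<in> Obj C"
  by (simp add: compact_object_def)

text \<open>The definition of compactness uses index sets in \<open>'u\<close>; reindexing along an
  injection carries the finite support back to an arbitrary small index set.\<close>

lemma compact_supported:
  fixes I :: "'i set"
  assumes "compact_object TYPE('u) C E" "small TYPE('u) I" "is_coproduct C I X S \<iota>" "y \<in> Hom C E S"
  shows "\<exists>F. finite F \<and> F \<subseteq> I \<and> supported X S \<iota> E F y"
proof -
  obtain \<phi> :: "'i \<Rightarrow> 'u" where \<phi>: "inj_on \<phi> I" using small_embedding[OF assms(2)] by blast
  let ?\<psi> = "inv_into I \<phi>"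
  have bij: "bij_betw ?\<psi> (\<phi> ` I) I" using \<phi> by (simp add: bij_betw_inv_into inj_on_imp_bij_betw)
  obtain F where F: "finite F" "F \<subseteq> \<phi> ` I"
    "supported (\<lambda>j. X (?\<psi> j)) S (\<lambda>j. \<iota> (?\<psi> j)) E F y"
    using compact_imp_supported_univ[OF assms(1) small_image[OF assms(2)] coproduct_reindex[OF assms(3) bij] assms(4)]
    by blast
  have "supported X S \<iota> E (?\<psi> ` F) y" using F(3) by (simp add: supported_def)
  moreover have "?\<psi> ` F \<subseteq> I" using F(2) bij by (auto simp: bij_betw_def)
  ultimately show ?thesis using F(1) by blast
qed

text \<open>Since \<open>y\<close> is a finite sum of its components, \<open>r\<close> can be tested
  on them one at a time.\<close>

lemma compact_vanish:
  assumes "compact_object TYPE('u) C E" "small TYPE('u) I" "is_coproduct C I X S \<iota>"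
    and "coproduct_projection I X S \<iota> p" "y \<in> Hom C E S" "r \<in> Hom C S Y"
    and "\<And>i. i \<in> I \<Longrightarrow> r \<bullet> (\<iota> i \<bullet> (p i \<bullet> y)) = Zero C E Y"
  shows "r \<bullet> y = Zero C E Y"
proof -
  obtain F where F: "finite F" "F \<subseteq> I" "supported X S \<iota> E F y"
    using compact_supported[OF assms(1,2,3,5)] by blast
  have E: "E \<in> Obj C" "Y \<in> Obj C" using assms(5,6) by (auto simp: in_hom)
  interpret H: comm_group "hom_group C E Y" by (rule hom_comm_group[OF E])
  have u: "\<iota> i \<bullet> (p i \<bullet> y) \<in> Hom C E S" if "i \<in> F" for i
    using comp_in_hom[OF comp_in_hom[OF assms(5) coproduct_projectionD(1)[OF assms(4)]] coproductD(3)[OF assms(3)]]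
      F(2) that by blast
  have "r \<bullet> y = r \<bullet> finprod (hom_group C E S) (\<lambda>i. \<iota> i \<bullet> (p i \<bullet> y)) F"
    using supported_expansion[OF assms(3,4) F(1,2) assms(5) F(3)] by simp
  also have "\<dots> = finprod (hom_group C E Y) (\<lambda>i. r \<bullet> (\<iota> i \<bullet> (p i \<bullet> y))) F"
    by (rule comp_finprod[OF F(1) u assms(6) E(1)])
  also have "\<dots> = Zero C E Y" by (rule H.finprod_one_eqI[simplified]) (use assms(7) F(2) in auto)
  finally show ?thesis .
qed

text \<open>A projection to a summand outside a finite support vanishes on all summands of that
  support, hence kills \<open>y\<close>.\<close>

lemma compact_projections_finite:
  assumes "compact_object TYPE('u) C E" "small TYPE('u) I" "is_coproduct C I X S \<iota>"
    and "coproduct_projection I X S \<iota> p" "y \<in> Hom C E S"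
  shows "finite {i \<in> I. p i \<bullet> y \<noteq> Zero C E (X i)}"
proof -
  obtain F where F: "finite F" "F \<subseteq> I" "supported X S \<iota> E F y"
    using compact_supported[OF assms(1,2,3,5)] by blast
  have "p i \<bullet> y = Zero C E (X i)" if "i \<in> I" "i \<notin> F" for i
  proof -
    have "\<forall>j\<in>F. p i \<bullet> \<iota> j = Zero C (X j) (X i)"
      using coproduct_projectionD(3)[OF assms(4) that(1)] F(2) that(2) by blast
    then show ?thesis using F(3) coproduct_projectionD(1)[OF assms(4) that(1)] by (auto simp: supported_def)
  qed
  then show ?thesis using F(1) by (auto intro: finite_subset[of _ F])
qed

end

section \<open>Compact objects under suspension and cones\<close>

context triangulated_category
begin

lemma coproduct_susp:
  assumes "is_coproduct T I X S \<iota>"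
  shows "is_coproduct T I (\<lambda>i. SuspO T (X i)) (SuspO T S) (\<lambda>i. SuspM T (\<iota> i))"
proof (rule is_coproductI)
  note c = coproductD[OF assms]
  show "SuspO T S \<in> Obj T" "\<And>i. i \<in> I \<Longrightarrow> SuspO T (X i) \<in> Obj T"
    "\<And>i. i \<in> I \<Longrightarrow> SuspM T (\<iota> i) \<in> Hom T (SuspO T (X i)) (SuspO T S)"
    using c susp_hom by auto
  fix Y' assume "Y' \<in> Obj T"
  then obtain Y where Y: "Y \<in> Obj T" "Y' = SuspO T Y" using desusp_obj by blast
  show "\<exists>h\<in>Hom T (SuspO T S) Y'. \<forall>i\<in>I. h \<bullet> SuspM T (\<iota> i) = g i"
    if g: "\<And>i. i \<in> I \<Longrightarrow> g i \<in> Hom T (SuspO T (X i)) Y'" for g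
  proof -
    have "\<forall>i\<in>I. \<exists>k. k \<in> Hom T (X i) Y \<and> g i = SuspM T k"
      using desusp_hom g Y c(2) by blast
    then obtain k where k: "\<And>i. i \<in> I \<Longrightarrow> k i \<in> Hom T (X i) Y \<and> g i = SuspM T (k i)" by metis
    then obtain h where h: "h \<in> Hom T S Y" "\<forall>i\<in>I. h \<bullet> \<iota> i = k i"
      using coproduct_ex[OF assms Y(1), of k] by blast
    have "SuspM T h \<bullet> SuspM T (\<iota> i) = g i" if "i \<in> I" for i
      using susp_comp[OF c(3)[OF that] h(1)] h(2) k that by simp
    then show ?thesis using susp_hom[OF h(1)] Y by blast
  qed
  show "h = h'" if h: "h \<in> Hom T (SuspO T S) Y'" "h' \<in> Hom T (SuspO T S) Y'"
    "\<And>i. i \<in> I \<Longrightarrow> h \<bullet> SuspM T (\<iota> i) = h' \<bullet> SuspM T (\<iota> i)" for h h'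
  proof -
    obtain k where k: "k \<in> Hom T S Y" "h = SuspM T k" using desusp_hom h Y c(1) by blast
    obtain k' where k': "k' \<in> Hom T S Y" "h' = SuspM T k'" using desusp_hom h Y c(1) by blast
    have "k \<bullet> \<iota> i = k' \<bullet> \<iota> i" if "i \<in> I" for i
    proof (rule susp_eq)
      show "k \<bullet> \<iota> i \<in> Arr T" "k' \<bullet> \<iota> i \<in> Arr T" using c(3)[OF that] k k' by (auto simp: in_hom)
      show "SuspM T (k \<bullet> \<iota> i) = SuspM T (k' \<bullet> \<iota> i)"
        using susp_comp[OF c(3)[OF that] k(1)] susp_comp[OF c(3)[OF that] k'(1)] h(3)[OF that] k k' by simp
    qed
    then have "k = k'" by (rule coproduct_eqI[OF assms k(1) k'(1)])
    then show ?thesis using k k' by simp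
  qed
qed

lemma coproduct_desusp:
  assumes "is_coproduct T I (\<lambda>i. SuspO T (X i)) (SuspO T S) \<iota>" "S \<in> Obj T" "\<And>i. i \<in> I \<Longrightarrow> X i \<in> Obj T"
  shows "\<exists>\<kappa>. is_coproduct T I X S \<kappa> \<and> (\<forall>i\<in>I. \<iota> i = SuspM T (\<kappa> i))"
proof -
  note c = coproductD[OF assms(1)]
  have "\<forall>i\<in>I. \<exists>k. k \<in> Hom T (X i) S \<and> \<iota> i = SuspM T k"
    using desusp_hom c(3) assms(2,3) by blast
  then obtain \<kappa> where \<kappa>: "\<And>i. i \<in> I \<Longrightarrow> \<kappa> i \<in> Hom T (X i) S \<and> \<iota> i = SuspM T (\<kappa> i)" by metis
  have "is_coproduct T I X S \<kappa>"
  proof (rule is_coproductI)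
    show "S \<in> Obj T" "\<And>i. i \<in> I \<Longrightarrow> X i \<in> Obj T" "\<And>i. i \<in> I \<Longrightarrow> \<kappa> i \<in> Hom T (X i) S"
      using assms \<kappa> by auto
    fix Y assume Y: "Y \<in> Obj T"
    show "\<exists>h\<in>Hom T S Y. \<forall>i\<in>I. h \<bullet> \<kappa> i = g i" if g: "\<And>i. i \<in> I \<Longrightarrow> g i \<in> Hom T (X i) Y" for g
    proof -
      obtain h' where h': "h' \<in> Hom T (SuspO T S) (SuspO T Y)" "\<forall>i\<in>I. h' \<bullet> \<iota> i = SuspM T (g i)"
        using coproduct_ex[OF assms(1) susp_obj[OF Y] susp_hom[OF g]] by blast
      obtain h where h: "h \<in> Hom T S Y" "h' = SuspM T h" using desusp_hom h'(1) assms(2) Y by blast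
      have "h \<bullet> \<kappa> i = g i" if "i \<in> I" for i
      proof (rule susp_eq)
        show "h \<bullet> \<kappa> i \<in> Arr T" "g i \<in> Arr T" using \<kappa>[OF that] h(1) g[OF that] by (auto simp: in_hom)
        show "SuspM T (h \<bullet> \<kappa> i) = SuspM T (g i)"
          using susp_comp[of "\<kappa> i" "X i" S h Y] \<kappa>[OF that] h h'(2) that by metis
      qed
      with h(1) show ?thesis by blast
    qed
    show "h = h'" if h: "h \<in> Hom T S Y" "h' \<in> Hom T S Y" "\<And>i. i \<in> I \<Longrightarrow> h \<bullet> \<kappa> i = h' \<bullet> \<kappa> i" for h h'
    proof (rule susp_eq)
      show "h \<in> Arr T" "h' \<in> Arr T" using h by (auto simp: in_hom)
      show "SuspM T h = SuspM T h'"
      proof (rule coproduct_eqI[OF assms(1) susp_hom[OF h(1)] susp_hom[OF h(2)]])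
        fix i assume "i \<in> I"
        then show "SuspM T h \<bullet> \<iota> i = SuspM T h' \<bullet> \<iota> i"
          using \<kappa> h susp_comp by metis
      qed
    qed
  qed
  with \<kappa> show ?thesis by blast
qed

text \<open>Suspension is bijective on objects and arrows, so a coproduct that receives a map from
  \<open>SuspO T E\<close> is itself the suspension of a coproduct.\<close>

lemma compact_susp:
  assumes "compact_object TYPE('u) T E"
  shows "compact_object TYPE('u) T (SuspO T E)"
proof (rule compact_if_supported)
  have E: "E \<in> Obj T" using compact_obj[OF assms] .
  then show "SuspO T E \<in> Obj T" by simp
  fix I :: "'u set" and X' S' \<iota>' y'
  assume sm: "small TYPE('u) I" and cop: "is_coproduct T I X' S' \<iota>'" and y': "y' \<in> Hom T (SuspO T E) S'"
  obtain S where S: "S \<in> Obj T" "S' = SuspO T S" using desusp_obj coproductD(1)[OF cop] by blast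
  have "\<forall>i\<in>I. \<exists>Z. Z \<in> Obj T \<and> X' i = SuspO T Z" using desusp_obj coproductD(2)[OF cop] by blast
  then obtain X where X: "\<And>i. i \<in> I \<Longrightarrow> X i \<in> Obj T \<and> X' i = SuspO T (X i)" by metis
  have "is_coproduct T I (\<lambda>i. SuspO T (X i)) (SuspO T S) \<iota>'"
    using cop X S by (simp add: is_coproduct_def)
  then obtain \<iota> where \<iota>: "is_coproduct T I X S \<iota>" "\<forall>i\<in>I. \<iota>' i = SuspM T (\<iota> i)"
    using coproduct_desusp[of I X S \<iota>'] S X by blast
  obtain y where y: "y \<in> Hom T E S" "y' = SuspM T y" using desusp_hom y' S E by blast
  obtain F where F: "finite F" "F \<subseteq> I" "supported X S \<iota> E F y"
    using compact_supported[OF assms sm \<iota>(1) y(1)] by blast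
  have "supported X' S' \<iota>' (SuspO T E) F y'"
    unfolding supported_def
  proof (intro allI ballI impI)
    fix Y' r' assume r': "r' \<in> Hom T S' Y'" and z: "\<forall>i\<in>F. r' \<bullet> \<iota>' i = Zero T (X' i) Y'"
    have "Y' \<in> Obj T" using r' by (simp add: in_hom)
    then obtain Y where Y: "Y \<in> Obj T" "Y' = SuspO T Y" using desusp_obj by blast
    obtain r where r: "r \<in> Hom T S Y" "r' = SuspM T r" using desusp_hom r' S Y by blast
    have "r \<bullet> \<iota> i = Zero T (X i) Y" if "i \<in> F" for i
    proof (rule susp_eq)
      have i: "i \<in> I" using that F(2) by blast
      have \<iota>i: "\<iota> i \<in> Hom T (X i) S" using coproductD(3)[OF \<iota>(1) i] .
      then show "r \<bullet> \<iota> i \<in> Arr T" "Zero T (X i) Y \<in> Arr T" using r Y by (auto simp: in_hom)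
      show "SuspM T (r \<bullet> \<iota> i) = SuspM T (Zero T (X i) Y)"
        using susp_comp[OF \<iota>i r(1)] bspec[OF z that] bspec[OF \<iota>(2) i] X[OF i] r(2) Y by simp
    qed
    then have "r \<bullet> y = Zero T E Y" using F(3) r(1) by (auto simp: supported_def)
    then show "r' \<bullet> y' = Zero T (SuspO T E) Y'"
      using susp_comp[OF y(1) r(1)] r(2) y(2) Y E by simp
  qed
  with F show "\<exists>F. finite F \<and> F \<subseteq> I \<and> supported X' S' \<iota>' (SuspO T E) F y'" by blast
qed

lemma compact_desusp:
  assumes "compact_object TYPE('u) T (SuspO T E)" "E \<in> Obj T"
  shows "compact_object TYPE('u) T E"
proof (rule compact_if_supported[OF assms(2)])
  fix I :: "'u set" and X S \<iota> y
  assume sm: "small TYPE('u) I" and cop: "is_coproduct T I X S \<iota>" and y: "y \<in> Hom T E S"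
  obtain F where F: "finite F" "F \<subseteq> I"
    "supported (\<lambda>i. SuspO T (X i)) (SuspO T S) (\<lambda>i. SuspM T (\<iota> i)) (SuspO T E) F (SuspM T y)"
    using compact_supported[OF assms(1) sm coproduct_susp[OF cop] susp_hom[OF y]] by blast
  have "supported X S \<iota> E F y"
    unfolding supported_def
  proof (intro allI ballI impI)
    fix Y r assume r: "r \<in> Hom T S Y" and z: "\<forall>i\<in>F. r \<bullet> \<iota> i = Zero T (X i) Y"
    have Y: "Y \<in> Obj T" using r by (simp add: in_hom)
    have "SuspM T r \<bullet> SuspM T (\<iota> i) = Zero T (SuspO T (X i)) (SuspO T Y)" if "i \<in> F" for i
      using susp_comp[of "\<iota> i" "X i" S r Y] coproductD(2,3)[OF cop, of i] that F(2) z r Y by auto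
    then have "SuspM T r \<bullet> SuspM T y = Zero T (SuspO T E) (SuspO T Y)"
      using F(3) susp_hom[OF r] by (auto simp: supported_def)
    then have "SuspM T (r \<bullet> y) = SuspM T (Zero T E Y)"
      using susp_comp[OF y r] Y assms(2) by simp
    then show "r \<bullet> y = Zero T E Y"
      by (rule susp_eq[rotated 2]) (use y r Y in \<open>auto simp: in_hom\<close>)
  qed
  with F show "\<exists>F. finite F \<and> F \<subseteq> I \<and> supported X S \<iota> E F y" by blast
qed

lemma compact_zero:
  assumes "zero_object T E"
  shows "compact_object TYPE('u) T E"
proof (rule compact_if_supported)
  show E: "E \<in> Obj T" using zero_object_obj[OF assms] .
  fix I :: "'u set" and X S \<iota> y
  assume "is_coproduct T I X S \<iota>" "y \<in> Hom T E S"
  then have "y = Zero T E S" using zero_object_hom(2)[OF assms] by blast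
  then have "supported X S \<iota> E {} y" using E by (auto simp: supported_def in_hom)
  then show "\<exists>F. finite F \<and> F \<subseteq> I \<and> supported X S \<iota> E F y" by blast
qed

text \<open>Let \<open>F\<close> support the restriction of \<open>y\<close> to \<open>B\<close>,
  and let \<open>\<pi>\<close> kill the summands of \<open>F\<close> and fix the others. Then
  \<open>\<pi> \<bullet> y\<close> vanishes on \<open>B\<close>, so it factors through
  \<open>SuspO T A\<close> by a map with finite support \<open>F'\<close>. A map \<open>r\<close>
  that vanishes on \<open>F\<close> satisfies \<open>r \<bullet> \<pi> = r\<close>, hence
  \<open>y\<close> is supported on the union.\<close>

lemma compact_cone:
  assumes "is_tri A B E" "compact_object TYPE('u) T A" "compact_object TYPE('u) T B"
  shows "compact_object TYPE('u) T E"
proof (rule compact_if_supported)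
  obtain f g h where t: "triangle f g h A B E" using assms(1) by (auto simp: is_tri_def)
  note d = triangleD[OF t]
  show "E \<in> Obj T" by fact
  fix I :: "'u set" and X S \<iota> y
  assume sm: "small TYPE('u) I" and cop: "is_coproduct T I X S \<iota>" and y: "y \<in> Hom T E S"
  note c = coproductD[OF cop]
  have yg: "y \<bullet> g \<in> Hom T B S" using y d by (simp add: in_hom)
  obtain F where F: "finite F" "F \<subseteq> I" "supported X S \<iota> B F (y \<bullet> g)"
    using compact_supported[OF assms(3) sm cop yg] by blast
  have "\<exists>\<pi>\<in>Hom T S S. \<forall>i\<in>I. \<pi> \<bullet> \<iota> i = (if i \<in> F then Zero T (X i) S else \<iota> i)"
    by (rule coproduct_ex[OF cop]) (use c zero_in_hom in auto)
  then obtain \<pi> where \<pi>: "\<pi> \<in> Hom T S S" "\<forall>i\<in>I. \<pi> \<bullet> \<iota> i = (if i \<in> F then Zero T (X i) S else \<iota> i)"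
    by blast
  have "\<forall>i\<in>F. \<pi> \<bullet> \<iota> i = Zero T (X i) S" using F(2) \<pi>(2) by auto
  then have "\<pi> \<bullet> (y \<bullet> g) = Zero T B S" using F(3) \<pi>(1) by (simp add: supported_def)
  then have "(\<pi> \<bullet> y) \<bullet> g = Zero T B S" using \<pi>(1) y d by (simp add: in_hom)
  then obtain z where z: "z \<in> Hom T (SuspO T A) S" "z \<bullet> h = \<pi> \<bullet> y"
    using extend_third[OF t comp_in_hom[OF y \<pi>(1)]] by blast
  obtain F' where F': "finite F'" "F' \<subseteq> I" "supported X S \<iota> (SuspO T A) F' z"
    using compact_supported[OF compact_susp[OF assms(2)] sm cop z(1)] by blast
  have "supported X S \<iota> E (F \<union> F') y"
    unfolding supported_def
  proof (intro allI ballI impI)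
    fix Y r assume r: "r \<in> Hom T S Y" and v: "\<forall>i\<in>F \<union> F'. r \<bullet> \<iota> i = Zero T (X i) Y"
    have "r \<bullet> \<pi> = r"
    proof (rule coproduct_eqI[OF cop])
      show "r \<bullet> \<pi> \<in> Hom T S Y" "r \<in> Hom T S Y" using comp_in_hom[OF \<pi>(1) r] r by auto
      fix i assume i: "i \<in> I"
      have "(r \<bullet> \<pi>) \<bullet> \<iota> i = r \<bullet> (\<pi> \<bullet> \<iota> i)" using comp_assoc[OF c(3)[OF i] \<pi>(1) r] .
      also have "\<dots> = r \<bullet> \<iota> i"
        using \<pi>(2) i v c(2)[OF i] r by (auto simp: in_hom)
      finally show "(r \<bullet> \<pi>) \<bullet> \<iota> i = r \<bullet> \<iota> i" .
    qed
    then have "r \<bullet> y = r \<bullet> (\<pi> \<bullet> y)" using comp_assoc[OF y \<pi>(1) r] by simp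
    also have "\<dots> = (r \<bullet> z) \<bullet> h" using comp_assoc[OF d(4) z(1) r] z(2) by simp
    also have "r \<bullet> z = Zero T (SuspO T A) Y" using F'(3) r v by (auto simp: supported_def)
    finally show "r \<bullet> y = Zero T E Y" using d r by (simp add: in_hom)
  qed
  with F F' show "\<exists>F. finite F \<and> F \<subseteq> I \<and> supported X S \<iota> E F y"
    by (intro exI[of _ "F \<union> F'"]) auto
qed

end

section \<open>Shifts and orthogonality\<close>

text \<open>Suspension is invertible, so the properties of shifts considered below are equivalent
  for neighbouring degrees; one equivalence then serves both directions of the induction.\<close>

lemma int_iff_induct:
  fixes P :: "int \<Rightarrow> bool"
  assumes "\<And>n. P (n + 1) \<longleftrightarrow> P n"
  shows "P n \<longleftrightarrow> P 0"
proof (induction n rule: int_induct[where k = 0])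
  case (step2 i)
  then show ?case using assms[of "i - 1"] by simp
qed (use assms in auto)

context triangulated_category
begin

lemma desusp_inv:
  assumes "X \<in> Obj T"
  shows "inv_into (Obj T) (SuspO T) X \<in> Obj T" "SuspO T (inv_into (Obj T) (SuspO T) X) = X"
  using assms susp_obj_bij inv_into_into[of X "SuspO T" "Obj T"] f_inv_into_f[of X "SuspO T" "Obj T"]
  by (auto simp: bij_betw_def)

lemma shift_0 [simp]: "shift T 0 X = X"
  by (simp add: shift_def)

lemma shift_obj [simp]:
  assumes "X \<in> Obj T"
  shows "shift T n X \<in> Obj T"
proof -
  have "(SuspO T ^^ m) X \<in> Obj T" "(inv_into (Obj T) (SuspO T) ^^ m) X \<in> Obj T" for m
    by (induction m) (use assms desusp_inv(1) in auto)
  then show ?thesis by (simp add: shift_def)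
qed

lemma shift_succ:
  assumes "X \<in> Obj T"
  shows "shift T (n + 1) X = SuspO T (shift T n X)"
proof (cases "n \<ge> 0")
  case True
  then show ?thesis by (simp add: shift_def nat_add_distrib)
next
  case False
  \<comment> \<open>\<open>m\<close> counts the desuspensions in \<open>shift T (n + 1) X\<close>,
    one fewer than in \<open>shift T n X\<close>.\<close>
  define m where "m = nat (- n - 1)"
  have m: "n = - int m - 1" using False by (simp add: m_def)
  have "shift T n X = inv_into (Obj T) (SuspO T) ((inv_into (Obj T) (SuspO T) ^^ m) X)"
    by (simp add: shift_def m nat_add_distrib)
  moreover have "shift T (n + 1) X = (inv_into (Obj T) (SuspO T) ^^ m) X"
    by (simp add: shift_def m)
  moreover have "(inv_into (Obj T) (SuspO T) ^^ m) X \<in> Obj T"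
    by (induction m) (use assms desusp_inv(1) in auto)
  ultimately show ?thesis using desusp_inv(2) by simp
qed

lemma shift_add:
  assumes "X \<in> Obj T"
  shows "shift T (m + n) X = shift T m (shift T n X)"
proof -
  have "shift T (m + 1 + n) X = shift T (m + 1) (shift T n X)
      \<longleftrightarrow> shift T (m + n) X = shift T m (shift T n X)" for m
    using shift_succ[of X "m + n"] shift_succ[of "shift T n X" m] assms by (simp add: algebra_simps)
  from int_iff_induct[of "\<lambda>m. shift T (m + n) X = shift T m (shift T n X)", OF this]
  show ?thesis by simp
qed

lemma shift_eq_iff:
  assumes "X \<in> Obj T" "Y \<in> Obj T"
  shows "shift T n X = Y \<longleftrightarrow> X = shift T (- n) Y"
  using shift_add[of X "- n" n] shift_add[of Y n "- n"] assms by auto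

lemma shift_1: "X \<in> Obj T \<Longrightarrow> shift T 1 X = SuspO T X"
  using shift_succ[of X 0] by simp

lemma is_tri_shift:
  assumes "X \<in> Obj T" "Y \<in> Obj T" "Z \<in> Obj T"
  shows "is_tri (shift T n X) (shift T n Y) (shift T n Z) \<longleftrightarrow> is_tri X Y Z"
  using int_iff_induct[of "\<lambda>n. is_tri (shift T n X) (shift T n Y) (shift T n Z)" n]
    is_tri_susp_iff shift_succ assms by simp

lemma coproduct_shift:
  assumes "is_coproduct T I X S \<iota>"
  shows "\<exists>\<kappa>. is_coproduct T I (\<lambda>i. shift T n (X i)) (shift T n S) \<kappa>"
proof -
  note c = coproductD[OF assms]
  let ?P = "\<lambda>n. \<exists>\<kappa>. is_coproduct T I (\<lambda>i. shift T n (X i)) (shift T n S) \<kappa>"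
  have cong: "is_coproduct T I (\<lambda>i. shift T (n + 1) (X i)) (shift T (n + 1) S) \<kappa>
      \<longleftrightarrow> is_coproduct T I (\<lambda>i. SuspO T (shift T n (X i))) (SuspO T (shift T n S)) \<kappa>" for n \<kappa>
    using shift_succ[OF c(1)] shift_succ[OF c(2)] by (simp add: is_coproduct_def)
  have "?P (n + 1) \<longleftrightarrow> ?P n" for n
  proof
    assume "?P (n + 1)"
    then show "?P n" unfolding cong using coproduct_desusp c by fastforce
  next
    assume "?P n"
    then show "?P (n + 1)" unfolding cong using coproduct_susp by blast
  qed
  from int_iff_induct[of ?P, OF this] show ?thesis using assms by auto
qed

lemma compact_shift:
  assumes "compact_object TYPE('u) T E"
  shows "compact_object TYPE('u) T (shift T n E)"
proof -
  have E: "E \<in> Obj T" using compact_obj[OF assms] .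
  have "compact_object TYPE('u) T (shift T (n + 1) E) \<longleftrightarrow> compact_object TYPE('u) T (shift T n E)" for n
    using compact_susp[where 'u = 'u, of "shift T n E"] compact_desusp[where 'u = 'u, of "shift T n E"] E by (auto simp: shift_succ)
  from int_iff_induct[of "\<lambda>n. compact_object TYPE('u) T (shift T n E)", OF this] show ?thesis using assms by simp
qed

definition orth :: "'a \<Rightarrow> 'a \<Rightarrow> bool" where
  "orth X Y \<longleftrightarrow> (\<forall>f\<in>Hom T X Y. f = Zero T X Y)"

lemma orthD: "orth X Y \<Longrightarrow> f \<in> Hom T X Y \<Longrightarrow> f = Zero T X Y"
  by (simp add: orth_def)

lemma orth_iff: "X \<in> Obj T \<Longrightarrow> Y \<in> Obj T \<Longrightarrow> orth X Y \<longleftrightarrow> Hom T X Y = {Zero T X Y}"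
  using zero_in_hom by (auto simp: orth_def)

lemma orth_susp:
  assumes "X \<in> Obj T" "Y \<in> Obj T"
  shows "orth (SuspO T X) (SuspO T Y) \<longleftrightarrow> orth X Y"
proof
  assume o: "orth (SuspO T X) (SuspO T Y)"
  show "orth X Y"
    unfolding orth_def
  proof
    fix f assume f: "f \<in> Hom T X Y"
    then have "SuspM T f = SuspM T (Zero T X Y)" using orthD[OF o susp_hom[OF f]] assms by simp
    then show "f = Zero T X Y" by (rule susp_eq[rotated 2]) (use f assms in \<open>auto simp: in_hom\<close>)
  qed
next
  assume o: "orth X Y"
  show "orth (SuspO T X) (SuspO T Y)"
    unfolding orth_def
  proof
    fix f assume "f \<in> Hom T (SuspO T X) (SuspO T Y)"
    then obtain k where "k \<in> Hom T X Y" "f = SuspM T k" using desusp_hom assms by blast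
    then show "f = Zero T (SuspO T X) (SuspO T Y)" using orthD[OF o, of k] assms by simp
  qed
qed

lemma orth_shift:
  assumes "X \<in> Obj T" "Y \<in> Obj T"
  shows "orth (shift T n X) (shift T n Y) \<longleftrightarrow> orth X Y"
  using int_iff_induct[of "\<lambda>n. orth (shift T n X) (shift T n Y)" n] orth_susp shift_succ assms by simp

lemma orth_shift_left:
  assumes "X \<in> Obj T" "Y \<in> Obj T"
  shows "orth (shift T n X) Y \<longleftrightarrow> orth X (shift T (- n) Y)"
  using orth_shift[of X "shift T (- n) Y" n] shift_add[of Y n "- n"] assms by simp

lemma orth_tri_left:
  assumes "is_tri X Y Z" "orth X W" "orth Z W" "W \<in> Obj T"
  shows "orth Y W"
  unfolding orth_def
proof
  fix a assume a: "a \<in> Hom T Y W"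
  obtain f g h where t: "triangle f g h X Y Z" using assms(1) by (auto simp: is_tri_def)
  have "a \<bullet> f = Zero T X W" by (rule orthD[OF assms(2) comp_in_hom[OF triangleD(2)[OF t] a]])
  then obtain b where b: "b \<in> Hom T Z W" "b \<bullet> g = a" using extend_second[OF t a] by blast
  then have "a = Zero T Z W \<bullet> g" using orthD[OF assms(3)] by simp
  then show "a = Zero T Y W" using triangleD[OF t] assms(4) by (simp add: in_hom)
qed

lemma orth_tri_right:
  assumes "is_tri X Y Z" "orth W X" "orth W Z" "W \<in> Obj T"
  shows "orth W Y"
  unfolding orth_def
proof
  fix a assume a: "a \<in> Hom T W Y"
  obtain f g h where t: "triangle f g h X Y Z" using assms(1) by (auto simp: is_tri_def)
  have "g \<bullet> a = Zero T W Z" by (rule orthD[OF assms(3) comp_in_hom[OF a triangleD(3)[OF t]]])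
  then obtain b where b: "b \<in> Hom T W X" "f \<bullet> b = a" using lift_first[OF t a] by blast
  then have "a = f \<bullet> Zero T W X" using orthD[OF assms(2)] by simp
  then show "a = Zero T W Y" using triangleD[OF t] assms(4) by (simp add: in_hom)
qed

lemma orth_retract:
  assumes "i \<in> Hom T X Y" "r \<in> Hom T Y X" "r \<bullet> i = Id T X"
  shows "orth Y W \<Longrightarrow> W \<in> Obj T \<Longrightarrow> orth X W" "orth W Y \<Longrightarrow> W \<in> Obj T \<Longrightarrow> orth W X"
proof -
  show "orth X W" if o: "orth Y W" "W \<in> Obj T"
    unfolding orth_def
  proof
    fix a assume a: "a \<in> Hom T X W"
    have "a = (a \<bullet> r) \<bullet> i" using comp_assoc[OF assms(1,2) a] assms(3) a by (simp add: in_hom)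
    also have "\<dots> = Zero T X W" using orthD[OF o(1) comp_in_hom[OF assms(2) a]] assms(1) o by (simp add: in_hom)
    finally show "a = Zero T X W" .
  qed
  show "orth W X" if o: "orth W Y" "W \<in> Obj T"
    unfolding orth_def
  proof
    fix a assume a: "a \<in> Hom T W X"
    have "a = r \<bullet> (i \<bullet> a)" using comp_assoc[OF a assms(1,2)] assms(3) a by (simp add: in_hom)
    also have "\<dots> = Zero T W X" using orthD[OF o(1) comp_in_hom[OF a assms(1)]] assms(2) o by (simp add: in_hom)
    finally show "a = Zero T W X" .
  qed
qed

lemma orth_iso:
  assumes "isomorphic T X Y"
  shows "orth X W \<Longrightarrow> W \<in> Obj T \<Longrightarrow> orth Y W" "orth W X \<Longrightarrow> W \<in> Obj T \<Longrightarrow> orth W Y"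
proof -
  obtain f g where "f \<in> Hom T X Y" "g \<in> Hom T Y X" "f \<bullet> g = Id T Y"
    using assms by (elim isomorphicE)
  from orth_retract[OF this(2,1,3)]
  show "orth X W \<Longrightarrow> W \<in> Obj T \<Longrightarrow> orth Y W" "orth W X \<Longrightarrow> W \<in> Obj T \<Longrightarrow> orth W Y" by auto
qed

lemma orth_biproduct_summand:
  assumes "is_biproduct T X Y Z"
  shows "orth Z W \<Longrightarrow> W \<in> Obj T \<Longrightarrow> orth X W" "orth W Z \<Longrightarrow> W \<in> Obj T \<Longrightarrow> orth W X"
proof -
  obtain i p where "i \<in> Hom T X Z" "p \<in> Hom T Z X" "p \<bullet> i = Id T X"
    using assms by (auto simp: is_biproduct_def biproduct_def)
  from orth_retract[OF this]
  show "orth Z W \<Longrightarrow> W \<in> Obj T \<Longrightarrow> orth X W" "orth W Z \<Longrightarrow> W \<in> Obj T \<Longrightarrow> orth W X" by auto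
qed

lemma orth_zero: "zero_object T Z \<Longrightarrow> orth Z W" "zero_object T Z \<Longrightarrow> orth W Z"
  using zero_object_hom by (auto simp: orth_def)

lemma orth_self: "orth X X \<Longrightarrow> X \<in> Obj T \<Longrightarrow> zero_object T X"
  using orthD[of X X "Id T X"] id_in_hom by (auto simp: zero_object_iff)

section \<open>Compact objects and a compact generator\<close>

text \<open>\<open>lifts D S p X\<close>: the maps \<open>p n\<close> exhibit \<open>S\<close> as a product of the \<open>D n\<close>, as far as maps
  from \<open>X\<close> are concerned.\<close>

definition lifts :: "(nat \<Rightarrow> 'a) \<Rightarrow> 'a \<Rightarrow> (nat \<Rightarrow> 'b) \<Rightarrow> 'a \<Rightarrow> bool" where
  "lifts D S p X \<longleftrightarrow>
    (\<forall>g. (\<forall>n. g n \<in> Hom T X (D n)) \<longrightarrow> (\<exists>h\<in>Hom T X S. \<forall>n. p n \<bullet> h = g n)) \<and>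
    (\<forall>h\<in>Hom T X S. (\<forall>n. p n \<bullet> h = Zero T X (D n)) \<longrightarrow> h = Zero T X S)"

lemma lifts_ex:
  assumes "lifts D S p X" "\<And>n. g n \<in> Hom T X (D n)"
  shows "\<exists>h\<in>Hom T X S. \<forall>n. p n \<bullet> h = g n"
  using assms(1)[unfolded lifts_def, THEN conjunct1, rule_format, of g] assms(2) by blast

lemma lifts_zero:
  assumes "lifts D S p X" "h \<in> Hom T X S" "\<And>n. p n \<bullet> h = Zero T X (D n)"
  shows "h = Zero T X S"
  using assms unfolding lifts_def by blast

text \<open>The five lemma for Hom(-, S) -> prod Hom(-, D n), applied to the consecutive terms
  \<open>SuspO T X\<close>, \<open>SuspO T Z\<close>, \<open>Y\<close>, \<open>X\<close>,
  \<open>Z\<close>. Writing the third vertex as a suspension gives a name to the fifth term.\<close>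

lemma lifts_middle:
  assumes p: "\<And>n. p n \<in> Hom T S (D n)"
    and t: "triangle f g h X Y (SuspO T Z)" "Z \<in> Obj T"
    and X: "lifts D S p X" "lifts D S p (SuspO T X)"
    and Z: "lifts D S p Z" "lifts D S p (SuspO T Z)"
  shows "lifts D S p Y"
  unfolding lifts_def
proof (intro conjI allI ballI impI)
  note d = triangleD[OF t(1)]
  have S: "S \<in> Obj T" "\<And>n. D n \<in> Obj T" using p by (auto simp: in_hom)
  obtain k where k: "triangle k f g Z X Y" using triangle_unrotate[OF t] by blast
  note dk = triangleD[OF k]
  fix q assume q: "\<forall>n. q n \<in> Hom T Y (D n)"
  have "\<And>n. q n \<bullet> f \<in> Hom T X (D n)" using q d(2) comp_in_hom by blast
  then obtain x where x: "x \<in> Hom T X S" "\<And>n. p n \<bullet> x = q n \<bullet> f" using lifts_ex[OF X(1), of "\<lambda>n. q n \<bullet> f"] by blast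
  have "x \<bullet> k = Zero T Z S"
  proof (rule lifts_zero[OF Z(1) comp_in_hom[OF dk(2) x(1)]])
    fix n
    have "p n \<bullet> (x \<bullet> k) = (q n \<bullet> f) \<bullet> k" using comp_assoc[OF dk(2) x(1) p] x(2) by simp
    also have "\<dots> = q n \<bullet> (f \<bullet> k)" using comp_assoc[OF dk(2) d(2)] q by blast
    also have "\<dots> = Zero T Z (D n)" using triangle_comp_first[OF k] q t(2) by (simp add: in_hom)
    finally show "p n \<bullet> (x \<bullet> k) = Zero T Z (D n)" .
  qed
  then obtain y where y: "y \<in> Hom T Y S" "y \<bullet> f = x" using extend_second[OF k x(1)] by blast
  \<comment> \<open>\<open>y\<close> is only known to give the right maps after restriction along
    \<open>f\<close>. The discrepancy \<open>e n\<close> therefore factors through \<open>g\<close>,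
    and lifting the factors to \<open>S\<close> yields the correction
    \<open>c \<bullet> g\<close>.\<close>
  define e where "e n = q n \<boxplus> neg T (p n \<bullet> y)" for n
  have e: "e n \<in> Hom T Y (D n)" for n using q p y by (simp add: e_def in_hom)
  have "e n \<bullet> f = Zero T X (D n)" for n
    using q p[of n] y x(2)[of n] d by (simp add: e_def in_hom)
  then have "\<forall>n. \<exists>z. z \<in> Hom T (SuspO T Z) (D n) \<and> z \<bullet> g = e n" using extend_second[OF t(1) e] by blast
  then obtain z where z: "\<And>n. z n \<in> Hom T (SuspO T Z) (D n)" "\<And>n. z n \<bullet> g = e n" by metis
  obtain c where c: "c \<in> Hom T (SuspO T Z) S" "\<And>n. p n \<bullet> c = z n" using lifts_ex[OF Z(2) z(1)] by blast
  show "\<exists>r\<in>Hom T Y S. \<forall>n. p n \<bullet> r = q n"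
  proof (intro bexI allI)
    show cy: "(c \<bullet> g) \<boxplus> y \<in> Hom T Y S" using c y d by (simp add: in_hom)
    fix n
    have cg: "p n \<bullet> (c \<bullet> g) = e n" using comp_assoc[OF d(3) c(1) p] c(2) z(2) by simp
    have "p n \<bullet> ((c \<bullet> g) \<boxplus> y) = e n \<boxplus> (p n \<bullet> y)"
      using comp_add_right[OF comp_in_hom[OF d(3) c(1)] y(1) p] cg by simp
    also have "\<dots> = q n \<boxplus> (neg T (p n \<bullet> y) \<boxplus> (p n \<bullet> y))"
      unfolding e_def by (rule add_assoc[of _ Y "D n"]) (use q p[of n] y in \<open>auto simp: in_hom\<close>)
    also have "\<dots> = q n" using q p[of n] y by (simp add: in_hom)
    finally show "p n \<bullet> ((c \<bullet> g) \<boxplus> y) = q n" .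
  qed
next
  note d = triangleD[OF t(1)]
  have S: "S \<in> Obj T" "\<And>n. D n \<in> Obj T" using p by (auto simp: in_hom)
  fix r assume r: "r \<in> Hom T Y S" and v: "\<forall>n. p n \<bullet> r = Zero T Y (D n)"
  have "r \<bullet> f = Zero T X S"
  proof (rule lifts_zero[OF X(1) comp_in_hom[OF d(2) r]])
    fix n
    have "p n \<bullet> (r \<bullet> f) = (p n \<bullet> r) \<bullet> f" using comp_assoc[OF d(2) r p] by simp
    then show "p n \<bullet> (r \<bullet> f) = Zero T X (D n)" using v d S by (simp add: in_hom)
  qed
  then obtain z where z: "z \<in> Hom T (SuspO T Z) S" "z \<bullet> g = r" using extend_second[OF t(1) r] by blast
  \<comment> \<open>The components of \<open>z\<close> vanish after restriction along
    \<open>g\<close>, so they come from \<open>SuspO T X\<close> through \<open>h\<close>. Lifting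
    them to \<open>c\<close> shows that \<open>z\<close> factors through \<open>h\<close>, and
    \<open>h \<bullet> g\<close> is zero.\<close>
  have "\<exists>w\<in>Hom T (SuspO T X) (D n). w \<bullet> h = p n \<bullet> z" for n
  proof (rule extend_third[OF t(1) comp_in_hom[OF z(1) p]])
    show "(p n \<bullet> z) \<bullet> g = Zero T Y (D n)" using comp_assoc[OF d(3) z(1) p] z(2) v by simp
  qed
  then obtain w where w: "\<And>n. w n \<in> Hom T (SuspO T X) (D n)" "\<And>n. w n \<bullet> h = p n \<bullet> z" by metis
  obtain c where c: "c \<in> Hom T (SuspO T X) S" "\<And>n. p n \<bullet> c = w n" using lifts_ex[OF X(2) w(1)] by blast
  have ch: "c \<bullet> h \<in> Hom T (SuspO T Z) S" using comp_in_hom[OF d(4) c(1)] .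
  have "z \<boxplus> neg T (c \<bullet> h) = Zero T (SuspO T Z) S"
  proof (rule lifts_zero[OF Z(2) diff_in_hom[OF z(1) ch]])
    fix n
    have pch: "p n \<bullet> (c \<bullet> h) = p n \<bullet> z" using comp_assoc[OF d(4) c(1) p] c(2) w(2) by simp
    show "p n \<bullet> (z \<boxplus> neg T (c \<bullet> h)) = Zero T (SuspO T Z) (D n)"
      using p[of n] z(1) ch pch d by (simp add: in_hom)
  qed
  then have "z = c \<bullet> h" by (rule diff_zero_imp_eq[OF z(1) ch])
  then have "r = c \<bullet> (h \<bullet> g)" using z(2) comp_assoc[OF d(3,4) c(1)] by simp
  then show "r = Zero T Y S" using triangle_comp_second[OF t(1)] c(1) d by (simp add: in_hom)
qed

text \<open>Maps out of a coproduct of any size are families of maps out of the summands, and a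
  product over \<open>I\<close> commutes with a product over \<open>n\<close>. This is why
  \<open>lifts\<close>, and not orthogonality to almost all \<open>D n\<close>, is carried up the
  tower.\<close>

lemma lifts_coproduct:
  assumes p: "\<And>n. p n \<in> Hom T S (D n)"
    and cop: "is_coproduct T I X P \<iota>" and X: "\<And>i. i \<in> I \<Longrightarrow> lifts D S p (X i)"
  shows "lifts D S p P"
  unfolding lifts_def
proof (intro conjI allI ballI impI)
  note c = coproductD[OF cop]
  have S: "S \<in> Obj T" "\<And>n. D n \<in> Obj T" using p by (auto simp: in_hom)
  {
    fix g assume g: "\<forall>n. g n \<in> Hom T P (D n)"
    have "\<exists>h. h \<in> Hom T (X i) S \<and> (\<forall>n. p n \<bullet> h = g n \<bullet> \<iota> i)" if "i \<in> I" for i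
      using lifts_ex[OF X[OF that], of "\<lambda>n. g n \<bullet> \<iota> i"] comp_in_hom[OF c(3)[OF that]] g by metis
    then obtain h where h: "\<And>i. i \<in> I \<Longrightarrow> h i \<in> Hom T (X i) S"
      "\<And>i n. i \<in> I \<Longrightarrow> p n \<bullet> h i = g n \<bullet> \<iota> i" by metis
    obtain k where k: "k \<in> Hom T P S" "\<And>i. i \<in> I \<Longrightarrow> k \<bullet> \<iota> i = h i"
      using coproduct_ex[OF cop S(1) h(1)] by blast
    have "p n \<bullet> k = g n" for n
    proof (rule coproduct_eqI[OF cop comp_in_hom[OF k(1) p]])
      show "g n \<in> Hom T P (D n)" using g by blast
      fix i assume i: "i \<in> I"
      show "(p n \<bullet> k) \<bullet> \<iota> i = g n \<bullet> \<iota> i" using comp_assoc[OF c(3)[OF i] k(1) p] k(2)[OF i] h(2)[OF i] by simp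
    qed
    with k(1) show "\<exists>h\<in>Hom T P S. \<forall>n. p n \<bullet> h = g n" by blast
  next
    fix h assume h: "h \<in> Hom T P S" "\<forall>n. p n \<bullet> h = Zero T P (D n)"
    show "h = Zero T P S"
    proof (rule coproduct_eqI[OF cop h(1)])
      show "Zero T P S \<in> Hom T P S" using c S by (simp add: in_hom)
      fix i assume i: "i \<in> I"
      have "h \<bullet> \<iota> i = Zero T (X i) S"
      proof (rule lifts_zero[OF X[OF i] comp_in_hom[OF c(3)[OF i] h(1)]])
        fix n
        have "p n \<bullet> (h \<bullet> \<iota> i) = Zero T P (D n) \<bullet> \<iota> i" using comp_assoc[OF c(3)[OF i] h(1) p] h(2) by metis
        then show "p n \<bullet> (h \<bullet> \<iota> i) = Zero T (X i) (D n)" using c(3)[OF i] S by (simp add: in_hom)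
      qed
      then show "h \<bullet> \<iota> i = Zero T P S \<bullet> \<iota> i" using c(3)[OF i] S by (simp add: in_hom)
    qed
  }
qed

lemma lifts_retract:
  assumes p: "\<And>n. p n \<in> Hom T S (D n)"
    and r: "i \<in> Hom T X Y" "r \<in> Hom T Y X" "r \<bullet> i = Id T X" and Y: "lifts D S p Y"
  shows "lifts D S p X"
  unfolding lifts_def
proof (intro conjI allI ballI impI)
  have S: "S \<in> Obj T" "\<And>n. D n \<in> Obj T" using p by (auto simp: in_hom)
  {
    fix g assume g: "\<forall>n. g n \<in> Hom T X (D n)"
    then have "\<And>n. g n \<bullet> r \<in> Hom T Y (D n)" using r(2) comp_in_hom by blast
    then obtain h where h: "h \<in> Hom T Y S" "\<And>n. p n \<bullet> h = g n \<bullet> r" using lifts_ex[OF Y, of "\<lambda>n. g n \<bullet> r"] by blast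
    have "p n \<bullet> (h \<bullet> i) = g n" for n
    proof -
      have gn: "g n \<in> Hom T X (D n)" using g by blast
      have "p n \<bullet> (h \<bullet> i) = (g n \<bullet> r) \<bullet> i" using comp_assoc[OF r(1) h(1) p] h(2) by simp
      also have "\<dots> = g n" using comp_assoc[OF r(1,2) gn] r(3) comp_id[OF gn] by simp
      finally show ?thesis .
    qed
    then show "\<exists>h\<in>Hom T X S. \<forall>n. p n \<bullet> h = g n" using comp_in_hom[OF r(1) h(1)] by blast
  next
    fix h assume h: "h \<in> Hom T X S" "\<forall>n. p n \<bullet> h = Zero T X (D n)"
    have "h \<bullet> r = Zero T Y S"
    proof (rule lifts_zero[OF Y comp_in_hom[OF r(2) h(1)]])
      fix n
      have "p n \<bullet> (h \<bullet> r) = Zero T X (D n) \<bullet> r" using comp_assoc[OF r(2) h(1) p] h(2) by metis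
      then show "p n \<bullet> (h \<bullet> r) = Zero T Y (D n)" using r(2) S by (simp add: in_hom)
    qed
    moreover have "h = (h \<bullet> r) \<bullet> i" using comp_assoc[OF r(1,2) h(1)] r(3) comp_id[OF h(1)] by simp
    ultimately show "h = Zero T X S" using r(1) S by (simp add: in_hom)
  }
qed

text \<open>A family of maps to the \<open>D n\<close> has only finitely many nonzero members, so
  their sum in the coproduct makes sense. Uniqueness is compactness: a map without nonzero
  components is zero.\<close>

lemma lifts_compact:
  assumes "small TYPE('u) (UNIV :: nat set)" "compact_object TYPE('u) T E"
    and cop: "is_coproduct T UNIV D S \<iota>" and p: "coproduct_projection UNIV D S \<iota> p"
    and fin: "finite {n. \<not> orth E (D n)}"
  shows "lifts D S p E"
  unfolding lifts_def
proof (intro conjI allI ballI impI)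
  note c = coproductD[OF cop, simplified]
  have E: "E \<in> Obj T" using compact_obj[OF assms(2)] .
  have pn: "p n \<in> Hom T S (D n)" for n using coproduct_projectionD(1)[OF p] by simp
  {
    fix g assume g: "\<forall>n. g n \<in> Hom T E (D n)"
    let ?F = "{n. \<not> orth E (D n)}"
    let ?h = "finprod (hom_group T E S) (\<lambda>n. \<iota> n \<bullet> g n) ?F"
    interpret K: comm_group "hom_group T E S" by (rule hom_comm_group[OF E c(1)])
    have "?h \<in> Hom T E S"
      by (rule K.finprod_closed[simplified]) (use comp_in_hom[OF _ c(3)] g in blast)
    moreover have "p n \<bullet> ?h = g n" for n
    proof -
      have "p n \<bullet> ?h = (if n \<in> ?F then g n else Zero T E (D n))"
        by (rule projection_finprod[OF cop p fin]) (use g E in auto)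
      then show ?thesis using g by (auto dest: orthD)
    qed
    ultimately show "\<exists>h\<in>Hom T E S. \<forall>n. p n \<bullet> h = g n" by blast
  next
    fix h assume h: "h \<in> Hom T E S" "\<forall>n. p n \<bullet> h = Zero T E (D n)"
    have "Id T S \<bullet> h = Zero T E S"
      by (rule compact_vanish[OF assms(2,1) cop p h(1) id_in_hom[OF c(1)]])
        (use h(2) c E in \<open>simp add: in_hom\<close>)
    then show "h = Zero T E S" using h(1) by (simp add: in_hom)
  }
qed

text \<open>\<open>lifts_middle\<close> consumes suspensions of both ends and a desuspension of one,
  so only the version for all shifts is stable under extensions.\<close>

definition shift_lifts :: "(nat \<Rightarrow> 'a) \<Rightarrow> 'a \<Rightarrow> (nat \<Rightarrow> 'b) \<Rightarrow> 'a \<Rightarrow> bool" where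
  "shift_lifts D S p X \<longleftrightarrow> X \<in> Obj T \<and> (\<forall>k. lifts D S p (shift T k X))"

lemma shift_lifts_shift:
  assumes "shift_lifts D S p X"
  shows "shift_lifts D S p (shift T k X)"
  using assms shift_add[of X _ k] by (simp add: shift_lifts_def flip: shift_add)

lemma shift_lifts_susp: "shift_lifts D S p X \<Longrightarrow> shift_lifts D S p (SuspO T X)"
  using shift_lifts_shift[of D S p X 1] by (simp add: shift_lifts_def shift_1)

lemma shift_lifts_middle:
  assumes p: "\<And>n. p n \<in> Hom T S (D n)" and t: "is_tri X Y Z"
    and "shift_lifts D S p X" "shift_lifts D S p Z"
  shows "shift_lifts D S p Y"
  unfolding shift_lifts_def
proof (intro conjI allI)
  have ob: "X \<in> Obj T" "Y \<in> Obj T" "Z \<in> Obj T" using is_tri_obj[OF t] by auto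
  show "Y \<in> Obj T" by fact
  fix k
  have Zk: "shift T k Z = SuspO T (shift T (k - 1) Z)" using shift_succ[of Z "k - 1"] ob by simp
  have "is_tri (shift T k X) (shift T k Y) (shift T k Z)" using is_tri_shift ob t by blast
  then obtain f g h where d: "triangle f g h (shift T k X) (shift T k Y) (SuspO T (shift T (k - 1) Z))"
    using Zk by (auto simp: is_tri_def)
  show "lifts D S p (shift T k Y)"
  proof (rule lifts_middle[OF p d])
    show "lifts D S p (SuspO T (shift T k X))"
      using assms(3) ob by (simp add: shift_lifts_def flip: shift_succ)
  qed (use assms(3,4) ob Zk[symmetric] in \<open>auto simp: shift_lifts_def\<close>)
qed

lemma shift_lifts_coproduct:
  assumes p: "\<And>n. p n \<in> Hom T S (D n)" and cop: "is_coproduct T I X P \<iota>"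
    and "\<And>i. i \<in> I \<Longrightarrow> shift_lifts D S p (X i)"
  shows "shift_lifts D S p P"
  unfolding shift_lifts_def
proof (intro conjI allI)
  show "P \<in> Obj T" using coproductD(1)[OF cop] .
  fix k
  obtain \<kappa> where "is_coproduct T I (\<lambda>i. shift T k (X i)) (shift T k P) \<kappa>"
    using coproduct_shift[OF cop] by blast
  then show "lifts D S p (shift T k P)"
    by (rule lifts_coproduct[OF p]) (use assms(3) in \<open>auto simp: shift_lifts_def\<close>)
qed

lemma shift_lifts_zero:
  assumes p: "\<And>n. p n \<in> Hom T S (D n)" and "zero_object T Z"
  shows "shift_lifts D S p Z"
proof -
  have S: "S \<in> Obj T" "\<And>n. D n \<in> Obj T" using p by (auto simp: in_hom)
  have Z: "Z \<in> Obj T" using zero_object_obj[OF assms(2)] .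
  \<comment> \<open>A zero object is the coproduct of the empty family; the index type is
    arbitrary.\<close>
  have "is_coproduct T {} (\<lambda>i :: nat. Z) Z (\<lambda>i. Id T Z)"
    unfolding is_coproduct_def using assms(2) by (auto simp: zero_object_def)
  then show ?thesis by (rule shift_lifts_coproduct[OF p]) auto
qed

end

lemma small_int:
  assumes "small U (UNIV :: nat set)"
  shows "small U (UNIV :: int set)"
proof (rule small_ordLeq[OF assms])
  show "inj (\<lambda>k :: int. if k \<ge> 0 then 2 * nat k else 2 * nat (- k) + 1)"
    by (rule injI) (auto split: if_splits dest: arg_cong[of _ _ even])
qed simp

section \<open>Ghost maps, the telescope and almost orthogonality\<close>

context triangulated_category
begin

text \<open>The map \<open>w\<close> is ghost: it kills all maps from shifts of \<open>G\<close>. Its fibre is a coproduct of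
  shifts of \<open>G\<close>, taken in two steps so that no smallness of a union of small sets is needed.\<close>

lemma ghost_step:
  assumes nat: "small TYPE('u) (UNIV :: nat set)" and ls: "locally_small TYPE('u) T"
    and cop: "has_coproducts TYPE('u) T" and G: "shift_lifts D S p G"
    and p: "\<And>n. p n \<in> Hom T S (D n)" and W: "W \<in> Obj T"
  shows "\<exists>P W' u w v. triangle u w v P W W' \<and> shift_lifts D S p P \<and>
    (\<forall>k. \<forall>f\<in>Hom T (shift T k G) W. w \<bullet> f = Zero T (shift T k G) W')"
proof -
  have Go: "shift T k G \<in> Obj T" for k using G by (simp add: shift_lifts_def)
  have "\<exists>Q \<iota> u. is_coproduct T (Hom T (shift T k G) W) (\<lambda>_. shift T k G) Q \<iota> \<and> u \<in> Hom T Q W \<and>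
      (\<forall>f\<in>Hom T (shift T k G) W. u \<bullet> \<iota> f = f)" for k
  proof -
    have "small TYPE('u) (Hom T (shift T k G) W)" using ls Go W by (simp add: locally_small_def)
    then obtain Q \<iota> where c: "is_coproduct T (Hom T (shift T k G) W) (\<lambda>_. shift T k G) Q \<iota>"
      using coproduct_exists[OF cop, of "Hom T (shift T k G) W" "\<lambda>_. shift T k G"] Go by blast
    then show ?thesis using coproduct_ex[OF c W, of "\<lambda>f. f"] by blast
  qed
  then obtain Q \<iota> u where Q: "\<And>k. is_coproduct T (Hom T (shift T k G) W) (\<lambda>_. shift T k G) (Q k) (\<iota> k)"
    and u: "\<And>k. u k \<in> Hom T (Q k) W" "\<And>k f. f \<in> Hom T (shift T k G) W \<Longrightarrow> u k \<bullet> \<iota> k f = f"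
    by metis
  have Qo: "Q k \<in> Obj T" for k using coproductD(1)[OF Q] .
  obtain P \<kappa> where P: "is_coproduct T (UNIV :: int set) Q P \<kappa>"
    using coproduct_exists[OF cop small_int[OF nat], of Q] Qo by blast
  obtain v where v: "v \<in> Hom T P W" "\<And>k. v \<bullet> \<kappa> k = u k"
    using coproduct_ex[OF P W, of u] u(1) by blast
  have "shift_lifts D S p (Q k)" for k
    by (rule shift_lifts_coproduct[OF p Q]) (rule shift_lifts_shift[OF G])
  then have PS: "shift_lifts D S p P" by (rule shift_lifts_coproduct[OF p P])
  obtain W' w x where t: "triangle v w x P W W'" using triangle_cone[OF v(1)] by blast
  note d = triangleD[OF t]
  have "w \<bullet> f = Zero T (shift T k G) W'" if f: "f \<in> Hom T (shift T k G) W" for k f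
  proof -
    have \<iota>: "\<iota> k f \<in> Hom T (shift T k G) (Q k)" by (rule coproductD(3)[OF Q f])
    have \<kappa>: "\<kappa> k \<in> Hom T (Q k) P" by (rule coproductD(3)[OF P UNIV_I])
    have "w \<bullet> f = w \<bullet> ((v \<bullet> \<kappa> k) \<bullet> \<iota> k f)" using u(2)[OF f] v(2) by simp
    also have "\<dots> = (w \<bullet> v) \<bullet> (\<kappa> k \<bullet> \<iota> k f)" using \<iota> \<kappa> d by (simp add: in_hom)
    also have "\<dots> = Zero T (shift T k G) W'" using triangle_comp_first[OF t] \<iota> \<kappa> d by (simp add: in_hom)
    finally show ?thesis .
  qed
  with t PS show ?thesis by blast
qed

text \<open>\<open>s\<close> is the shift map of the sequence \<open>W\<close>, and the cone
  \<open>C\<close> of \<open>\<phi> = 1 - s\<close> is its homotopy colimit. Ghostness makes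
  \<open>s\<close> zero on maps from shifts of \<open>G\<close>, so \<open>\<phi>\<close> acts on
  these as the identity, \<open>C\<close> receives no nonzero map from them, and the generator
  forces \<open>C\<close> to be zero. Hence \<open>x 0\<close>, pushed into \<open>M\<close>, lifts
  through \<open>\<phi>\<close> to a map \<open>y\<close> whose component in degree \<open>n\<close>
  is \<open>x n\<close>. As \<open>E\<close> is compact, almost all of these are zero.\<close>

lemma telescope_vanishes:
  assumes nat: "small TYPE('u) (UNIV :: nat set)" and E: "compact_object TYPE('u) T E"
    and gen: "compact_generator TYPE('u) T G"
    and W: "is_coproduct T (UNIV :: nat set) W M \<iota>"
    and w: "\<And>n. w n \<in> Hom T (W n) (W (Suc n))"
    and ghost: "\<And>n k f. f \<in> Hom T (shift T k G) (W n) \<Longrightarrow> w n \<bullet> f = Zero T (shift T k G) (W (Suc n))"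
    and x0: "x 0 \<in> Hom T E (W 0)" and x: "\<And>n. x (Suc n) = w n \<bullet> x n"
  shows "\<exists>n. x n = Zero T E (W n)"
proof -
  note c = coproductD[OF W, simplified]
  have Eo: "E \<in> Obj T" using compact_obj[OF E] .
  have Gc: "compact_object TYPE('u) T (shift T k G)" for k
    using compact_shift gen by (auto simp: compact_generator_def)
  have Go: "G \<in> Obj T" "shift T k G \<in> Obj T" for k
    using compact_obj[OF Gc[of 0]] compact_obj[OF Gc] by auto
  obtain q where q: "coproduct_projection UNIV W M \<iota> q" using coproduct_projection_exists[OF W] by blast
  note qD = coproduct_projectionD[OF q UNIV_I]
  have iw: "\<iota> (Suc n) \<bullet> w n \<in> Hom T (W n) M" for n using comp_in_hom[OF w c(3)] .
  obtain s where s: "s \<in> Hom T M M" "\<And>n. s \<bullet> \<iota> n = \<iota> (Suc n) \<bullet> w n"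
    using coproduct_ex[OF W c(1), of "\<lambda>n. \<iota> (Suc n) \<bullet> w n"] iw by blast
  have sG: "s \<bullet> y = Zero T (shift T k G) M" if y: "y \<in> Hom T (shift T k G) M" for y k
  proof (rule compact_vanish[OF Gc nat W q y s(1)])
    fix n
    have qy: "q n \<bullet> y \<in> Hom T (shift T k G) (W n)" using comp_in_hom[OF y qD(1)] .
    have "s \<bullet> (\<iota> n \<bullet> (q n \<bullet> y)) = (\<iota> (Suc n) \<bullet> w n) \<bullet> (q n \<bullet> y)"
      using comp_assoc[OF qy c(3) s(1)] s(2) by simp
    also have "\<dots> = \<iota> (Suc n) \<bullet> (w n \<bullet> (q n \<bullet> y))" using comp_assoc[OF qy w c(3)] .
    also have "\<dots> = Zero T (shift T k G) M" using ghost[OF qy] c(3)[of "Suc n"] Go by (simp add: in_hom)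
    finally show "s \<bullet> (\<iota> n \<bullet> (q n \<bullet> y)) = Zero T (shift T k G) M" .
  qed
  define \<phi> where "\<phi> = Id T M \<boxplus> neg T s"
  have \<phi>: "\<phi> \<in> Hom T M M" using s c(1) by (simp add: \<phi>_def in_hom)
  have \<phi>y: "\<phi> \<bullet> y = y \<boxplus> neg T (s \<bullet> y)" if "y \<in> Hom T X M" for X y
    using that s c(1) by (simp add: \<phi>_def in_hom)
  have \<phi>G: "\<phi> \<bullet> y = y" if y: "y \<in> Hom T (shift T k G) M" for y k
    using \<phi>y[OF y] sG[OF y] y by (simp add: in_hom)
  obtain C g h where t: "triangle \<phi> g h M M C" using triangle_cone[OF \<phi>] by blast
  note d = triangleD[OF t]
  \<comment> \<open>Maps to \<open>C\<close> sit in an exact sequence between maps to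
    \<open>M\<close> and maps to its suspension. Because \<open>\<phi>\<close> acts as the identity
    in both places, the image in the suspension vanishes, and so does whatever comes from
    \<open>M\<close>.\<close>
  have "orth (shift T k G) C" for k
    unfolding orth_def
  proof
    fix a assume a: "a \<in> Hom T (shift T k G) C"
    have k: "SuspO T (shift T (k - 1) G) = shift T k G" using shift_succ[OF Go(1), of "k - 1"] by simp
    have ha: "h \<bullet> a \<in> Hom T (SuspO T (shift T (k - 1) G)) (SuspO T M)" using comp_in_hom[OF a d(4)] k by simp
    obtain b where b: "b \<in> Hom T (shift T (k - 1) G) M" "h \<bullet> a = SuspM T b"
      using desusp_hom[OF ha Go(2) c(1)] by blast
    have "SuspM T b = SuspM T (\<phi> \<bullet> b)" using \<phi>G[OF b(1)] by simp
    also have "\<dots> = SuspM T \<phi> \<bullet> (h \<bullet> a)" using susp_comp[OF b(1) \<phi>] b(2) by simp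
    also have "\<dots> = (SuspM T \<phi> \<bullet> h) \<bullet> a" using comp_assoc[OF a d(4) susp_hom[OF \<phi>]] by simp
    also have "\<dots> = Zero T (shift T k G) (SuspO T M)" using triangle_comp_third[OF t] a c(1) by (simp add: in_hom)
    finally have "h \<bullet> a = Zero T (shift T k G) (SuspO T M)" using b(2) by simp
    then obtain z where z: "z \<in> Hom T (shift T k G) M" "g \<bullet> z = a" using lift_second[OF t a] by blast
    have "a = g \<bullet> (\<phi> \<bullet> z)" using \<phi>G[OF z(1)] z(2) by simp
    also have "\<dots> = (g \<bullet> \<phi>) \<bullet> z" using comp_assoc[OF z(1) \<phi> d(3)] by simp
    also have "\<dots> = Zero T (shift T k G) C" using triangle_comp_first[OF t] z d by (simp add: in_hom)
    finally show "a = Zero T (shift T k G) C" .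
  qed
  then have C: "zero_object T C"
    using gen d(7) orth_iff Go by (simp add: compact_generator_def)
  have i0: "\<iota> 0 \<bullet> x 0 \<in> Hom T E M" using comp_in_hom[OF x0 c(3)] .
  obtain y where y: "y \<in> Hom T E M" "\<phi> \<bullet> y = \<iota> 0 \<bullet> x 0"
    using lift_first[OF t i0 zero_object_hom(1)[OF C comp_in_hom[OF i0 d(3)]]] by blast
  have qy: "q n \<bullet> y \<in> Hom T E (W n)" for n using comp_in_hom[OF y(1) qD(1)] .
  have split: "(q n \<bullet> y) \<boxplus> neg T (q n \<bullet> (s \<bullet> y)) = q n \<bullet> (\<iota> 0 \<bullet> x 0)" for n
  proof -
    have "q n \<bullet> (\<iota> 0 \<bullet> x 0) = q n \<bullet> (y \<boxplus> neg T (s \<bullet> y))" using y \<phi>y[OF y(1)] by simp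
    also have "\<dots> = (q n \<bullet> y) \<boxplus> neg T (q n \<bullet> (s \<bullet> y))" using qD(1)[of n] y s by (simp add: in_hom)
    finally show ?thesis by simp
  qed
  \<comment> \<open>In components, \<open>s\<close> sends nothing to degree 0 and sends degree
    \<open>n\<close> to degree \<open>Suc n\<close> by \<open>w n\<close>.\<close>
  have q0s: "q 0 \<bullet> s = Zero T M (W 0)"
  proof (rule coproduct_eqI[OF W comp_in_hom[OF s(1) qD(1)]])
    show "Zero T M (W 0) \<in> Hom T M (W 0)" using c by (simp add: zero_in_hom)
    fix n
    have "(q 0 \<bullet> s) \<bullet> \<iota> n = q 0 \<bullet> (\<iota> (Suc n) \<bullet> w n)" using comp_assoc[OF c(3) s(1) qD(1)] s(2) by simp
    also have "\<dots> = (q 0 \<bullet> \<iota> (Suc n)) \<bullet> w n" using comp_assoc[OF w c(3) qD(1)] by simp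
    also have "\<dots> = Zero T M (W 0) \<bullet> \<iota> n"
      using qD(3)[of "Suc n" 0] w[of n] c by (simp add: in_hom)
    finally show "(q 0 \<bullet> s) \<bullet> \<iota> n = Zero T M (W 0) \<bullet> \<iota> n" .
  qed
  have qSs: "q (Suc n) \<bullet> s = w n \<bullet> q n" for n
  proof (rule coproduct_eqI[OF W comp_in_hom[OF s(1) qD(1)] comp_in_hom[OF qD(1) w]])
    fix m
    have "(q (Suc n) \<bullet> s) \<bullet> \<iota> m = q (Suc n) \<bullet> (\<iota> (Suc m) \<bullet> w m)"
      using comp_assoc[OF c(3) s(1) qD(1)] s(2) by simp
    also have "\<dots> = (q (Suc n) \<bullet> \<iota> (Suc m)) \<bullet> w m" using comp_assoc[OF w c(3) qD(1)] by simp
    also have "\<dots> = w n \<bullet> (q n \<bullet> \<iota> m)"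
      using qD(2)[of n] qD(2)[of "Suc n"] qD(3)[of m n] qD(3)[of "Suc m" "Suc n"] w[of n] w[of m] c(2)
      by (cases "m = n") (simp_all add: in_hom)
    also have "\<dots> = (w n \<bullet> q n) \<bullet> \<iota> m" using comp_assoc[OF c(3) qD(1) w] by simp
    finally show "(q (Suc n) \<bullet> s) \<bullet> \<iota> m = (w n \<bullet> q n) \<bullet> \<iota> m" .
  qed
  \<comment> \<open>In degree 0 the equation for \<open>y\<close> reads off \<open>x 0\<close>; in
    each later degree it says that a component is the image of the preceding one, which is the
    recursion for \<open>x\<close>.\<close>
  have qyx: "q n \<bullet> y = x n" for n
  proof (induction n)
    case 0
    have "q 0 \<bullet> (s \<bullet> y) = Zero T E (W 0)"
      using comp_assoc[OF y(1) s(1) qD(1)[of 0]] q0s y(1) c by (simp add: in_hom)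
    moreover have "q 0 \<bullet> (\<iota> 0 \<bullet> x 0) = x 0"
      using comp_assoc[OF x0 c(3) qD(1)[of 0], symmetric] qD(2)[of 0] id_comp[OF x0] by simp
    ultimately show ?case using split[of 0] qy[of 0] c by (simp add: in_hom)
  next
    case (Suc n)
    have e: "q (Suc n) \<bullet> (s \<bullet> y) = x (Suc n)"
      using comp_assoc[OF y(1) s(1) qD(1)[of "Suc n"], symmetric] comp_assoc[OF y(1) qD(1) w] qSs[of n] Suc x
      by simp
    have xS: "x (Suc n) \<in> Hom T E (W (Suc n))" using comp_in_hom[OF qy[of n] w] Suc x by simp
    have "q (Suc n) \<bullet> (\<iota> 0 \<bullet> x 0) = Zero T E (W (Suc n))"
      using comp_assoc[OF x0 c(3) qD(1)[of "Suc n"], symmetric] qD(3)[of 0 "Suc n"] x0 c by (simp add: in_hom)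
    then have "(q (Suc n) \<bullet> y) \<boxplus> neg T (x (Suc n)) = Zero T E (W (Suc n))"
      using split[of "Suc n"] e by simp
    then show ?case by (rule diff_zero_imp_eq[OF qy xS])
  qed
  have "finite {n. x n \<noteq> Zero T E (W n)}"
    using compact_projections_finite[OF E nat W q y(1)] qyx by simp
  then show ?thesis using infinite_UNIV_nat by (metis (mono_tags, lifting) UNIV_eq_I mem_Collect_eq)
qed

text \<open>The cone of \<open>E\<close> -> \<open>W n\<close> is assembled from \<open>n\<close>
  suspended coproducts of shifts of \<open>G\<close>. At a stage where this map is zero, its cone
  contains \<open>SuspO T E\<close> as a direct summand.\<close>

lemma lifts_compact_generated:
  assumes nat: "small TYPE('u) (UNIV :: nat set)" and ls: "locally_small TYPE('u) T"
    and cop: "has_coproducts TYPE('u) T" and gen: "compact_generator TYPE('u) T G"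
    and E: "compact_object TYPE('u) T E"
    and G: "shift_lifts D S p G" and p: "\<And>n. p n \<in> Hom T S (D n)"
  shows "lifts D S p E"
proof -
  have Eo: "E \<in> Obj T" using compact_obj[OF E] .
  obtain P nx u w v where step: "\<And>X. X \<in> Obj T \<Longrightarrow> triangle (u X) (w X) (v X) (P X) X (nx X)"
    "\<And>X. X \<in> Obj T \<Longrightarrow> shift_lifts D S p (P X)"
    "\<And>X k f. X \<in> Obj T \<Longrightarrow> f \<in> Hom T (shift T k G) X \<Longrightarrow> w X \<bullet> f = Zero T (shift T k G) (nx X)"
    using ghost_step[OF nat ls cop G p] by metis
  define W where "W n = (nx ^^ n) E" for n
  have W0: "W 0 = E" and WS: "\<And>n. W (Suc n) = nx (W n)" by (simp_all add: W_def)
  have Wo: "W n \<in> Obj T" for n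
    by (induction n) (use Eo W0 WS triangleD(7)[OF step(1)] in auto)
  have wW: "w (W n) \<in> Hom T (W n) (W (Suc n))" for n using triangleD(3)[OF step(1)[OF Wo]] WS by simp
  define x where "x = rec_nat (Id T E) (\<lambda>n z. w (W n) \<bullet> z)"
  have x0: "x 0 = Id T E" and xS: "\<And>n. x (Suc n) = w (W n) \<bullet> x n" by (simp_all add: x_def)
  have xW: "x n \<in> Hom T E (W n)" for n
    by (induction n) (use x0 xS W0 id_in_hom[OF Eo] comp_in_hom[OF _ wW] in auto)
  obtain M \<iota> where M: "is_coproduct T UNIV W M \<iota>" using coproduct_exists[OF cop nat, of W] Wo by blast
  obtain N where N: "x N = Zero T E (W N)"
    using telescope_vanishes[OF nat E gen M wW _ xW xS] step(3)[OF Wo] WS by metis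
  have "\<exists>C g h. triangle (x n) g h E (W n) C \<and> shift_lifts D S p C" for n
  proof (induction n)
    case 0
    obtain Z where Z: "zero_object T Z" using ex_zero_object by blast
    show ?case using triangle_id[OF Eo Z] shift_lifts_zero[of p S D, OF p Z] x0 W0 by auto
  next
    case (Suc n)
    then obtain A g h where A: "triangle (x n) g h E (W n) A" "shift_lifts D S p A" by blast
    obtain C g' h' where C: "triangle (x (Suc n)) g' h' E (W (Suc n)) C" using triangle_cone[OF xW] by blast
    \<comment> \<open>The octahedron for \<open>w (W n)\<close> after \<open>x n\<close>: the new
      cone is an extension of the suspension of \<open>P (W n)\<close> by the old cone.\<close>
    have "\<exists>a b c. triangle a b c A C (SuspO T (P (W n)))"
      using octahedron[OF A(1) triangle_rotate[OF step(1)[OF Wo, of n]]] C WS xS by fastforce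
    then have "is_tri A C (SuspO T (P (W n)))" by (simp add: is_tri_def)
    then have "shift_lifts D S p C"
      by (rule shift_lifts_middle[OF p _ A(2) shift_lifts_susp[OF step(2)[OF Wo]]])
    with C show ?case by blast
  qed
  then obtain C g h where t: "triangle (Zero T E (W N)) g h E (W N) C" and C: "shift_lifts D S p C"
    using N by metis
  note d = triangleD[OF t]
  \<comment> \<open>Since the first map of the triangle is zero, the identity of
    \<open>SuspO T E\<close> lifts through the connecting map \<open>h\<close>; the lift is a
    section of \<open>h\<close>.\<close>
  have z: "SuspM T (Zero T E (W N)) \<bullet> Id T (SuspO T E) = Zero T (SuspO T E) (SuspO T (W N))"
    using Eo Wo by simp
  obtain b where b: "b \<in> Hom T (SuspO T E) C" "h \<bullet> b = Id T (SuspO T E)"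
    using lift_third[OF t id_in_hom z] Eo by auto
  \<comment> \<open>Desuspending the section and \<open>h\<close> exhibits \<open>E\<close> as a
    retract of the desuspended cone, which is one of the shifts covered by
    \<open>shift_lifts\<close>.\<close>
  obtain C0 where C0: "C0 \<in> Obj T" "C = SuspO T C0" using desusp_obj d(7) by blast
  have sC: "shift T (- 1) C = C0" using shift_eq_iff[OF d(7) C0(1), of "- 1"] C0 shift_1 by simp
  obtain h0 where h0: "h0 \<in> Hom T C0 E" "h = SuspM T h0" using desusp_hom d(4) C0 Eo by blast
  obtain b0 where b0: "b0 \<in> Hom T E C0" "b = SuspM T b0" using desusp_hom b(1) C0 Eo by blast
  have "SuspM T (h0 \<bullet> b0) = SuspM T (Id T E)" using susp_comp[OF b0(1) h0(1)] b(2) b0 h0 susp_id[OF Eo] by simp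
  then have "h0 \<bullet> b0 = Id T E" by (rule susp_eq[rotated 2]) (use h0 b0 Eo in \<open>auto simp: in_hom\<close>)
  then show ?thesis
    using lifts_retract[OF p b0(1) h0(1)] C sC by (auto simp: shift_lifts_def)
qed

text \<open>If \<open>E\<close> had nonzero maps to infinitely many \<open>D n\<close>, they would assemble to a map to the
  coproduct of the \<open>D n\<close> with infinitely many nonzero components.\<close>

theorem compact_almost_orth:
  fixes D :: "nat \<Rightarrow> 'a"
  assumes nat: "small TYPE('u) (UNIV :: nat set)" and ls: "locally_small TYPE('u) T"
    and cop: "has_coproducts TYPE('u) T" and gen: "compact_generator TYPE('u) T G"
    and E: "compact_object TYPE('u) T E"
    and D: "\<And>n. D n \<in> Obj T" and fin: "\<And>k. finite {n. \<not> orth (shift T k G) (D n)}"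
  shows "finite {n. \<not> orth E (D n)}"
proof -
  have Eo: "E \<in> Obj T" using compact_obj[OF E] .
  obtain S \<iota> where S: "is_coproduct T UNIV D S \<iota>" using coproduct_exists[OF cop nat, of D] D by blast
  obtain p where p: "coproduct_projection UNIV D S \<iota> p" using coproduct_projection_exists[OF S] by blast
  have pn: "p n \<in> Hom T S (D n)" for n using coproduct_projectionD(1)[OF p UNIV_I] .
  have Gc: "compact_object TYPE('u) T G" using gen by (simp add: compact_generator_def)
  have "shift_lifts D S p G"
    unfolding shift_lifts_def
    using compact_obj[OF Gc] lifts_compact[OF nat compact_shift[OF Gc] S p fin] by blast
  then have l: "lifts D S p E" by (rule lifts_compact_generated[OF nat ls cop gen E _ pn])
  \<comment> \<open>Choose a nonzero map wherever one exists, so that the support of the chosen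
    family is exactly the set to be bounded; elsewhere any map will do.\<close>
  have "\<exists>f\<in>Hom T E (D n). orth E (D n) \<or> f \<noteq> Zero T E (D n)" for n
    using zero_in_hom[OF Eo D] by (auto simp: orth_def)
  then obtain f where f: "\<And>n. f n \<in> Hom T E (D n)" "\<And>n. orth E (D n) \<or> f n \<noteq> Zero T E (D n)" by metis
  obtain h where h: "h \<in> Hom T E S" "\<And>n. p n \<bullet> h = f n" using lifts_ex[OF l f(1)] by blast
  have "finite {n. f n \<noteq> Zero T E (D n)}"
    using compact_projections_finite[OF E nat S p h(1)] h(2) by simp
  then show ?thesis by (rule finite_subset[rotated]) (use f(2) in auto)
qed

end

section \<open>t-structures\<close>

context category
begin

lemma isomorphic_sym:
  assumes "isomorphic C X Y"
  shows "isomorphic C Y X"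
proof -
  obtain f g where fg: "f \<in> Hom C X Y" "g \<in> Hom C Y X" "g \<bullet> f = Id C X" "f \<bullet> g = Id C Y"
    using assms by (elim isomorphicE)
  then show ?thesis using isoI[OF fg(2,1,4,3)] by (auto simp: isomorphic_def)
qed

lemma isomorphic_obj: "isomorphic C X Y \<Longrightarrow> X \<in> Obj C \<and> Y \<in> Obj C"
  by (auto simp: isomorphic_def in_hom)

end

section \<open>Degrees and closure under cones\<close>

context triangulated_category
begin

text \<open>Lifting the identity of \<open>Y\<close> gives a right inverse \<open>b\<close> of
  \<open>f\<close>. The map \<open>b \<bullet> f\<close> minus the identity is killed by
  \<open>f\<close>, so its suspension comes from the zero vertex, and \<open>b\<close> is a
  two-sided inverse.\<close>

lemma is_tri_zero_right:
  assumes "is_tri X Y Z" "zero_object T Z"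
  shows "isomorphic T X Y"
proof -
  obtain f g h where t: "triangle f g h X Y Z" using assms(1) by (auto simp: is_tri_def)
  note d = triangleD[OF t]
  have "g \<bullet> Id T Y = Zero T Y Z" using zero_object_hom(1)[OF assms(2) d(3)] d by (simp add: in_hom)
  then obtain b where b: "b \<in> Hom T Y X" "f \<bullet> b = Id T Y"
    using lift_first[OF t id_in_hom[OF d(6)]] by blast
  have bf: "b \<bullet> f \<in> Hom T X X" using comp_in_hom[OF d(2) b(1)] .
  let ?e = "(b \<bullet> f) \<boxplus> neg T (Id T X)"
  have e: "?e \<in> Hom T X X" using diff_in_hom[OF bf id_in_hom[OF d(5)]] .
  have "f \<bullet> ?e = Zero T X Y"
    using comp_assoc[OF d(2) b(1) d(2), symmetric] b(2) b(1) d by (simp add: in_hom)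
  then have "SuspM T f \<bullet> SuspM T ?e = Zero T (SuspO T X) (SuspO T Y)"
    using susp_comp[OF e d(2)] d by simp
  then obtain c where c: "c \<in> Hom T (SuspO T X) Z" "h \<bullet> c = SuspM T ?e"
    using lift_third[OF t susp_hom[OF e]] by blast
  then have "SuspM T ?e = SuspM T (Zero T X X)"
    using zero_object_hom(1)[OF assms(2) c(1)] d by (simp add: in_hom)
  then have "?e = Zero T X X" by (rule susp_eq[rotated 2]) (use e d in \<open>auto simp: in_hom\<close>)
  then have "b \<bullet> f = Id T X" by (rule diff_zero_imp_eq[OF bf id_in_hom[OF d(5)]])
  then have "is_iso T f" by (rule isoI[OF d(2) b(1) _ b(2)])
  then show ?thesis using d(2) by (auto simp: isomorphic_def)
qed

lemma is_tri_zero_left: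
  assumes "is_tri X Y Z" "zero_object T X"
  shows "isomorphic T Y Z"
  using is_tri_zero_right[OF is_tri_rotate[OF assms(1)] zero_object_susp[OF assms(2)]] .

text \<open>Both families are shifts of a set of objects, so facts about degrees proved for an
  arbitrary \<open>L\<close> serve the coaisle as well.\<close>

lemma T_ge_eq_T_le: "T_ge T R n = T_le T R n"
  by (simp add: T_ge_def T_le_def)

lemma in_T_le:
  assumes "L \<subseteq> Obj T"
  shows "X \<in> T_le T L n \<longleftrightarrow> X \<in> Obj T \<and> shift T n X \<in> L"
proof
  assume "X \<in> T_le T L n"
  then obtain Y where Y: "Y \<in> L" "X = shift T (- n) Y" by (auto simp: T_le_def)
  then have "Y \<in> Obj T" using assms by auto
  then show "X \<in> Obj T \<and> shift T n X \<in> L" using Y shift_eq_iff[of X Y n] by simp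
next
  assume "X \<in> Obj T \<and> shift T n X \<in> L"
  then show "X \<in> T_le T L n" using shift_eq_iff[of X "shift T n X" n] by (auto simp: T_le_def)
qed

lemma shift_in_T_le:
  assumes "L \<subseteq> Obj T" "X \<in> Obj T"
  shows "shift T k X \<in> T_le T L n \<longleftrightarrow> X \<in> T_le T L (n + k)"
  using assms by (simp add: in_T_le shift_add)

lemma susp_in_T_le:
  assumes "L \<subseteq> Obj T" "X \<in> Obj T"
  shows "SuspO T X \<in> T_le T L n \<longleftrightarrow> X \<in> T_le T L (n + 1)"
  using shift_in_T_le[OF assms, of 1] shift_1[OF assms(2)] by simp

text \<open>Asking for every zero object, instead of the existence of one, makes stability under
  intersection immediate. Closure under biproducts is left to be derived from cones.\<close>

definition tri_closed :: "'a set \<Rightarrow> bool" where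
  "tri_closed S \<longleftrightarrow> S \<subseteq> Obj T \<and> (\<forall>X Y. X \<in> S \<longrightarrow> isomorphic T X Y \<longrightarrow> Y \<in> S) \<and>
    (\<forall>Z. zero_object T Z \<longrightarrow> Z \<in> S) \<and> (\<forall>X\<in>Obj T. SuspO T X \<in> S \<longleftrightarrow> X \<in> S) \<and>
    (\<forall>X Y Z. is_tri X Y Z \<longrightarrow> X \<in> S \<longrightarrow> Y \<in> S \<longrightarrow> Z \<in> S)"

lemma tri_closed_Int: "tri_closed S \<Longrightarrow> tri_closed S' \<Longrightarrow> tri_closed (S \<inter> S')"
  unfolding tri_closed_def by blast

lemma tri_closed_imp_triangulated:
  assumes "tri_closed S"
  shows "triangulated_subcategory T S"
proof -
  have S: "S \<subseteq> Obj T" and iso: "\<And>X Y. X \<in> S \<Longrightarrow> isomorphic T X Y \<Longrightarrow> Y \<in> S"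
    and zero: "\<And>Z. zero_object T Z \<Longrightarrow> Z \<in> S"
    and susp: "\<And>X. X \<in> Obj T \<Longrightarrow> SuspO T X \<in> S \<longleftrightarrow> X \<in> S"
    and cone: "\<And>X Y Z. is_tri X Y Z \<Longrightarrow> X \<in> S \<Longrightarrow> Y \<in> S \<Longrightarrow> Z \<in> S"
    using assms unfolding tri_closed_def by blast+
  have "Z \<in> S" if "X \<in> S" "Y \<in> S" "is_biproduct T X Y Z" for X Y Z
  proof -
    have ob: "X \<in> Obj T" "Y \<in> Obj T" using that S by auto
    then have t: "is_tri Y Z X" using that(3) is_tri_biproduct by (auto simp: is_biproduct_def)
    \<comment> \<open>Two rotations present the suspension of the biproduct as the cone of a map
      from \<open>X\<close> to the suspension of \<open>Y\<close>.\<close>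
    then have "is_tri X (SuspO T Y) (SuspO T Z)" using is_tri_rotate by blast
    then show ?thesis using cone susp that ob is_tri_obj[OF t] by blast
  qed
  moreover have "Cod T g \<in> S" if "(f, g, h) \<in> Tri T" "Dom T f \<in> S" "Cod T f \<in> S" for f g h
    using cone triangle_of_Tri[OF that(1)] that unfolding is_tri_def by blast
  moreover have "SuspO T ` S = S"
  proof
    show "SuspO T ` S \<subseteq> S" using S susp by auto
    show "S \<subseteq> SuspO T ` S"
    proof
      fix X assume X: "X \<in> S"
      then obtain X0 where "X0 \<in> Obj T" "X = SuspO T X0" using desusp_obj S by blast
      then show "X \<in> SuspO T ` S" using X susp by auto
    qed
  qed
  ultimately show ?thesis
    using S iso zero ex_zero_object unfolding triangulated_subcategory_def strictly_full_def by blast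
qed

end

section \<open>Aisle and coaisle as orthogonals of each other\<close>

locale t_structured = triangulated_category T for T (structure) +
  fixes L R
  assumes t_str: "t_structure T L R"
begin

lemma L_obj: "L \<subseteq> Obj T" and R_obj: "R \<subseteq> Obj T"
  using t_str by (auto simp: t_structure_def strictly_full_def)

lemma L_iso: "X \<in> L \<Longrightarrow> isomorphic T X Y \<Longrightarrow> Y \<in> L" and R_iso: "X \<in> R \<Longrightarrow> isomorphic T X Y \<Longrightarrow> Y \<in> R"
  using t_str isomorphic_obj unfolding t_structure_def strictly_full_def by blast+

lemmas in_le = in_T_le[OF L_obj] and in_ge = in_T_le[OF R_obj, folded T_ge_eq_T_le]
lemmas shift_in_le = shift_in_T_le[OF L_obj] and shift_in_ge = shift_in_T_le[OF R_obj, folded T_ge_eq_T_le]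
lemmas susp_in_le = susp_in_T_le[OF L_obj] and susp_in_ge = susp_in_T_le[OF R_obj, folded T_ge_eq_T_le]

lemma le_0: "T_le T L 0 = L" and ge_0: "T_ge T R 0 = R"
  by (auto simp: T_le_def T_ge_def)

lemma le_mono:
  assumes "X \<in> T_le T L m" "m \<le> n"
  shows "X \<in> T_le T L n"
  using assms(2)
proof (induction n rule: int_ge_induct)
  case (step i)
  have X: "X \<in> Obj T" using assms(1) by (simp add: in_le)
  have "shift T i X \<in> T_le T L 0" using step X by (simp add: in_le)
  then have "shift T i X \<in> T_le T L 1" using t_str by (auto simp: t_structure_def)
  then show ?case using shift_in_le[OF X, of i 1] by (simp add: add.commute)
qed (use assms in simp)

lemma ge_mono:
  assumes "X \<in> T_ge T R m" "n \<le> m"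
  shows "X \<in> T_ge T R n"
  using assms(2)
proof (induction n rule: int_le_induct)
  case (step i)
  have X: "X \<in> Obj T" using assms(1) by (simp add: in_ge)
  have "shift T (i - 1) X \<in> T_ge T R 1" using step X shift_in_ge[OF X, of "i - 1" 1] by simp
  then have "shift T (i - 1) X \<in> T_ge T R 0" using t_str by (auto simp: t_structure_def)
  then show ?case using shift_in_ge[OF X, of "i - 1" 0] by simp
qed (use assms in simp)

lemma orth_le_ge:
  assumes X: "X \<in> T_le T L m" and Y: "Y \<in> T_ge T R n" and "m < n"
  shows "orth X Y"
proof -
  have ob: "X \<in> Obj T" "Y \<in> Obj T" using X Y by (auto simp: in_le in_ge)
  have "Y \<in> T_ge T R (1 + m)" using ge_mono[OF Y, of "1 + m"] \<open>m < n\<close> by simp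
  then have "shift T m X \<in> T_le T L 0" "shift T m Y \<in> T_ge T R 1"
    using X ob shift_in_le[OF ob(1), of m 0] shift_in_ge[OF ob(2), of m 1] by simp_all
  then have "orth (shift T m X) (shift T m Y)"
    using t_str orth_iff ob by (auto simp: t_structure_def)
  then show ?thesis using orth_shift ob by simp
qed

lemma decomposition:
  assumes "X \<in> Obj T"
  shows "\<exists>A\<in>T_le T L n. \<exists>B\<in>T_ge T R (n + 1). is_tri A X B"
proof -
  have X: "shift T n X \<in> Obj T" using assms by simp
  then obtain A B f g h where A: "A \<in> T_le T L 0" and B: "B \<in> T_ge T R 1"
    and t: "(f, g, h) \<in> Tri T" "f \<in> Hom T A (shift T n X)" "g \<in> Hom T (shift T n X) B"
    using t_str unfolding t_structure_def by metis
  have ob: "A \<in> Obj T" "B \<in> Obj T" using A B by (auto simp: in_le in_ge)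
  have "is_tri A (shift T n X) B" using triangle_of_Tri[OF t(1)] t by (auto simp: is_tri_def in_hom)
  then have "is_tri (shift T (- n) A) (shift T (- n) (shift T n X)) (shift T (- n) B)"
    using is_tri_shift ob X by blast
  then have "is_tri (shift T (- n) A) X (shift T (- n) B)"
    using shift_add[OF assms, of "- n" n] by simp
  moreover have "shift T (- n) A \<in> T_le T L n" "shift T (- n) B \<in> T_ge T R (n + 1)"
    using A B shift_in_le[OF ob(1)] shift_in_ge[OF ob(2)] by simp_all
  ultimately show ?thesis by blast
qed

text \<open>In the truncation triangle, \<open>B\<close> lies between \<open>X\<close> and the
  suspension of \<open>A\<close>, neither of which maps to \<open>B\<close>. So \<open>B\<close> is
  orthogonal to itself, hence zero, and \<open>A\<close> is isomorphic to \<open>X\<close>.\<close>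

lemma in_L_if_orth:
  assumes X: "X \<in> Obj T" and o: "\<And>Y. Y \<in> T_ge T R 1 \<Longrightarrow> orth X Y"
  shows "X \<in> L"
proof -
  obtain A B where A: "A \<in> T_le T L 0" and B: "B \<in> T_ge T R 1" and t: "is_tri A X B"
    using decomposition[OF X, of 0] by auto
  have ob: "A \<in> Obj T" "B \<in> Obj T" using is_tri_obj[OF t] by auto
  have "SuspO T A \<in> T_le T L 0" using susp_in_le[OF ob(1)] le_mono[OF A] by simp
  then have "orth (SuspO T A) B" using orth_le_ge[OF _ B] by simp
  then have "orth B B" using orth_tri_left[OF is_tri_rotate[OF t] o[OF B]] ob by simp
  then have "isomorphic T A X" using is_tri_zero_right[OF t] orth_self ob by simp
  then show ?thesis using A L_iso by (simp add: le_0)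
qed

lemma in_R_if_orth:
  assumes Y: "Y \<in> Obj T" and o: "\<And>X. X \<in> T_le T L (- 1) \<Longrightarrow> orth X Y"
  shows "Y \<in> R"
proof -
  obtain A B where A: "A \<in> T_le T L (- 1)" and B: "B \<in> T_ge T R 0" and t: "is_tri A Y B"
    using decomposition[OF Y, of "- 1"] by auto
  have ob: "A \<in> Obj T" "B \<in> Obj T" using is_tri_obj[OF t] by auto
  \<comment> \<open>Turned back, the triangle begins with the desuspension of \<open>B\<close>,
    which lies one degree higher in the coaisle. \<open>A\<close> maps trivially to it and to
    \<open>Y\<close>, hence to itself.\<close>
  obtain B0 where B0: "B0 \<in> Obj T" "B = SuspO T B0" using desusp_obj ob by blast
  have "B0 \<in> T_ge T R 1" using B B0 susp_in_ge[OF B0(1), of 0] by simp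
  then have "orth A B0" using orth_le_ge[OF A] by simp
  then have "orth A A" using orth_tri_right[OF is_tri_unrotate _ o[OF A] ob(1)] t B0 by blast
  then have "isomorphic T Y B" using is_tri_zero_left[OF t] orth_self ob by simp
  then show ?thesis using B R_iso isomorphic_sym by (metis ge_0)
qed

text \<open>With this description and its dual, closure under extensions and isomorphisms, and of
  the coaisle under summands, become statements about orthogonality.\<close>

lemma le_iff_orth: "X \<in> T_le T L n \<longleftrightarrow> X \<in> Obj T \<and> (\<forall>Y\<in>T_ge T R (n + 1). orth X Y)"
proof
  assume "X \<in> T_le T L n"
  then show "X \<in> Obj T \<and> (\<forall>Y\<in>T_ge T R (n + 1). orth X Y)"
    using orth_le_ge by (auto simp: in_le)
next
  assume X: "X \<in> Obj T \<and> (\<forall>Y\<in>T_ge T R (n + 1). orth X Y)"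
  have "shift T n X \<in> L"
  proof (rule in_L_if_orth)
    fix Y assume Y: "Y \<in> T_ge T R 1"
    then have Yo: "Y \<in> Obj T" by (simp add: in_ge)
    have "shift T (- n) Y \<in> T_ge T R (n + 1)" using Y shift_in_ge[OF Yo] by simp
    then show "orth (shift T n X) Y" using X Yo orth_shift_left by simp
  qed (use X in simp)
  then show "X \<in> T_le T L n" using X by (simp add: in_le)
qed

lemma ge_iff_orth: "Y \<in> T_ge T R n \<longleftrightarrow> Y \<in> Obj T \<and> (\<forall>X\<in>T_le T L (n - 1). orth X Y)"
proof
  assume "Y \<in> T_ge T R n"
  then show "Y \<in> Obj T \<and> (\<forall>X\<in>T_le T L (n - 1). orth X Y)"
    using orth_le_ge by (auto simp: in_ge)
next
  assume Y: "Y \<in> Obj T \<and> (\<forall>X\<in>T_le T L (n - 1). orth X Y)"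
  have "shift T n Y \<in> R"
  proof (rule in_R_if_orth)
    fix X assume X: "X \<in> T_le T L (- 1)"
    then have Xo: "X \<in> Obj T" by (simp add: in_le)
    have "shift T (- n) X \<in> T_le T L (n - 1)" using X shift_in_le[OF Xo] by simp
    then show "orth X (shift T n Y)" using Y Xo orth_shift_left[of X Y "- n"] by simp
  qed (use Y in simp)
  then show "Y \<in> T_ge T R n" using Y by (simp add: in_ge)
qed

lemma le_extension: "is_tri X Y Z \<Longrightarrow> X \<in> T_le T L n \<Longrightarrow> Z \<in> T_le T L n \<Longrightarrow> Y \<in> T_le T L n"
  unfolding le_iff_orth using orth_tri_left is_tri_obj in_ge by metis

lemma ge_extension: "is_tri X Y Z \<Longrightarrow> X \<in> T_ge T R n \<Longrightarrow> Z \<in> T_ge T R n \<Longrightarrow> Y \<in> T_ge T R n"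
  unfolding ge_iff_orth using orth_tri_right is_tri_obj in_le by metis

lemma le_iso: "X \<in> T_le T L n \<Longrightarrow> isomorphic T X Y \<Longrightarrow> Y \<in> T_le T L n"
  unfolding le_iff_orth using orth_iso(1) isomorphic_obj in_ge by metis

lemma ge_iso: "X \<in> T_ge T R n \<Longrightarrow> isomorphic T X Y \<Longrightarrow> Y \<in> T_ge T R n"
  unfolding ge_iff_orth using orth_iso(2) isomorphic_obj in_le by metis

lemma le_zero: "zero_object T Z \<Longrightarrow> Z \<in> T_le T L n"
  by (simp add: le_iff_orth zero_object_obj orth_zero)

lemma ge_zero: "zero_object T Z \<Longrightarrow> Z \<in> T_ge T R n"
  by (simp add: ge_iff_orth zero_object_obj orth_zero)

lemma ge_summand: "is_biproduct T X Y Z \<Longrightarrow> X \<in> Obj T \<Longrightarrow> Z \<in> T_ge T R n \<Longrightarrow> X \<in> T_ge T R n"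
  unfolding ge_iff_orth using orth_biproduct_summand(2) in_le by metis

lemma in_T_minus: "X \<in> T_minus T L \<longleftrightarrow> (\<exists>n. X \<in> T_le T L n)"
proof
  assume "\<exists>n. X \<in> T_le T L n"
  then obtain n where "X \<in> T_le T L n" by blast
  then have "X \<in> T_le T L (max n 1)" by (rule le_mono) simp
  then show "X \<in> T_minus T L" unfolding T_minus_def by (rule UN_I[rotated]) simp
qed (auto simp: T_minus_def)

lemma in_T_plus: "X \<in> T_plus T R \<longleftrightarrow> (\<exists>n. X \<in> T_ge T R n)"
proof
  assume "\<exists>n. X \<in> T_ge T R n"
  then obtain n where "X \<in> T_ge T R n" by blast
  then have "X \<in> T_ge T R (- max (- n) 1)" by (rule ge_mono) simp
  then show "X \<in> T_plus T R" unfolding T_plus_def by (rule UN_I[rotated]) simp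
qed (auto simp: T_plus_def)

lemma tri_closed_T_minus: "tri_closed (T_minus T L)"
  unfolding tri_closed_def
proof (intro conjI allI ballI impI)
  show "T_minus T L \<subseteq> Obj T" by (auto simp: in_T_minus in_le)
  show "Y \<in> T_minus T L" if "X \<in> T_minus T L" "isomorphic T X Y" for X Y
    using that le_iso by (auto simp: in_T_minus)
  show "Z \<in> T_minus T L" if "zero_object T Z" for Z
    using that le_zero by (auto simp: in_T_minus)
  show "SuspO T X \<in> T_minus T L \<longleftrightarrow> X \<in> T_minus T L" if "X \<in> Obj T" for X
    unfolding in_T_minus susp_in_le[OF that] by (metis diff_add_cancel)
  fix X Y Z assume t: "is_tri X Y Z" and "X \<in> T_minus T L" "Y \<in> T_minus T L"
  then obtain m n where "X \<in> T_le T L m" "Y \<in> T_le T L n" by (auto simp: in_T_minus)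
  then have "SuspO T X \<in> T_le T L (max m n)" "Y \<in> T_le T L (max m n)"
    using susp_in_le[of X] is_tri_obj[OF t] le_mono[of X m] le_mono[of Y n] by simp_all
  then show "Z \<in> T_minus T L" using le_extension[OF is_tri_rotate[OF t]] by (auto simp: in_T_minus)
qed

lemma tri_closed_T_plus: "tri_closed (T_plus T R)"
  unfolding tri_closed_def
proof (intro conjI allI ballI impI)
  show "T_plus T R \<subseteq> Obj T" by (auto simp: in_T_plus in_ge)
  show "Y \<in> T_plus T R" if "X \<in> T_plus T R" "isomorphic T X Y" for X Y
    using that ge_iso by (auto simp: in_T_plus)
  show "Z \<in> T_plus T R" if "zero_object T Z" for Z
    using that ge_zero by (auto simp: in_T_plus)
  show "SuspO T X \<in> T_plus T R \<longleftrightarrow> X \<in> T_plus T R" if "X \<in> Obj T" for X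
    unfolding in_T_plus susp_in_ge[OF that] by (metis diff_add_cancel)
  fix X Y Z assume t: "is_tri X Y Z" and "X \<in> T_plus T R" "Y \<in> T_plus T R"
  then obtain m n where "X \<in> T_ge T R m" "Y \<in> T_ge T R n" by (auto simp: in_T_plus)
  \<comment> \<open>Suspension moves \<open>X\<close> one degree down, so a common lower bound has
    to drop by one; in the aisle the bound can be kept.\<close>
  then have "SuspO T X \<in> T_ge T R (min m n - 1)" "Y \<in> T_ge T R (min m n - 1)"
    using susp_in_ge[of X] is_tri_obj[OF t] ge_mono[of X m] ge_mono[of Y n] by simp_all
  then show "Z \<in> T_plus T R" using ge_extension[OF is_tri_rotate[OF t]] by (auto simp: in_T_plus)
qed

section \<open>Approximation by compact objects\<close>

text \<open>The accuracy \<open>m\<close> ranges over all integers: suspension shifts it freely, and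
  the induction for summands starts from an arbitrary lower value.\<close>

definition approx :: "'u itself \<Rightarrow> int \<Rightarrow> 'a \<Rightarrow> bool" where
  "approx U m F \<longleftrightarrow> (\<exists>E D. compact_object U T E \<and> D \<in> T_le T L (- m) \<and> is_tri E F D)"

lemma approx_obj: "approx U m F \<Longrightarrow> F \<in> Obj T"
  using is_tri_obj by (auto simp: approx_def)

lemma approx_mono: "approx U m F \<Longrightarrow> n \<le> m \<Longrightarrow> approx U n F"
  unfolding approx_def using le_mono by (metis neg_le_iff_le)

lemma T_minus_c_eq: "T_minus_c U T L = {F. \<forall>m. approx U m F}"
proof -
  have e: "(\<exists>E D f g h. compact_object U T E \<and> D \<in> T_le T L (- m) \<and>
      (f, g, h) \<in> Tri T \<and> f \<in> Hom T E F \<and> g \<in> Hom T F D) \<longleftrightarrow> approx U m F" for m F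
    unfolding approx_def is_tri_def
  proof safe
    fix E D f g h
    assume *: "compact_object U T E" "D \<in> T_le T L (- m)" "(f, g, h) \<in> Tri T" "f \<in> Hom T E F" "g \<in> Hom T F D"
    then have "triangle f g h E F D" using triangle_of_Tri[of f g h] by (simp add: in_hom)
    with * show "\<exists>E D. compact_object U T E \<and> D \<in> T_le T L (- m) \<and> (\<exists>f g h. triangle f g h E F D)" by blast
  next
    fix E D f g h
    assume "compact_object U T E" "D \<in> T_le T L (- m)" "triangle f g h E F D"
    then show "\<exists>E D f g h. compact_object U T E \<and> D \<in> T_le T L (- m) \<and>
      (f, g, h) \<in> Tri T \<and> f \<in> Hom T E F \<and> g \<in> Hom T F D"
      by (intro exI[of _ E] exI[of _ D] exI[of _ f] exI[of _ g] exI[of _ h]) (simp add: triangleD(1-3))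
  qed
  have "(F \<in> Obj T \<and> (\<forall>m>0. approx U m F)) \<longleftrightarrow> (\<forall>m. approx U m F)" for F
  proof safe
    fix m assume "\<forall>m>0. approx U m F"
    then have "approx U (max m 1) F" by simp
    then show "approx U m F" by (rule approx_mono) simp
  qed (auto dest: approx_obj)
  then show ?thesis unfolding T_minus_c_def e by auto
qed

lemma approx_iso: "approx U m F \<Longrightarrow> isomorphic T F F' \<Longrightarrow> approx U m F'"
  unfolding approx_def using is_tri_iso by blast

lemma approx_susp_iff:
  assumes "F \<in> Obj T"
  shows "approx TYPE('u) m (SuspO T F) \<longleftrightarrow> approx TYPE('u) (m - 1) F"
proof
  assume "approx TYPE('u) m (SuspO T F)"
  then obtain E D where *: "compact_object TYPE('u) T E" "D \<in> T_le T L (- m)" "is_tri E (SuspO T F) D"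
    by (auto simp: approx_def)
  obtain E0 D0 where ob: "E0 \<in> Obj T" "E = SuspO T E0" "D0 \<in> Obj T" "D = SuspO T D0"
    using desusp_obj is_tri_obj[OF *(3)] by blast
  have "compact_object TYPE('u) T E0" using compact_desusp *(1) ob by blast
  moreover have "D0 \<in> T_le T L (- (m - 1))" using *(2) ob susp_in_le[OF ob(3)] by (simp add: algebra_simps)
  moreover have "is_tri E0 F D0" using *(3) ob is_tri_susp_iff assms by simp
  ultimately show "approx TYPE('u) (m - 1) F" by (auto simp: approx_def)
next
  assume "approx TYPE('u) (m - 1) F"
  then obtain E D where *: "compact_object TYPE('u) T E" "D \<in> T_le T L (- (m - 1))" "is_tri E F D"
    by (auto simp: approx_def)
  have ob: "E \<in> Obj T" "D \<in> Obj T" using is_tri_obj[OF *(3)] by auto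
  have "SuspO T D \<in> T_le T L (- m)" using *(2) susp_in_le[OF ob(2)] by (simp add: algebra_simps)
  moreover have "is_tri (SuspO T E) (SuspO T F) (SuspO T D)" using *(3) ob is_tri_susp_iff assms by simp
  ultimately show "approx TYPE('u) m (SuspO T F)" using compact_susp[OF *(1)] by (auto simp: approx_def)
qed

text \<open>The compact part is zero and the error term is \<open>F\<close> itself.\<close>

lemma approx_of_le:
  assumes "F \<in> T_le T L n"
  shows "approx TYPE('u) (- n) F"
proof -
  obtain Z where Z: "zero_object T Z" using ex_zero_object by blast
  have "F \<in> Obj T" using assms by (simp add: in_le)
  then have "is_tri Z F F" using triangle_zero_id[OF _ Z] unfolding is_tri_def by blast
  then show ?thesis using compact_zero[OF Z] assms by (auto simp: approx_def)
qed

lemma approx_zero: "zero_object T Z \<Longrightarrow> approx TYPE('u) m Z"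
  using approx_of_le[OF le_zero, of Z "- m"] by simp

text \<open>The approximation of \<open>Y\<close> is chosen after that of \<open>X\<close>, and so fine that the map from \<open>X\<close> to
  \<open>Y\<close> lifts to the compact approximations; the cone of the lift approximates \<open>Z\<close>.\<close>

lemma approx_cone:
  assumes bound: "\<And>E. compact_object TYPE('u) T E \<Longrightarrow> \<exists>B. \<forall>D\<in>T_le T L B. orth E D"
    and t: "is_tri X Y Z" and X: "approx TYPE('u) m X" and Y: "\<And>n. approx TYPE('u) n Y"
  shows "approx TYPE('u) (m + 1) Z"
proof -
  obtain a b c where abc: "triangle a b c X Y Z" using t by (auto simp: is_tri_def)
  obtain KX DX f g h where KX: "compact_object TYPE('u) T KX" and DX: "DX \<in> T_le T L (- m)"
    and tX: "triangle f g h KX X DX" using X by (auto simp: approx_def is_tri_def)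
  obtain B where B: "\<forall>D\<in>T_le T L B. orth KX D" using bound[OF KX] by blast
  \<comment> \<open>\<open>- B\<close> makes the error term \<open>DY\<close> orthogonal to
    \<open>KX\<close>, so that the map lifts; \<open>m + 1\<close> is the accuracy wanted in the
    end.\<close>
  obtain KY DY f' g' h' where KY: "compact_object TYPE('u) T KY"
    and DY: "DY \<in> T_le T L (- max (m + 1) (- B))" and tY: "triangle f' g' h' KY Y DY"
    using Y[of "max (m + 1) (- B)"] by (auto simp: approx_def is_tri_def)
  note dX = triangleD[OF tX] and dY = triangleD[OF tY] and d = triangleD[OF abc]
  have af: "a \<bullet> f \<in> Hom T KX Y" using comp_in_hom[OF dX(2) d(2)] .
  have "DY \<in> T_le T L B" using le_mono[OF DY] by simp
  then have "orth KX DY" using B by blast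
  then have "g' \<bullet> (a \<bullet> f) = Zero T KX DY" using orthD comp_in_hom[OF af dY(3)] by blast
  then obtain e where e: "e \<in> Hom T KX KY" "f' \<bullet> e = a \<bullet> f" using lift_first[OF tY af] by blast
  obtain KZ i j where tE: "triangle e i j KX KY KZ" using triangle_cone[OF e(1)] by blast
  \<comment> \<open>The map \<open>a \<bullet> f\<close> from \<open>KX\<close> to \<open>Y\<close>
    also equals \<open>f' \<bullet> e\<close>. Its two factorizations place the cone
    \<open>C\<close> between \<open>KZ\<close> and \<open>DY\<close> and between \<open>DX\<close>
    and \<open>Z\<close>.\<close>
  obtain C k l where tC: "triangle (a \<bullet> f) k l KX Y C" using triangle_cone[OF af] by blast
  obtain u v w where oct1: "triangle u v w KZ C DY"
    using octahedron[OF tE tY] tC e(2) by fastforce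
  obtain u' v' w' where oct2: "triangle u' v' w' DX C Z"
    using octahedron[OF tX abc tC] by blast
  \<comment> \<open>The approximation of \<open>Z\<close> is the composite \<open>KZ\<close> ->
    \<open>C\<close> -> \<open>Z\<close>. Its cone \<open>Q\<close> is an extension of the
    suspension of \<open>DX\<close> by \<open>DY\<close>, and this suspension is the gain of one
    degree.\<close>
  obtain Q p q where tQ: "triangle (v' \<bullet> u) p q KZ Z Q"
    using triangle_cone[OF comp_in_hom[OF triangleD(2)[OF oct1] triangleD(3)[OF oct2]]] by blast
  obtain u'' v'' w'' where "triangle u'' v'' w'' DY Q (SuspO T DX)"
    using octahedron[OF oct1 triangle_rotate[OF oct2] tQ] by blast
  then have t3: "is_tri DY Q (SuspO T DX)" by (auto simp: is_tri_def)
  have "DY \<in> T_le T L (- (m + 1))" using le_mono[OF DY] by simp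
  moreover have "SuspO T DX \<in> T_le T L (- (m + 1))" using DX susp_in_le[OF dX(7)] by simp
  ultimately have "Q \<in> T_le T L (- (m + 1))" using le_extension[OF t3] by blast
  moreover have "compact_object TYPE('u) T KZ"
    using compact_cone[OF _ KX KY] tE by (auto simp: is_tri_def)
  moreover have "is_tri KZ Z Q" using tQ by (auto simp: is_tri_def)
  ultimately show ?thesis by (auto simp: approx_def)
qed

lemma tri_closed_T_minus_c:
  assumes "\<And>E. compact_object TYPE('u) T E \<Longrightarrow> \<exists>B. \<forall>D\<in>T_le T L B. orth E D"
  shows "tri_closed (T_minus_c TYPE('u) T L)"
  unfolding tri_closed_def T_minus_c_eq
proof (intro conjI allI ballI impI)
  show "{F. \<forall>m. approx TYPE('u) m F} \<subseteq> Obj T" using approx_obj by blast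
  show "Y \<in> {F. \<forall>m. approx TYPE('u) m F}"
    if "X \<in> {F. \<forall>m. approx TYPE('u) m F}" "isomorphic T X Y" for X Y
    using that approx_iso by blast
  show "Z \<in> {F. \<forall>m. approx TYPE('u) m F}" if "zero_object T Z" for Z
    using that approx_zero by blast
  show "SuspO T X \<in> {F. \<forall>m. approx TYPE('u) m F} \<longleftrightarrow> X \<in> {F. \<forall>m. approx TYPE('u) m F}" if "X \<in> Obj T" for X
    unfolding mem_Collect_eq approx_susp_iff[OF that] by (metis add_diff_cancel_right')
  show "Z \<in> {F. \<forall>m. approx TYPE('u) m F}"
    if "is_tri X Y Z" "X \<in> {F. \<forall>m. approx TYPE('u) m F}" "Y \<in> {F. \<forall>m. approx TYPE('u) m F}" for X Y Z
  proof -
    have "approx TYPE('u) (m - 1 + 1) Z" for m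
      by (rule approx_cone[OF assms that(1)]) (use that(2,3) in auto)
    then show ?thesis by simp
  qed
qed

text \<open>Either summand is the cone of a map from the other one to \<open>Z\<close>, so each gain in the
  approximation of one summand is passed on to the other.\<close>

lemma T_minus_c_summand:
  assumes bound: "\<And>E. compact_object TYPE('u) T E \<Longrightarrow> \<exists>B. \<forall>D\<in>T_le T L B. orth E D"
    and Z: "Z \<in> T_minus_c TYPE('u) T L" and bi: "is_biproduct T X Y Z"
    and X: "X \<in> T_minus T L" and Y: "Y \<in> T_minus T L"
  shows "X \<in> T_minus_c TYPE('u) T L"
proof -
  have Za: "approx TYPE('u) n Z" for n using Z by (simp add: T_minus_c_eq)
  obtain k l where kl: "X \<in> T_le T L k" "Y \<in> T_le T L l" using X Y by (auto simp: in_T_minus)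
  then have ob: "X \<in> Obj T" "Y \<in> Obj T" by (auto simp: in_le)
  have tX: "is_tri Y Z X" and tY: "is_tri X Z Y"
    using bi biproduct_sym[OF bi] is_tri_biproduct ob by (auto simp: is_biproduct_def)
  \<comment> \<open>The start is free: both summands lie below \<open>max k l\<close>, so zero is an
    admissible compact part for each. Both are carried along since each step uses the other
    summand.\<close>
  have "approx TYPE('u) (int n - max k l) X \<and> approx TYPE('u) (int n - max k l) Y" for n
  proof (induction n)
    case 0
    show ?case
      using approx_of_le[OF le_mono[OF kl(1)], of "max k l"] approx_of_le[OF le_mono[OF kl(2)], of "max k l"]
      by simp
  next
    case (Suc n)
    have "int (Suc n) - max k l = (int n - max k l) + 1" by simp
    then show ?case
      using approx_cone[OF bound tX _ Za] approx_cone[OF bound tY _ Za] Suc by metis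
  qed
  then have *: "approx TYPE('u) (int n - max k l) X" for n by blast
  have "approx TYPE('u) m X" for m
    by (rule approx_mono[OF *[of "nat (m + max k l)"]]) simp
  then show ?thesis by (simp add: T_minus_c_eq)
qed

text \<open>A single approximation is enough: it presents \<open>F\<close> as an extension of an
  object of the aisle by a compact object.\<close>

lemma T_minus_c_subset:
  assumes "\<And>E. compact_object TYPE('u) T E \<Longrightarrow> E \<in> T_minus T L"
  shows "T_minus_c TYPE('u) T L \<subseteq> T_minus T L"
proof
  fix F assume "F \<in> T_minus_c TYPE('u) T L"
  then have "approx TYPE('u) 0 F" by (simp add: T_minus_c_eq)
  then obtain E D where ED: "compact_object TYPE('u) T E" "D \<in> T_le T L 0" "is_tri E F D"
    by (auto simp: approx_def)
  obtain n where "E \<in> T_le T L n" using assms[OF ED(1)] by (auto simp: in_T_minus)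
  then have "E \<in> T_le T L (max n 0)" "D \<in> T_le T L (max n 0)"
    using le_mono[of E n] le_mono[OF ED(2)] by simp_all
  then show "F \<in> T_minus T L" using le_extension[OF ED(3)] by (auto simp: in_T_minus)
qed

section \<open>Bounds for compact objects from those for the generator\<close>

lemma compact_orth_le:
  assumes nat: "small TYPE('u) (UNIV :: nat set)" and ls: "locally_small TYPE('u) T"
    and cop: "has_coproducts TYPE('u) T" and gen: "compact_generator TYPE('u) T G"
    and G: "\<And>X. X \<in> L \<Longrightarrow> orth (shift T (- A) G) X" and E: "compact_object TYPE('u) T E"
  shows "\<exists>B. \<forall>D\<in>T_le T L B. orth E D"
proof (rule ccontr)
  assume "\<not> ?thesis"
  then have "\<forall>n :: nat. \<exists>D. D \<in> T_le T L (- int n) \<and> \<not> orth E D" by blast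
  then obtain D :: "nat \<Rightarrow> 'a" where D: "\<And>n. D n \<in> T_le T L (- int n)" "\<And>n. \<not> orth E (D n)" by metis
  have Do: "D n \<in> Obj T" for n using D(1)[of n] by (simp add: in_le)
  have Go: "G \<in> Obj T" using gen compact_obj by (auto simp: compact_generator_def)
  have "finite {n. \<not> orth (shift T k G) (D n)}" for k
  proof (rule finite_subset)
    \<comment> \<open>Moving the shift by \<open>A + k\<close> to the other side turns
      \<open>shift T k G\<close> into \<open>shift T (- A) G\<close>; the shifted \<open>D n\<close>
      lies in \<open>L\<close> once \<open>n\<close> is at least \<open>A + k\<close>.\<close>
    show "{n. \<not> orth (shift T k G) (D n)} \<subseteq> {..nat (A + k)}"
    proof clarify
      fix n assume n: "\<not> orth (shift T k G) (D n)"
      show "n \<le> nat (A + k)"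
      proof (rule ccontr)
        assume "\<not> n \<le> nat (A + k)"
        then have "D n \<in> T_le T L (0 + - (A + k))" using le_mono[OF D(1)[of n]] by simp
        then have "shift T (- (A + k)) (D n) \<in> L" using shift_in_le[OF Do] le_0 by metis
        then have "orth (shift T (- A) G) (shift T (- (A + k)) (D n))" by (rule G)
        then have "orth (shift T (A + k) (shift T (- A) G)) (D n)"
          using orth_shift_left Go Do by simp
        then show False using n shift_add[OF Go, of "A + k" "- A"] by simp
      qed
    qed
  qed simp
  then have "finite {n. \<not> orth E (D n)}" by (rule compact_almost_orth[OF nat ls cop gen E Do])
  then show False using D(2) by simp
qed

lemma compact_in_T_minus:
  assumes nat: "small TYPE('u) (UNIV :: nat set)" and ls: "locally_small TYPE('u) T"
    and cop: "has_coproducts TYPE('u) T" and gen: "compact_generator TYPE('u) T G"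
    and G: "G \<in> T_minus T L" and E: "compact_object TYPE('u) T E"
  shows "E \<in> T_minus T L"
proof (rule ccontr)
  assume "E \<notin> T_minus T L"
  \<comment> \<open>If \<open>E\<close> lies in no level of the aisle, then for every
    \<open>n\<close> the orthogonality criterion fails on some object of the coaisle starting in
    degree \<open>n + 1\<close>.\<close>
  then have "\<forall>n :: nat. \<exists>Y. Y \<in> T_ge T R (int n + 1) \<and> \<not> orth E Y"
    using compact_obj[OF E] by (auto simp: in_T_minus le_iff_orth)
  then obtain D :: "nat \<Rightarrow> 'a" where D: "\<And>n. D n \<in> T_ge T R (int n + 1)" "\<And>n. \<not> orth E (D n)" by metis
  have Do: "D n \<in> Obj T" for n using D(1)[of n] by (simp add: in_ge)
  obtain j where j: "G \<in> T_le T L j" using G by (auto simp: in_T_minus)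
  then have Go: "G \<in> Obj T" by (simp add: in_le)
  have "finite {n. \<not> orth (shift T k G) (D n)}" for k
  proof (rule finite_subset)
    \<comment> \<open>The degrees of \<open>D n\<close> go up while the shift of \<open>G\<close>
      stays below \<open>j - k\<close>, so every \<open>n\<close> at or above \<open>j - k\<close>
      gives orthogonality.\<close>
    have "shift T k G \<in> T_le T L (j - k)" using shift_in_le[OF Go] j by simp
    then have "orth (shift T k G) (D n)" if "\<not> n \<le> nat (j - k)" for n
      using orth_le_ge[OF _ D(1)] that by simp
    then show "{n. \<not> orth (shift T k G) (D n)} \<subseteq> {..nat (j - k)}" by blast
  qed simp
  then have "finite {n. \<not> orth E (D n)}" by (rule compact_almost_orth[OF nat ls cop gen E Do])
  then show False using D(2) by simp
qed

end

section \<open>The triangulated and thick subcategories\<close>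

theorem proposition0p23:
  fixes T :: "('o, 'm) tri_data" and L R :: "'o set" and A :: int and G :: 'o
  assumes "small TYPE('u) (UNIV :: nat set)"
    and "triangulated_category T"
    and "locally_small TYPE('u) T"
    and "has_coproducts TYPE('u) T"
    and "t_structure T L R"
    and "A > 0"
    and "compact_generator TYPE('u) T G"
    and "\<forall>X \<in> L. Hom T (shift T (- A) G) X = {Zero T (shift T (- A) G) X}"
  shows "T_b_c TYPE('u) T L R \<subseteq> T_minus_c TYPE('u) T L
    \<and> triangulated_subcategory T (T_b_c TYPE('u) T L R)
    \<and> triangulated_subcategory T (T_minus_c TYPE('u) T L)
    \<and> (G \<in> T_minus T L \<longrightarrow>
        thick_subcategory_of T (T_minus T L) (T_b_c TYPE('u) T L R)
        \<and> thick_subcategory_of T (T_minus T L) (T_minus_c TYPE('u) T L))"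
proof -
  interpret t_structured T L R
    using assms(2,5) by (simp add: t_structured_def t_structured_axioms_def)
  have G: "orth (shift T (- A) G) X" if "X \<in> L" for X
    using assms(8) that by (auto simp: orth_def)
  have bound: "\<exists>B. \<forall>D\<in>T_le T L B. orth E D" if "compact_object TYPE('u) T E" for E
    by (rule compact_orth_le[OF assms(1,3,4,7) G that])
  have c: "tri_closed (T_minus_c TYPE('u) T L)" by (rule tri_closed_T_minus_c[OF bound])
  have b: "tri_closed (T_b_c TYPE('u) T L R)"
    unfolding T_b_c_def T_b_def
    by (intro tri_closed_Int c tri_closed_T_minus tri_closed_T_plus)
  show ?thesis
  proof (intro conjI impI)
    assume "G \<in> T_minus T L"
    then have "T_minus_c TYPE('u) T L \<subseteq> T_minus T L"
      using compact_in_T_minus[OF assms(1,3,4,7)] T_minus_c_subset[where 'u = 'u] by blast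
    \<comment> \<open>For the bounded subcategory a summand also has to be bounded below, which it
      inherits from \<open>Z\<close>; being bounded above is given by the ambient category.\<close>
    moreover have "X \<in> T_plus T R" if "is_biproduct T X Y Z" "X \<in> T_minus T L" "Z \<in> T_plus T R" for X Y Z
      using ge_summand[OF that(1)] that(2,3) by (auto simp: in_T_plus in_T_minus in_le)
    ultimately show "thick_subcategory_of T (T_minus T L) (T_b_c TYPE('u) T L R)"
      and "thick_subcategory_of T (T_minus T L) (T_minus_c TYPE('u) T L)"
      using b c T_minus_c_summand[OF bound] tri_closed_imp_triangulated tri_closed_T_minus
      unfolding thick_subcategory_of_def T_b_c_def T_b_def by blast+
  qed (use b c tri_closed_imp_triangulated in \<open>auto simp: T_b_c_def\<close>)
qed

end
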